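(* Assume $R$ has $n$ rows (and $m$ columns). Let $\lambda_+/\lambda_-$ be a diagonal of $R$ and $w\in S_n$. Then $T^{\lambda_+}_w$ is the restriction to $\lambda_+$ of the insertion tableau of the word $$\mathrm{aug}(w)=w(1),w(1)+n,\dots,w(1)+(m-1)n,\ w(2),w(2)+n,\dots,w(2)+(m-1)n,\ \dots,\ w(n),w(n)+n,\dots,w(n)+(m-1)n.$$
   Context: Fix integers $m\ge n\ge 1$; $R$ is a rectangular Young diagram. English convention (row $1$ on top); "above" = smaller row index, "right" = larger column index. A diagonal of $R$ is a skew shape $\lambda_+/\lambda_-$ ($\lambda_-\subseteq\lambda_+\subseteq R$ Young diagrams) consisting of exactly $n$ boxes $b_1,\dots,b_n$, $b_{i+1}$ strictly above and strictly right of $b_i$. $T[x]$ is the entry of $T$ in box $x$. Insertion tableau means the RSK row-insertion tableau. Sliding an empty box through a filling strictly increasing along rows and columns: while the empty box has a filled neighbour immediately right or immediately below, move the smaller such entry into it; where it ends is the final position of the sliding path. $T^{\lambda_+}_w$: start with $T[b_i]=w(i)$ ($i=1,\dots,n$), boxes of $\lambda_-$ unfilled. While not all boxes of $\lambda_+$ are filled: choose a corner box $x$ of the Young diagram of unfilled boxes (removing $x$ leaves a Young diagram), slide $x$ through $T$, and if the final position of the path is $b_i$ put $T[b_i]+n$ into $b_i$ ($T[b_i]$ the entry of $b_i$ before the slide). The resulting filling of $\lambda_+$ is $T^{\lambda_+}_w$; it is independent of the choices made. *)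

theory Defs
  imports "HOL-Combinatorics.Permutations"
begin

text \<open>A box is a pair (row, column), both starting from 1, with row 1 on top.\<close>

type_synonym box = "nat \<times> nat"

definition young_diagram :: "box set \<Rightarrow> bool" where
  "young_diagram L \<longleftrightarrow> finite L \<and> L \<subseteq> {1..} \<times> {1..} \<and>
     (\<forall>(i, j)\<in>L. {1..i} \<times> {1..j} \<subseteq> L)"

definition corner :: "box set \<Rightarrow> box \<Rightarrow> bool" where
  "corner L x \<longleftrightarrow> x \<in> L \<and> young_diagram (L - {x})"

definition right_of :: "box \<Rightarrow> box" where
  "right_of x = (fst x, Suc (snd x))"

definition below :: "box \<Rightarrow> box" where
  "below x = (Suc (fst x), snd x)"

text \<open>The boxes \<open>b 1, \<dots>, b n\<close> are determined by \<open>lp - lm\<close>; only the values of \<open>b\<close>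
  on \<open>{1..n}\<close> matter.\<close>

definition is_diagonal :: "nat \<Rightarrow> box set \<Rightarrow> box set \<Rightarrow> box set \<Rightarrow> (nat \<Rightarrow> box) \<Rightarrow> bool" where
  "is_diagonal n R lp lm b \<longleftrightarrow>
     young_diagram lp \<and> young_diagram lm \<and> lm \<subseteq> lp \<and> lp \<subseteq> R \<and>
     lp - lm = b ` {1..n} \<and>
     (\<forall>i\<in>{1..<n}. fst (b (Suc i)) < fst (b i) \<and> snd (b i) < snd (b (Suc i)))"

text \<open>Partial fillings are maps; \<open>None\<close> means that the box is unfilled.
  \<open>slides T x T' y\<close>: sliding the empty box \<open>x\<close> through \<open>T\<close> ends with the empty box at \<open>y\<close>
  and leaves the filling \<open>T'\<close>, in which \<open>y\<close> is unfilled.\<close>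

inductive slides :: "(box \<rightharpoonup> nat) \<Rightarrow> box \<Rightarrow> (box \<rightharpoonup> nat) \<Rightarrow> box \<Rightarrow> bool" where
  stop: "T (right_of x) = None \<Longrightarrow> T (below x) = None \<Longrightarrow> slides T x T x"
| move_right: "T (right_of x) = Some a \<Longrightarrow> (\<And>c. T (below x) = Some c \<Longrightarrow> a < c) \<Longrightarrow>
    slides (T(x := Some a, right_of x := None)) (right_of x) T' y \<Longrightarrow> slides T x T' y"
| move_below: "T (below x) = Some a \<Longrightarrow> (\<And>c. T (right_of x) = Some c \<Longrightarrow> a < c) \<Longrightarrow>
    slides (T(x := Some a, below x := None)) (below x) T' y \<Longrightarrow> slides T x T' y"

inductive fill_step :: "nat \<Rightarrow> box set \<Rightarrow> (nat \<Rightarrow> box) \<Rightarrow> (box \<rightharpoonup> nat) \<Rightarrow> (box \<rightharpoonup> nat) \<Rightarrow> bool"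
  for n :: nat and lp :: "box set" and b :: "nat \<Rightarrow> box" where
  refill: "corner (lp - dom T) x \<Longrightarrow> slides T x T' (b i) \<Longrightarrow> i \<in> {1..n} \<Longrightarrow> T (b i) = Some e \<Longrightarrow>
    fill_step n lp b T (T'(b i := Some (e + n)))"
| no_refill: "corner (lp - dom T) x \<Longrightarrow> slides T x T' y \<Longrightarrow> y \<notin> b ` {1..n} \<Longrightarrow>
    fill_step n lp b T T'"

definition initial_filling :: "nat \<Rightarrow> (nat \<Rightarrow> box) \<Rightarrow> (nat \<Rightarrow> nat) \<Rightarrow> (box \<rightharpoonup> nat)" where
  "initial_filling n b w = map_of (map (\<lambda>i. (b i, w i)) [1..<Suc n])"

text \<open>The procedure involves choices, so it is a relation: \<open>T\<close> is the outcome of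
  some complete run that starts from the diagonal filled with \<open>w\<close>.\<close>

definition slide_filling ::
    "nat \<Rightarrow> box set \<Rightarrow> (nat \<Rightarrow> box) \<Rightarrow> (nat \<Rightarrow> nat) \<Rightarrow> (box \<rightharpoonup> nat) \<Rightarrow> bool" where
  "slide_filling n lp b w T \<longleftrightarrow>
     (fill_step n lp b)\<^sup>*\<^sup>* (initial_filling n b w) T \<and> lp \<subseteq> dom T"

text \<open>RSK row insertion; a tableau is its list of rows from top to bottom. The second component
  of \<open>row_insert x r\<close> is the entry bumped out of the row, if any.\<close>

fun row_insert :: "nat \<Rightarrow> nat list \<Rightarrow> nat list \<times> nat option" where
  "row_insert x [] = ([x], None)"
| "row_insert x (y # ys) =
     (if x < y then (x # ys, Some y) else (let (zs, u) = row_insert x ys in (y # zs, u)))"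

fun tableau_insert :: "nat \<Rightarrow> nat list list \<Rightarrow> nat list list" where
  "tableau_insert x [] = [[x]]"
| "tableau_insert x (r # rs) =
     (case row_insert x r of
        (r', None) \<Rightarrow> r' # rs
      | (r', Some y) \<Rightarrow> r' # tableau_insert y rs)"

definition insertion_rows :: "nat list \<Rightarrow> nat list list" where
  "insertion_rows u = fold tableau_insert u []"

definition filling_of_rows :: "nat list list \<Rightarrow> (box \<rightharpoonup> nat)" where
  "filling_of_rows P = (\<lambda>(i, j).
     if i \<in> {1..length P} \<and> j \<in> {1..length (P ! (i - 1))} then Some (P ! (i - 1) ! (j - 1))
     else None)"

definition insertion_tableau :: "nat list \<Rightarrow> (box \<rightharpoonup> nat)" where
  "insertion_tableau u = filling_of_rows (insertion_rows u)"

definition aug :: "nat \<Rightarrow> nat \<Rightarrow> (nat \<Rightarrow> nat) \<Rightarrow> nat list" where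
  "aug n m w = concat (map (\<lambda>i. map (\<lambda>k. w i + k * n) [0..<m]) [1..<Suc n])"

end

theory Submission
  imports Defs "HOL-Library.Multiset"
begin

text \<open>
  Give the letter \<open>w i + k * n\<close> the class \<open>i\<close>. Both the slide filling and the insertion tableau are
  determined by the row of each letter, and both make sense when the sequence of classes of the
  letters \<open>1, 2, 3, \<dots>\<close> is an arbitrary word, the box \<open>b i\<close> being refilled with the next letter of
  class \<open>i\<close>. In both cases the rows obey the same local rules: for consecutive letters the order of
  their classes decides which of them is in the higher row, every letter below the first row has a
  smaller letter one row above, and a Knuth move on the class word either carries the rows along
  or, if the two exchanged letters compete for the same place, permutes them cyclically. These rules
  determine all rows: for a permutation \<open>s\<close> and suitable decreasing columns \<open>C\<close>, the word \<open>s\<^sup>M C\<close>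
  is Knuth equivalent to \<open>C (n \<dots> 2 1)\<^sup>M\<close>, where the rows are forced, and the two alternatives of a
  Knuth move are distinguished by the rule for consecutive letters. Counting the letters in each row
  along the same moves shows that the letters up to \<open>m * n\<close> fill at least the boxes of \<open>lp\<close>.
\<close>

section \<open>Words of classes\<close>

text \<open>On the insertion side this is the classical correspondence read backwards: listing the
  letters class by class inverts the standardization of the class word, so the insertion tableau is
  the recording tableau of the class word, and Knuth moves on classes act on it as dual Knuth moves.
  For sliding only local rules are verified, which is why the two sides are compared through axioms
  on rows. The obstacle is that a power of \<open>s\<close> alone is in general not Knuth equivalent
  to a power of \<open>n ... 2 1\<close>. Columns placed behind it cure this, and they do no harm,
  because they concern letters larger than all those of interest. Their heights are the
  \<open>d\<close> that precede \<open>d + 1\<close> in \<open>s\<close>: when the letters of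
  \<open>s\<close> are absorbed from right to left, each \<open>a > 1\<close> lengthens the column
  of height \<open>a - 1\<close>, and this choice makes that column available exactly when
  \<open>a\<close> arrives. Rows suffice to recover boxes, since a row lists its letters in
  increasing order.\<close>

definition between :: "nat \<Rightarrow> nat \<Rightarrow> nat \<Rightarrow> bool" where
  "between p q s \<longleftrightarrow> q < p \<and> p < s \<or> s < p \<and> p < q"

text \<open>The Knuth relations. The witness \<open>p\<close> has the lowest of the three positions
  here and the highest in \<open>high_move\<close>. The parameter \<open>f\<close> lets one
  definition act on words (with \<open>id\<close>) and on tokens that carry rows (with
  \<open>fst\<close>).\<close>

inductive low_move :: "('a \<Rightarrow> nat) \<Rightarrow> 'a list \<Rightarrow> 'a list \<Rightarrow> bool" for f where
  "between (f p) (f q) (f s) \<Longrightarrow> low_move f (x @ [p, q, s] @ y) (x @ [p, s, q] @ y)"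

inductive high_move :: "('a \<Rightarrow> nat) \<Rightarrow> 'a list \<Rightarrow> 'a list \<Rightarrow> bool" for f where
  "between (f p) (f q) (f s) \<Longrightarrow> high_move f (x @ [q, s, p] @ y) (x @ [s, q, p] @ y)"

definition word_move :: "nat list \<Rightarrow> nat list \<Rightarrow> bool" where
  "word_move u v \<longleftrightarrow> low_move id u v \<or> high_move id u v"

abbreviation word_equiv :: "nat list \<Rightarrow> nat list \<Rightarrow> bool" (infix "\<approx>" 50) where
  "u \<approx> v \<equiv> word_move\<^sup>*\<^sup>* u v"

lemma low_move_context:
  assumes "low_move f u v" shows "low_move f (x @ u @ y) (x @ v @ y)"
  using assms
proof cases
  case (1 p q s x' y')
  show ?thesis unfolding 1 using low_move.intros[of f p q s "x @ x'" "y' @ y"] 1(3) by simp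
qed

lemma high_move_context:
  assumes "high_move f u v" shows "high_move f (x @ u @ y) (x @ v @ y)"
  using assms
proof cases
  case (1 p q s x' y')
  show ?thesis unfolding 1 using high_move.intros[of f p q s "x @ x'" "y' @ y"] 1(3) by simp
qed

lemma low_moves_context: "(low_move f)\<^sup>*\<^sup>* u v \<Longrightarrow> (low_move f)\<^sup>*\<^sup>* (x @ u @ y) (x @ v @ y)"
  by (induction rule: rtranclp_induct) (auto dest: low_move_context[of _ _ _ x y])

lemma word_equiv_context: "u \<approx> v \<Longrightarrow> x @ u @ y \<approx> x @ v @ y"
proof (induction rule: rtranclp_induct)
  case (step v w)
  then have "word_move (x @ v @ y) (x @ w @ y)"
    using low_move_context high_move_context unfolding word_move_def by blast
  with step.IH show ?case
    by (rule rtranclp.rtrancl_into_rtrancl)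
qed auto

lemma low_moves_word_equiv: "(low_move id)\<^sup>*\<^sup>* u v \<Longrightarrow> u \<approx> v"
  by (induction rule: rtranclp_induct) (auto simp: word_move_def intro: rtranclp.rtrancl_into_rtrancl)

lemma word_equiv_Cons: "u \<approx> v \<Longrightarrow> a # u \<approx> a # v"
  using word_equiv_context[of u v "[a]" "[]"] by simp

lemma word_equiv_append_left: "u \<approx> v \<Longrightarrow> x @ u \<approx> x @ v"
  using word_equiv_context[of u v x "[]"] by simp

lemma word_equiv_append_right: "u \<approx> v \<Longrightarrow> u @ y \<approx> v @ y"
  using word_equiv_context[of u v "[]" y] by simp

section \<open>Decreasing columns under Knuth moves\<close>

fun down :: "nat \<Rightarrow> nat list" where
  "down 0 = []"
| "down (Suc d) = Suc d # down d"

lemma length_down [simp]: "length (down d) = d"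
  by (induction d) auto

lemma nth_down: "k < d \<Longrightarrow> down d ! k = d - k"
  by (induction d arbitrary: k) (auto simp: nth_Cons split: nat.splits)

lemma set_down: "set (down d) = {1..d}"
  by (induction d) auto

text \<open>Each entry of the run is smaller than the letter before it, which in turn is smaller
  than \<open>z\<close>; that preceding letter is the witness with which \<open>z\<close> passes the
  entry. Restricting to low moves pays off later, since these carry the rows along.\<close>

lemma low_moves_past_down:
  assumes "map f t = down d" "d < f y" "f y < f z"
  shows "(low_move f)\<^sup>*\<^sup>* (y # t @ [z]) (y # z # t)"
  using assms
proof (induction d arbitrary: t y)
  case 0
  then show ?case by simp
next
  case (Suc d)
  then obtain t1 t' where t: "t = t1 # t'" "f t1 = Suc d" "map f t' = down d"
    by (cases t) auto
  have "(low_move f)\<^sup>*\<^sup>* (t1 # t' @ [z]) (t1 # z # t')"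
    using Suc.prems t by (intro Suc.IH) auto
  then have "(low_move f)\<^sup>*\<^sup>* (y # t @ [z]) (y # t1 # z # t')"
    using low_moves_context[of f _ _ "[y]" "[]"] t by fastforce
  moreover have "low_move f (y # t1 # z # t') (y # z # t1 # t')"
    using low_move.intros[of f y t1 z "[]" t'] Suc.prems t by (auto simp: between_def)
  ultimately show ?case
    using t by auto
qed

lemma low_moves_increasing_past_down:
  assumes "map f t = down d" "d < f y" "sorted_wrt (<) (map f (y # zs))"
  shows "(low_move f)\<^sup>*\<^sup>* (y # t @ zs) (y # zs @ t)"
  using assms
proof (induction zs arbitrary: y)
  case Nil
  then show ?case by simp
next
  case (Cons z zs)
  have "(low_move f)\<^sup>*\<^sup>* (y # t @ [z]) (y # z # t)"
    using Cons.prems by (intro low_moves_past_down) auto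
  then have "(low_move f)\<^sup>*\<^sup>* (y # t @ z # zs) (y # z # t @ zs)"
    using low_moves_context[of f _ _ "[]" zs] by fastforce
  moreover have "(low_move f)\<^sup>*\<^sup>* (z # t @ zs) (z # zs @ t)"
    using Cons.prems by (intro Cons.IH) auto
  then have "(low_move f)\<^sup>*\<^sup>* (y # z # t @ zs) (y # z # zs @ t)"
    using low_moves_context[of f _ _ "[y]" "[]"] by fastforce
  ultimately show ?case by simp
qed

text \<open>The heads increase, so each head passes the tails of all earlier columns. What is left
  behind the heads is again a list of columns, each shorter by one, which permits induction on
  heights.\<close>

lemma low_moves_heads_first:
  assumes "list_all2 (\<lambda>r d. map f r = down (Suc d)) rs ds" "sorted_wrt (<) ds"
  shows "(low_move f)\<^sup>*\<^sup>* (concat rs) (map hd rs @ concat (map tl rs))"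
  using assms
proof (induction rs ds rule: list_all2_induct)
  case Nil
  then show ?case by simp
next
  case (Cons r rs d ds)
  then obtain y t where r: "r = y # t" "f y = Suc d" "map f t = down d"
    by (cases r) auto
  have hds: "map f (map hd rs) = map Suc ds"
    using Cons.hyps(2)
  proof (induction rs ds rule: list_all2_induct)
    case (Cons x xs y ys)
    then show ?case by (cases x) auto
  qed auto
  have "(low_move f)\<^sup>*\<^sup>* (concat rs) (map hd rs @ concat (map tl rs))"
    using Cons by simp
  then have "(low_move f)\<^sup>*\<^sup>* (r @ concat rs) (r @ map hd rs @ concat (map tl rs))"
    using low_moves_context[of f _ _ r "[]"] by fastforce
  moreover have "(low_move f)\<^sup>*\<^sup>* (y # t @ map hd rs) (y # map hd rs @ t)"
  proof (rule low_moves_increasing_past_down)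
    have "sorted_wrt (<) (map Suc (d # ds))"
      using Cons.prems by (simp add: sorted_wrt_map)
    then show "sorted_wrt (<) (map f (y # map hd rs))"
      using hds r by simp
  qed (use r in auto)
  then have "(low_move f)\<^sup>*\<^sup>* (r @ map hd rs @ concat (map tl rs))
      (y # map hd rs @ t @ concat (map tl rs))"
    using low_moves_context[of f _ _ "[]" "concat (map tl rs)"] r by fastforce
  ultimately show ?case
    using r by simp
qed

lemma word_equiv_high: "between p q s \<Longrightarrow> q # s # p # y \<approx> s # q # p # y"
  using high_move.intros[of id p q s "[]" y] by (auto simp: word_move_def)

lemma down_down_equiv:
  assumes "d < e"
  shows "down (Suc d) @ down (Suc e) \<approx> Suc d # Suc e # down d @ down e"
proof -
  have "(low_move id)\<^sup>*\<^sup>* (concat [down (Suc d), down (Suc e)])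
     (map hd [down (Suc d), down (Suc e)] @ concat (map tl [down (Suc d), down (Suc e)]))"
    by (rule low_moves_heads_first[of _ _ "[d, e]"]) (use assms in auto)
  then show ?thesis
    using low_moves_word_equiv by simp
qed

text \<open>With both heads in front, the letters \<open>a\<close>, \<open>Suc d\<close>,
  \<open>e\<close> meet and \<open>e\<close> is the witness of a high move. The induction hypothesis
  is then used twice: for \<open>e\<close>, to rebuild its column, and for \<open>a\<close>, to pass
  the rest of the shorter column.\<close>

lemma letter_past_down:
  assumes "d < e" "e < a"
  shows "a # down d @ down e \<approx> down d @ a # down e"
  using assms
proof (induction d arbitrary: e a)
  case 0
  then show ?case by simp
next
  case (Suc d)
  then obtain e' where e: "e = Suc e'" "d < e'"
    by (cases e) auto
  have "a # down (Suc d) @ down e \<approx> a # Suc d # e # down d @ down e'"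
    using word_equiv_Cons[OF down_down_equiv[OF e(2)]] e by simp
  also have "\<dots> \<approx> Suc d # a # e # down d @ down e'"
    using Suc.prems by (intro word_equiv_high) (auto simp: between_def)
  also have "\<dots> \<approx> Suc d # a # down d @ e # down e'"
    using Suc.prems e by (intro word_equiv_Cons Suc.IH) auto
  also have "\<dots> = Suc d # a # down d @ down e"
    using e by simp
  also have "\<dots> \<approx> Suc d # down d @ a # down e"
    using Suc.prems by (intro word_equiv_Cons Suc.IH) auto
  finally show ?case by simp
qed

section \<open>Absorbing a permutation into columns\<close>

definition columns :: "nat set \<Rightarrow> nat list" where
  "columns E = concat (map down (sorted_list_of_set E))"

lemma columns_Un:
  assumes "finite A" "finite B" "\<And>x y. x \<in> A \<Longrightarrow> y \<in> B \<Longrightarrow> x < y"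
  shows "columns (A \<union> B) = columns A @ columns B"
proof -
  have "sorted_list_of_set (set (sorted_list_of_set A @ sorted_list_of_set B))
     = sorted_list_of_set A @ sorted_list_of_set B"
    by (rule sorted_list_of_set.idem_if_sorted_distinct)
      (use assms in \<open>auto simp: sorted_append less_imp_le dest: less_imp_neq\<close>)
  then show ?thesis
    using assms by (simp add: columns_def)
qed

lemma columns_empty [simp]: "columns {} = []"
  by (simp add: columns_def)

lemma columns_singleton [simp]: "columns {d} = down d"
  by (simp add: columns_def)

text \<open>To pass a column, \<open>a\<close> needs a taller column right behind it that is still
  shorter than \<open>a\<close>; the next column of the list serves, and \<open>down e\<close>
  closes the list.\<close>

lemma letter_past_columns:
  assumes "sorted_wrt (<) (ds @ [e])" "e < a"
  shows "a # concat (map down ds) @ down e \<approx> concat (map down ds) @ a # down e"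
  using assms
proof (induction ds)
  case Nil
  then show ?case by simp
next
  case (Cons d ds)
  define e' where "e' = hd (ds @ [e])"
  define es where "es = tl (ds @ [e])"
  have es: "ds @ [e] = e' # es"
    unfolding e'_def es_def by (cases ds) auto
  have "\<forall>x\<in>set (ds @ [e]). d < x \<and> x \<le> e"
    using Cons.prems by (auto simp: sorted_wrt_append)
  then have *: "d < e'" "e' < a"
    using Cons.prems(2) unfolding es by auto
  have eq: "concat (map down ds) @ down e = down e' @ concat (map down es)"
    using arg_cong[OF es, of "\<lambda>l. concat (map down l)"] by simp
  have "a # concat (map down (d # ds)) @ down e = (a # down d @ down e') @ concat (map down es)"
    using eq by simp
  also have "\<dots> \<approx> (down d @ a # down e') @ concat (map down es)"
    by (intro word_equiv_append_right letter_past_down *)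
  also have "\<dots> = down d @ (a # concat (map down ds) @ down e)"
    using eq by simp
  also have "\<dots> \<approx> down d @ (concat (map down ds) @ a # down e)"
    using Cons by (intro word_equiv_append_left Cons.IH) auto
  finally show ?case by simp
qed

text \<open>The letter passes all columns shorter than \<open>a - 1\<close> and stops at the one of
  height \<open>a - 1\<close>, where \<open>a # down (a - 1)\<close> is \<open>down a\<close>. For
  \<open>a = 1\<close> it becomes a new column in front. That height \<open>a\<close> is vacant
  keeps the heights distinct.\<close>

lemma letter_into_columns:
  assumes "finite V" "a \<notin> V" "0 < a" "a = 1 \<or> a - 1 \<in> V" "0 \<notin> V"
  shows "a # columns V \<approx> columns (insert a (V - {a - 1}))"
proof -
  define A where "A = {x \<in> V. x < a - 1}"
  define B where "B = {x \<in> V. a < x}"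
  have fin: "finite A" "finite B"
    using assms(1) by (auto simp: A_def B_def)
  have V': "insert a (V - {a - 1}) = A \<union> ({a} \<union> B)"
    using assms by (auto simp: A_def B_def) 
  have cV': "columns (insert a (V - {a - 1})) = columns A @ down a @ columns B"
    unfolding V' using fin
    by (subst columns_Un; (subst columns_Un)?) (auto simp: A_def B_def)
  show ?thesis
  proof (cases "a = 1")
    case True
    then have "A = {}" "V = B"
      using assms unfolding A_def B_def
      by (auto, metis Suc_lessI gr0I)
    then show ?thesis
      using cV' True by simp
  next
    case False
    define e where "e = a - 1"
    have a: "a = Suc e" "e \<in> V"
      using False assms by (auto simp: e_def)
    have "x < e \<or> x = e \<or> Suc e < x" if "x \<in> V" for x
      using that assms(2) a(1) by (metis Suc_lessI linorder_neqE_nat)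
    then have "V = A \<union> ({e} \<union> B)"
      using assms a by (auto simp: A_def B_def)
    then have cV: "columns V = columns A @ down e @ columns B"
      using fin a by (simp only:) (subst columns_Un; (subst columns_Un)?; auto simp: A_def B_def)
    have "a # columns A @ down e \<approx> columns A @ a # down e"
      unfolding columns_def
      by (rule letter_past_columns) (use fin a in \<open>auto simp: sorted_wrt_append A_def\<close>)
    then show ?thesis
      using word_equiv_append_right[of _ _ "columns B"] cV cV' a by fastforce
  qed
qed

text \<open>Inserting the letters of a permutation from right to left into the columns with heights
  \<open>E\<close>, the heights after inserting the letters of \<open>R\<close> are \<open>col_heights n E R\<close>.\<close>

definition col_heights :: "nat \<Rightarrow> nat set \<Rightarrow> nat set \<Rightarrow> nat set" where
  "col_heights n E R = {d \<in> {1..n}. d \<in> R \<and> (Suc d \<in> R \<longrightarrow> d \<in> E) \<or> d \<notin> R \<and> d \<in> E \<and> Suc d \<notin> R}"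

definition ascent_set :: "nat \<Rightarrow> nat list \<Rightarrow> nat set" where
  "ascent_set n s = {d \<in> {1..<n}. \<exists>x y. s = x @ d # y \<and> Suc d \<in> set y}"

lemma ascent_set_suffix:
  assumes "distinct s" "set s = {1..n}" "s = x @ y" "1 \<le> d" "d < n"
  shows "d \<in> ascent_set n s \<Longrightarrow> d \<in> set y \<Longrightarrow> Suc d \<in> set y"
    and "d \<notin> ascent_set n s \<Longrightarrow> Suc d \<in> set y \<Longrightarrow> d \<in> set y"
proof -
  show "Suc d \<in> set y" if "d \<in> ascent_set n s" "d \<in> set y"
  proof -
    from that obtain x' y' where *: "s = x' @ d # y'" "Suc d \<in> set y'"
      by (auto simp: ascent_set_def)
    obtain y1 y2 where y: "y = y1 @ d # y2"
      using \<open>d \<in> set y\<close> by (auto dest: split_list)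
    have "(x @ y1) @ d # y2 = x' @ d # y'"
      using * y assms(3) by simp
    moreover have "d \<notin> set (x @ y1)" "d \<notin> set x'" "d \<notin> set y2" "d \<notin> set y'"
      using assms(1) unfolding assms(3) y using * assms y by auto
    ultimately have "y2 = y'"
      by (metis append_Cons_eq_iff)
    then show ?thesis
      using * y by simp
  qed
  show "d \<in> set y" if "d \<notin> ascent_set n s" "Suc d \<in> set y"
  proof (rule ccontr)
    assume "d \<notin> set y"
    moreover have "d \<in> set s"
      using assms by auto
    ultimately have "d \<in> set x"
      using assms(3) by auto
    then obtain x1 x2 where "x = x1 @ d # x2"
      by (auto dest: split_list)
    then have "s = x1 @ d # (x2 @ y)" "Suc d \<in> set (x2 @ y)"
      using assms(3) that by auto
    then have "d \<in> ascent_set n s"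
      using assms(4,5) unfolding ascent_set_def by (simp, blast)
    then show False
      using that by simp
  qed
qed

text \<open>A column of height \<open>d\<close> is created by the letter \<open>d\<close> and used
  up by \<open>d + 1\<close>. If both have been absorbed, it is present exactly when
  \<open>d\<close> came second from the right, that is, when \<open>d\<close> precedes
  \<open>d + 1\<close> in \<open>s\<close>; \<open>col_heights\<close> records this. An ascent
  \<open>d\<close> has its column from the start, and otherwise \<open>d\<close> creates it before
  \<open>d + 1\<close> arrives.\<close>

lemma suffix_columns_equiv:
  assumes "distinct s" "set s = {1..n}" "s = x @ y" "E = ascent_set n s"
  shows "y @ columns E \<approx> columns (col_heights n E (set y))"
  using assms(3)
proof (induction y arbitrary: x)
  case Nil
  have "col_heights n E {} = E"
    using assms(4) by (auto simp: col_heights_def ascent_set_def)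
  then show ?case by simp
next
  case (Cons a y)
  let ?V = "col_heights n E (set y)"
  have s: "s = (x @ [a]) @ y"
    using Cons.prems by simp
  have a: "a \<in> {1..n}" "a \<notin> set y"
    using Cons.prems assms(1,2) by auto
  have E: "E \<subseteq> {1..<n}"
    using assms(4) by (auto simp: ascent_set_def)
  have P: "d \<in> E \<Longrightarrow> d \<in> set y \<Longrightarrow> Suc d \<in> set y"
    "d \<notin> E \<Longrightarrow> Suc d \<in> set y \<Longrightarrow> d \<in> set y"
    "d \<in> E \<Longrightarrow> d \<in> set (a # y) \<Longrightarrow> Suc d \<in> set (a # y)"
    "d \<notin> E \<Longrightarrow> Suc d \<in> set (a # y) \<Longrightarrow> d \<in> set (a # y)" if "1 \<le> d" "d < n" for d
    using ascent_set_suffix[OF assms(1,2) s that] ascent_set_suffix[OF assms(1,2) Cons.prems that]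
      assms(4) by auto
  have ys: "set y \<subseteq> {1..n}"
    using Cons.prems assms(2) by auto
  have "(a # y) @ columns E \<approx> a # columns ?V"
    using word_equiv_Cons[OF Cons.IH[OF s]] by simp
  also have "\<dots> \<approx> columns (insert a (?V - {a - 1}))"
  proof (rule letter_into_columns)
    show "finite ?V"
      by (simp add: col_heights_def)
    show "a \<notin> ?V"
      using a P(3)[of a] E by (auto simp: col_heights_def)
    show "a = 1 \<or> a - 1 \<in> ?V"
    proof (cases "a = 1")
      case False
      then have "Suc (a - 1) = a" "1 \<le> a - 1" "a - 1 < n"
        using a by auto
      then show ?thesis
        using P(4)[of "a - 1"] a unfolding col_heights_def by (cases "a - 1 \<in> E") force+
    qed simp
  qed (use a in \<open>auto simp: col_heights_def\<close>)
  also have "insert a (?V - {a - 1}) = col_heights n E (set (a # y))"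
  proof (rule set_eqI)
    fix d
    show "d \<in> insert a (?V - {a - 1}) \<longleftrightarrow> d \<in> col_heights n E (set (a # y))"
    proof (cases "d = a")
      case True
      then show ?thesis
        using a P(2)[of a] ys by (cases "a = n") (auto simp: col_heights_def)
    next
      case False
      show ?thesis
      proof (cases "Suc d = a")
        case True
        then show ?thesis
          using a P(1)[of d] False by (auto simp: col_heights_def)
      next
        case False
        then show ?thesis
          using \<open>d \<noteq> a\<close> by (auto simp: col_heights_def)
      qed
    qed
  qed
  finally show ?case .
qed

text \<open>Once all letters are absorbed, every initial column has been lengthened and recreated,
  and one column of full height has been added.\<close>

lemma permutation_columns_equiv:
  assumes "distinct s" "set s = {1..n}" "1 \<le> n"
  shows "s @ columns (ascent_set n s) \<approx> columns (ascent_set n s) @ down n"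
proof -
  let ?E = "ascent_set n s"
  have E: "?E \<subseteq> {1..<n}"
    by (auto simp: ascent_set_def)
  then have "col_heights n ?E (set s) = ?E \<union> {n}"
    using assms by (auto simp: col_heights_def)
  moreover have "columns (?E \<union> {n}) = columns ?E @ down n"
    using E by (subst columns_Un) (auto intro: finite_subset)
  ultimately show ?thesis
    using suffix_columns_equiv[OF assms(1,2), of "[]" s ?E] by simp
qed

lemma permutation_power_columns_equiv:
  assumes "distinct s" "set s = {1..n}" "1 \<le> n"
  shows "concat (replicate k s) @ columns (ascent_set n s)
    \<approx> columns (ascent_set n s) @ concat (replicate k (down n))"
proof (induction k)
  case 0
  then show ?case by simp
next
  case (Suc k)
  let ?c = "columns (ascent_set n s)"
  have "concat (replicate (Suc k) s) @ ?c \<approx> s @ ?c @ concat (replicate k (down n))"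
    using word_equiv_append_left[OF Suc] by simp
  also have "\<dots> \<approx> ?c @ down n @ concat (replicate k (down n))"
    using word_equiv_append_right[OF permutation_columns_equiv[OF assms]] by simp
  finally show ?case by simp
qed

section \<open>Row systems\<close>

text \<open>A token is a letter given by its class and its row; the value of the letter is its position
  in the list. Both the outcome of the sliding procedure and the insertion tableau assign rows
  subject to these rules. The second alternative of \<open>high\<close> is the one where the two exchanged
  letters compete for the same place.\<close>

locale row_system =
  fixes n :: nat and R :: "(nat \<times> nat) list \<Rightarrow> bool"
  assumes asc: "R (x @ (c, r) # (c', r') # y) \<Longrightarrow> c < c' \<Longrightarrow> r' \<le> r"
    and desc: "R (x @ (c, r) # (c', r') # y) \<Longrightarrow> c' < c \<Longrightarrow> r < r'"
    and row_bounds: "R (x @ (c, r) # y) \<Longrightarrow> 1 \<le> r \<and> r \<le> n"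
    and above: "R (x @ (c, r) # y) \<Longrightarrow> r \<le> 1 \<or> (\<exists>p\<in>set x. r \<le> Suc (snd p))"
    and low: "R (x @ [p, q, s] @ y) \<Longrightarrow> between (fst p) (fst q) (fst s) \<Longrightarrow> R (x @ [p, s, q] @ y)"
    and high: "R (x @ [(cq, rq), (cs, rs), (cp, rp)] @ y) \<Longrightarrow> between cp cq cs \<Longrightarrow>
      R (x @ [(cs, rs), (cq, rq), (cp, rp)] @ y) \<or> R (x @ [(cs, rq), (cq, rp), (cp, rs)] @ y)"
begin

section \<open>Transporting rows along Knuth equivalences\<close>

lemma low_moves: "(low_move fst)\<^sup>*\<^sup>* z z' \<Longrightarrow> R z \<Longrightarrow> R z'"
proof (induction rule: rtranclp_induct)
  case (step y z)
  from step(2) step.IH[OF step.prems] show ?case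
    by cases (simp add: low[simplified])
qed

lemma map_fst_eq_3:
  assumes "map fst zu = x @ [a, b, c] @ y"
  obtains zx ra rb rc zy where "zu = zx @ [(a, ra), (b, rb), (c, rc)] @ zy"
    "map fst zx = x" "map fst zy = y"
  using assms by (auto simp: map_eq_append_conv Cons_eq_map_conv) 

text \<open>Both alternatives of \<open>high\<close> permute the three rows, so the multiset of rows
  of the rewritten part survives; the counting of letters rests on this. As fillings, the second
  alternative interchanges the two larger letters where the first interchanges the two smaller
  ones.\<close>

lemma word_move_transfer:
  assumes "word_move (map fst zu) v" "R (zx @ zu @ zy)"
  shows "\<exists>zv. R (zx @ zv @ zy) \<and> map fst zv = v \<and> mset (map snd zv) = mset (map snd zu)"
  using assms(1) unfolding word_move_def
proof
  assume "low_move id (map fst zu) v"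
  then show ?thesis
  proof cases
    case (1 p q s x y)
    from 1(1) obtain z1 rp rq rs z2 where z: "zu = z1 @ [(p, rp), (q, rq), (s, rs)] @ z2"
      "map fst z1 = x" "map fst z2 = y"
      by (rule map_fst_eq_3)
    have "R ((zx @ z1) @ [(p, rp), (s, rs), (q, rq)] @ z2 @ zy)"
      by (rule low) (use assms(2) z 1 in auto)
    then show ?thesis
      by (intro exI[of _ "z1 @ [(p, rp), (s, rs), (q, rq)] @ z2"]) (use z 1 in auto)
  qed
next
  assume "high_move id (map fst zu) v"
  then show ?thesis
  proof cases
    case (1 p q s x y)
    from 1(1) obtain z1 rq rs rp z2 where z: "zu = z1 @ [(q, rq), (s, rs), (p, rp)] @ z2"
      "map fst z1 = x" "map fst z2 = y"
      by (rule map_fst_eq_3)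
    have "R ((zx @ z1) @ [(s, rs), (q, rq), (p, rp)] @ z2 @ zy) \<or>
        R ((zx @ z1) @ [(s, rq), (q, rp), (p, rs)] @ z2 @ zy)"
      by (rule high) (use assms(2) z 1 in auto)
    then show ?thesis
    proof
      assume "R ((zx @ z1) @ [(s, rs), (q, rq), (p, rp)] @ z2 @ zy)"
      then show ?thesis
        by (intro exI[of _ "z1 @ [(s, rs), (q, rq), (p, rp)] @ z2"]) (use z 1 in auto)
    next
      assume "R ((zx @ z1) @ [(s, rq), (q, rp), (p, rs)] @ z2 @ zy)"
      then show ?thesis
        by (intro exI[of _ "z1 @ [(s, rq), (q, rp), (p, rs)] @ z2"]) (use z 1 in auto)
    qed
  qed
qed

lemma word_equiv_transfer:
  assumes "u \<approx> v" "R (zx @ zu @ zy)" "map fst zu = u"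
  shows "\<exists>zv. R (zx @ zv @ zy) \<and> map fst zv = v \<and> mset (map snd zv) = mset (map snd zu)"
  using assms(1)
proof (induction rule: rtranclp_induct)
  case base
  then show ?case using assms by auto
next
  case (step v w)
  then show ?case
    using word_move_transfer by metis
qed

section \<open>Rows forced on words of columns\<close>

lemma down_rows_step:
  assumes "R (zx @ zr @ zy)" "map fst zr = down d" "Suc k < d"
  shows "snd (zr ! k) < snd (zr ! Suc k)"
proof -
  have len: "length zr = d"
    using assms(2) by (metis length_down length_map)
  define p where "p = zr ! k"
  define q where "q = zr ! Suc k"
  have "zr = take k zr @ p # q # drop (Suc (Suc k)) zr"
    using assms(3) len by (simp add: p_def q_def Cons_nth_drop_Suc)
  then have R': "R ((zx @ take k zr) @ (fst p, snd p) # (fst q, snd q) # drop (Suc (Suc k)) zr @ zy)"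
    using assms(1) by (metis append.assoc append_Cons prod.collapse)
  have "fst p = d - k" "fst q = d - Suc k"
    using arg_cong[OF assms(2), of "\<lambda>l. l ! k"] arg_cong[OF assms(2), of "\<lambda>l. l ! Suc k"] assms(3) len
    by (auto simp: p_def q_def nth_down)
  then have "snd p < snd q"
    using desc[OF R'] assms(3) by simp
  then show ?thesis
    by (simp add: p_def q_def)
qed

lemma down_rows_lower:
  assumes "R (zx @ zr @ zy)" "map fst zr = down d" "k < d"
  shows "Suc k \<le> snd (zr ! k)"
  using assms(3)
proof (induction k)
  case 0
  then obtain p z where "zr = p # z"
    using assms(2) by (cases zr; cases d) auto
  then show ?case
    using row_bounds[of zx "fst p" "snd p" "z @ zy"] assms(1) by simp
next
  case (Suc k)
  then show ?case
    using down_rows_step[OF assms(1,2), of k] by simp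
qed

text \<open>The \<open>n\<close> rows of a full column increase strictly inside
  \<open>{1..n}\<close>, so counting back from the last one leaves no slack.\<close>

lemma down_rows_upper:
  assumes "R (zx @ zr @ zy)" "map fst zr = down n" "k < n"
  shows "snd (zr ! k) \<le> Suc k"
proof -
  have len: "length zr = n"
    using assms(2) by (metis length_down length_map)
  have "snd (zr ! k) + (j - k) \<le> snd (zr ! j)" if "k \<le> j" "j < n" for j
    using that
  proof (induction j rule: dec_induct)
    case (step j)
    then show ?case
      using down_rows_step[OF assms(1,2), of j] by simp
  qed simp
  from this[of "n - 1"] have "snd (zr ! k) + (n - 1 - k) \<le> snd (zr ! (n - 1))"
    using assms(3) by simp
  moreover have "snd (zr ! (n - 1)) \<le> n"
  proof -
    have "zr = take (n - 1) zr @ zr ! (n - 1) # []"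
      using len assms(3) by (metis Cons_nth_drop_Suc Suc_pred' append_take_drop_id diff_less
          drop_all le_refl less_nat_zero_code less_one linorder_neqE_nat)
    then have "R ((zx @ take (n - 1) zr) @ (fst (zr ! (n - 1)), snd (zr ! (n - 1))) # zy)"
      using assms(1) by (metis append.assoc append_Cons append_Nil prod.collapse)
    then show ?thesis
      using row_bounds by blast
  qed
  ultimately show ?thesis
    using assms(3) by simp
qed

text \<open>The first letter of the run is at most one row below some earlier letter, and an ascent
  never leads to a lower row.\<close>

lemma increasing_rows_bound:
  assumes "R (zx @ hs @ zy)" "\<And>p. p \<in> set zx \<Longrightarrow> snd p \<le> j" "sorted_wrt (<) (map fst hs)"
  shows "\<forall>p\<in>set hs. snd p \<le> Suc j"
  using assms(1,3)
proof (induction hs arbitrary: zy rule: rev_induct)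
  case Nil
  then show ?case by simp
next
  case (snoc h hs)
  have IH: "\<forall>p\<in>set hs. snd p \<le> Suc j"
    using snoc.prems by (intro snoc.IH[of "h # zy"]) (auto simp: sorted_wrt_append)
  have "snd h \<le> Suc j"
  proof (cases hs rule: rev_cases)
    case Nil
    then show ?thesis
      using above[of zx "fst h" "snd h" zy] snoc.prems assms(2) by force
  next
    case (snoc hs' h')
    have "R ((zx @ hs') @ (fst h', snd h') # (fst h, snd h) # zy)" "fst h' < fst h"
      using snoc.prems snoc by (auto simp: sorted_wrt_append)
    from asc[OF this] show ?thesis
      using IH snoc by simp
  qed
  with IH show ?case by simp
qed

text \<open>Since low moves carry the rows, the heads of all columns may be brought to the front,
  where they form an increasing run in rows up to \<open>j + 1\<close>. The tails are columns again,
  now behind letters in rows up to \<open>j + 1\<close>.\<close>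

lemma columns_rows_upper:
  assumes "R (zx @ concat rs @ zy)" "\<And>p. p \<in> set zx \<Longrightarrow> snd p \<le> j"
    "list_all2 (\<lambda>r d. map fst r = down d) rs ds" "sorted_wrt (<) ds" "i < length rs"
    "k < length (rs ! i)"
  shows "snd (rs ! i ! k) \<le> j + Suc k"
  using assms
\<comment> \<open>The number of columns is part of the measure so that discarding an empty column
  decreases it too.\<close>
proof (induction "length rs + length (concat rs)" arbitrary: zx rs ds j i k rule: less_induct)
  case less
  show ?case
  proof (cases rs)
    case Nil
    then show ?thesis using less.prems by simp
  next
    case (Cons r rs')
    then obtain d ds' where ds: "ds = d # ds'" "map fst r = down d"
      "list_all2 (\<lambda>r d. map fst r = down d) rs' ds'"
      using less.prems(3) by (auto simp: list_all2_Cons1)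
    show ?thesis
    proof (cases d)
      case 0
      then have "r = []"
        using ds by simp
      then obtain i' where i: "i = Suc i'"
        using less.prems Cons by (cases i) auto
      have "snd (rs' ! i' ! k) \<le> j + Suc k"
        by (rule less.hyps[of rs' zx j ds'])
          (use less.prems Cons \<open>r = []\<close> ds i in auto)
      then show ?thesis
        using Cons i by simp
    next
      case (Suc d')
      have pos: "0 < x" if "x \<in> set ds" for x
        using that less.prems(4) ds Suc by auto
      define es where "es = map (\<lambda>x. x - 1) ds"
      have ds_es: "ds = map Suc es"
        using pos by (auto simp: es_def intro!: map_idI[symmetric])
      have rs_es: "list_all2 (\<lambda>r d. map fst r = down (Suc d)) rs es"
        using less.prems(3) unfolding ds_es by (simp add: list_all2_map2)
      have es: "sorted_wrt (<) es"
        using less.prems(4) unfolding ds_es by (simp add: sorted_wrt_map)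
      let ?z = "map hd rs @ concat (map tl rs)"
      have "R (zx @ ?z @ zy)"
        using low_moves_context[OF low_moves_heads_first[OF rs_es es], of zx zy]
          less.prems(1) by (rule low_moves)
      then have R': "R (zx @ map hd rs @ (concat (map tl rs) @ zy))"
        by simp
      have hds: "map fst (map hd rs) = ds"
        using rs_es unfolding ds_es
      proof (induction rs es rule: list_all2_induct)
        case (Cons x xs y ys)
        then show ?case by (cases x) auto
      qed auto
      have heads: "\<forall>p\<in>set (map hd rs). snd p \<le> Suc j"
        by (rule increasing_rows_bound[OF R' less.prems(2)]) (use hds less.prems(4) in auto)
      show ?thesis
      proof (cases k)
        case 0
        then have "rs ! i ! k = hd (rs ! i)"
          using less.prems by (metis hd_conv_nth length_0_conv less_nat_zero_code)
        then show ?thesis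
          using heads less.prems(5) 0 by simp
      next
        case (Suc k')
        have "snd (map tl rs ! i ! k') \<le> Suc j + Suc k'"
        proof (rule less.hyps[of "map tl rs" "zx @ map hd rs" "Suc j" es])
          have "length (concat (map tl rs)) < length (concat rs)"
          proof -
            have "length (concat (map tl rs')) \<le> length (concat rs')"
              by (induction rs') auto
            then show ?thesis
              using Cons ds \<open>d = Suc d'\<close> by (cases r) auto
          qed
          then show "length (map tl rs) + length (concat (map tl rs)) < length rs + length (concat rs)"
            by simp
          show "list_all2 (\<lambda>r d. map fst r = down d) (map tl rs) es"
            using rs_es by (auto simp: list_all2_conv_all_nth map_tl)
        qed (use R' heads less.prems Suc es in \<open>auto simp: le_SucI\<close>)
        then show ?thesis
          using less.prems Suc by (simp add: nth_tl)
      qed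
    qed
  qed
qed

end

definition down_tokens :: "nat \<Rightarrow> (nat \<times> nat) list" where
  "down_tokens d = zip (down d) [1..<Suc d]"

definition column_tokens :: "nat \<Rightarrow> nat set \<Rightarrow> nat \<Rightarrow> (nat \<times> nat) list" where
  "column_tokens n E k =
     concat (map down_tokens (sorted_list_of_set E)) @ concat (replicate k (down_tokens n))"

lemma map_fst_eq_concat:
  assumes "map fst z = concat us"
  shows "\<exists>zs. z = concat zs \<and> map (map fst) zs = us"
  using assms
proof (induction us arbitrary: z)
  case (Cons u us)
  then obtain z1 z2 where "z = z1 @ z2" "map fst z1 = u" "map fst z2 = concat us"
    by (auto simp: map_eq_append_conv)
  with Cons.IH[of z2] show ?case
    by (metis concat.simps(2) list.simps(9))
qed auto

context row_system
begin

lemma tokens_eq_down_tokens: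
  assumes "map fst r = down d" "\<And>k. k < d \<Longrightarrow> snd (r ! k) = Suc k"
  shows "r = down_tokens d"
proof (rule nth_equalityI)
  have len: "length r = d"
    using assms(1) by (metis length_down length_map)
  then show "length r = length (down_tokens d)"
    by (simp add: down_tokens_def)
  fix k assume "k < length r"
  then show "r ! k = down_tokens d ! k"
    using assms(2)[of k] arg_cong[OF assms(1), of "\<lambda>l. l ! k"] len
    by (auto simp: down_tokens_def prod_eq_iff simp del: upt_Suc)
qed

text \<open>Lower bounds on rows come from the strict descents inside a column. Upper bounds come
  from \<open>columns_rows_upper\<close> for the columns in front and from the limit of
  \<open>n\<close> rows for the full columns behind them.\<close>

lemma column_tokens_unique:
  assumes "R z" "map fst z = columns E @ concat (replicate k (down n))"
  shows "z = column_tokens n E k"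
proof -
  obtain zc zd where z: "z = zc @ zd" "map fst zc = columns E"
    "map fst zd = concat (replicate k (down n))"
    using assms(2) by (auto simp: map_eq_append_conv)
  obtain rs where rs: "zc = concat rs" "map (map fst) rs = map down (sorted_list_of_set E)"
    using map_fst_eq_concat[of zc] z(2) unfolding columns_def by auto
  obtain ts where ts: "zd = concat ts" "map (map fst) ts = replicate k (down n)"
    using map_fst_eq_concat[OF z(3)] by auto
  have "rs = map down_tokens (sorted_list_of_set E)"
  proof (rule nth_equalityI)
    show len: "length rs = length (map down_tokens (sorted_list_of_set E))"
      using rs(2) by (metis length_map)
    fix i assume i: "i < length rs"
    let ?d = "sorted_list_of_set E ! i"
    have ri: "map fst (rs ! i) = down ?d"
      using arg_cong[OF rs(2), of "\<lambda>l. l ! i"] i len by simp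
    have "rs ! i = down_tokens ?d"
    proof (rule tokens_eq_down_tokens[OF ri])
      fix k assume k: "k < ?d"
      have "z = concat (take i rs) @ rs ! i @ (concat (drop (Suc i) rs) @ zd)"
        using i z(1) rs(1) by (metis append.assoc concat.simps(2) concat_append id_take_nth_drop)
      then have "Suc k \<le> snd (rs ! i ! k)"
        using down_rows_lower[OF _ ri k] assms(1) by metis
      \<comment> \<open>The columns open the word, so nothing precedes them and the bound
        \<open>j\<close> on earlier rows is \<open>0\<close>.\<close>
      moreover have "snd (rs ! i ! k) \<le> 0 + Suc k"
      proof (rule columns_rows_upper)
        show "R ([] @ concat rs @ zd)"
          using assms(1) z rs by simp
        show "list_all2 (\<lambda>r d. map fst r = down d) rs (sorted_list_of_set E)"
          using rs(2) by (auto simp: list_all2_conv_all_nth list_eq_iff_nth_eq)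
        show "k < length (rs ! i)"
          using k ri by (metis length_down length_map)
      qed (use i in auto)
      ultimately show "snd (rs ! i ! k) = Suc k" by simp
    qed
    then show "rs ! i = map down_tokens (sorted_list_of_set E) ! i"
      using i len by simp
  qed
  moreover have "ts = replicate k (down_tokens n)"
  proof (rule nth_equalityI)
    show len: "length ts = length (replicate k (down_tokens n))"
      using ts(2) by (metis length_map length_replicate)
    fix i assume i: "i < length ts"
    have ti: "map fst (ts ! i) = down n"
      using arg_cong[OF ts(2), of "\<lambda>l. l ! i"] i len by simp
    have "ts ! i = down_tokens n"
    proof (rule tokens_eq_down_tokens[OF ti])
      fix j assume j: "j < n"
      have "z = (zc @ concat (take i ts)) @ ts ! i @ concat (drop (Suc i) ts)"
        using i z(1) ts(1) by (metis append.assoc concat.simps(2) concat_append id_take_nth_drop)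
      then show "snd (ts ! i ! j) = Suc j"
        using down_rows_lower[OF _ ti j] down_rows_upper[OF _ ti j] assms(1)
        by (metis le_antisym)
    qed
    then show "ts ! i = replicate k (down_tokens n) ! i"
      using i len by simp
  qed
  ultimately show ?thesis
    using z rs ts by (simp add: column_tokens_def)
qed

end

text \<open>Quantifying over two systems allows sliding to be compared with row insertion
  directly.\<close>

definition unique_rows :: "nat \<Rightarrow> nat list \<Rightarrow> bool" where
  "unique_rows n u \<longleftrightarrow> (\<forall>R1 R2 z1 z2. row_system n R1 \<longrightarrow> row_system n R2 \<longrightarrow>
     R1 z1 \<longrightarrow> R2 z2 \<longrightarrow> map fst z1 = u \<longrightarrow> map fst z2 = u \<longrightarrow> z1 = z2)"

text \<open>The rows of the last two letters in the first system would be those of the first two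
  letters in the second. As \<open>cp\<close> lies between \<open>cq\<close> and \<open>cs\<close>,
  one of these pairs is an ascent and the other a descent, so the same two rows would be compared in
  contradictory ways.\<close>

lemma high_alternatives_exclusive:
  assumes "row_system n R1" "row_system n R2"
    and 1: "R1 (x @ [(cq, rq), (cs, rs), (cp, rp)] @ y)"
    and 2: "R2 (x' @ [(cq, rq'), (cs, rs'), (cp, rp')] @ y')"
    and 3: "R1 (x @ [(cs, rs), (cq, rq), (cp, rp)] @ y)"
    and eq: "rs = rq'" "rq = rp'" "rp = rs'"
    and "between cp cq cs"
  shows False
proof -
  interpret R1: row_system n R1 by fact
  interpret R2: row_system n R2 by fact
  have "rs \<le> rq" if "cq < cs"
    using R1.asc[of x cq rq cs rs] 1 that by simp
  moreover have "rs < rp" if "cp < cs"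
    using R1.desc[of "x @ [(cq, rq)]" cs rs cp rp] 1 that by simp
  moreover have "rp \<le> rs" if "cs < cp"
    using R1.asc[of "x @ [(cq, rq)]" cs rs cp rp] 1 that by simp
  moreover have "rs' \<le> rq'" if "cq < cs"
    using R2.asc[of x' cq rq' cs rs'] 2 that by simp
  moreover have "rq' < rs'" if "cs < cq"
    using R2.desc[of x' cq rq' cs rs'] 2 that by simp
  ultimately show False
    using eq \<open>between cp cq cs\<close> by (auto simp: between_def)
qed

text \<open>For a fixed alternative a move is injective on rows, so agreement after the move gives
  agreement before it; that the two systems choose different alternatives is excluded by
  \<open>high_alternatives_exclusive\<close>.\<close>

lemma unique_rows_move:
  assumes "word_move u v" "unique_rows n v"
  shows "unique_rows n u"
  unfolding unique_rows_def
proof (intro allI impI)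
  fix R1 R2 z1 z2
  assume R: "row_system n R1" "row_system n R2" and z: "R1 z1" "R2 z2"
    and u: "map fst z1 = u" "map fst z2 = u"
  interpret R1: row_system n R1 by fact
  interpret R2: row_system n R2 by fact
  have uniq: "z1' = z2'" if "R1 z1'" "R2 z2'" "map fst z1' = v" "map fst z2' = v" for z1' z2'
    using assms(2) R that unfolding unique_rows_def by metis
  from assms(1) show "z1 = z2"
    unfolding word_move_def
  proof
    assume "low_move id u v"
    then show ?thesis
    proof cases
      case (1 p q s x y)
      obtain x1 p1 q1 s1 y1 where z1: "z1 = x1 @ [(p, p1), (q, q1), (s, s1)] @ y1"
        "map fst x1 = x" "map fst y1 = y"
        using u(1) 1(1) R1.map_fst_eq_3 by metis
      obtain x2 p2 q2 s2 y2 where z2: "z2 = x2 @ [(p, p2), (q, q2), (s, s2)] @ y2"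
        "map fst x2 = x" "map fst y2 = y"
        using u(2) 1(1) R1.map_fst_eq_3 by metis
      have len: "length x1 = length x2"
        using z1 z2 by (metis length_map)
      have "x1 @ [(p, p1), (s, s1), (q, q1)] @ y1 = x2 @ [(p, p2), (s, s2), (q, q2)] @ y2"
        by (rule uniq; (rule R1.low R2.low)?) (use z1 z2 z 1 in auto)
      then show ?thesis
        using len z1 z2 by simp
    qed
  next
    assume "high_move id u v"
    then show ?thesis
    proof cases
      case (1 p q s x y)
      obtain x1 p1 q1 s1 y1 where z1: "z1 = x1 @ [(q, q1), (s, s1), (p, p1)] @ y1"
        "map fst x1 = x" "map fst y1 = y"
        using u(1) 1(1) R1.map_fst_eq_3 by metis
      obtain x2 p2 q2 s2 y2 where z2: "z2 = x2 @ [(q, q2), (s, s2), (p, p2)] @ y2"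
        "map fst x2 = x" "map fst y2 = y"
        using u(2) 1(1) R1.map_fst_eq_3 by metis
      have len: "length x1 = length x2"
        using z1 z2 by (metis length_map)
      have bt: "between p q s"
        using 1 by simp
      let ?a1 = "x1 @ [(s, s1), (q, q1), (p, p1)] @ y1"
      let ?b1 = "x1 @ [(s, q1), (q, p1), (p, s1)] @ y1"
      let ?a2 = "x2 @ [(s, s2), (q, q2), (p, p2)] @ y2"
      let ?b2 = "x2 @ [(s, q2), (q, p2), (p, s2)] @ y2"
      have v: "map fst ?a1 = v" "map fst ?b1 = v" "map fst ?a2 = v" "map fst ?b2 = v"
        using z1 z2 1 by auto
      have h1: "R1 ?a1 \<or> R1 ?b1" and h2: "R2 ?a2 \<or> R2 ?b2"
        using R1.high[OF _ bt] R2.high[OF _ bt] z z1 z2 by auto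
      consider "R1 ?a1" "R2 ?a2" | "R1 ?b1" "R2 ?b2" | "R1 ?a1" "R2 ?b2" | "R1 ?b1" "R2 ?a2"
        using h1 h2 by blast
      then show ?thesis
      proof cases
        case 1
        then have "?a1 = ?a2" using uniq v by metis
        then show ?thesis using len z1 z2 by simp
      next
        case 2
        then have "?b1 = ?b2" using uniq v by metis
        then show ?thesis using len z1 z2 by simp
      next
        case 3
        then have "?a1 = ?b2" using uniq v by metis
        then have "s1 = q2" "q1 = p2" "p1 = s2"
          using len by auto
        then have False
          using high_alternatives_exclusive[OF R _ _ 3(1) _ _ _ bt] z z1 z2 by blast
        then show ?thesis ..
      next
        case 4
        then have "?b1 = ?a2" using uniq v by metis
        then have "s2 = q1" "q2 = p1" "p2 = s1"
          using len by auto
        then have False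
          using high_alternatives_exclusive[OF R(2,1) _ _ 4(2) _ _ _ bt] z z1 z2 by blast
        then show ?thesis ..
      qed
    qed
  qed
qed

lemma unique_rows_equiv: "u \<approx> v \<Longrightarrow> unique_rows n v \<Longrightarrow> unique_rows n u"
  by (induction rule: converse_rtranclp_induct) (auto intro: unique_rows_move)

lemma unique_rows_columns: "unique_rows n (columns E @ concat (replicate k (down n)))"
  unfolding unique_rows_def using row_system.column_tokens_unique by metis

section \<open>Counting the letters of a row\<close>

lemma count_down_tokens: "1 \<le> r \<Longrightarrow> count (mset (map snd (down_tokens d))) r = (if r \<le> d then 1 else 0)"
  unfolding down_tokens_def by (simp add: distinct_count_atmost_1[THEN iffD1] del: upt_Suc)

lemma count_column_tokens:
  assumes "1 \<le> r" "r \<le> n" "finite E"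
  shows "count (mset (map snd (column_tokens n E k))) r = card {d \<in> E. r \<le> d} + k"
proof -
  have "count (mset (map snd (concat (map down_tokens ds)))) r = length (filter (\<lambda>d. r \<le> d) ds)" for ds
    using assms(1) by (induction ds) (auto simp: count_down_tokens simp del: mset_map)
  moreover have "count (mset (map snd (concat (replicate k (down_tokens n))))) r = k"
    using assms by (induction k) (auto simp: count_down_tokens simp del: mset_map)
  moreover have "length (filter (\<lambda>d. r \<le> d) (sorted_list_of_set E)) = card {d \<in> E. r \<le> d}"
    using assms(3) by (subst distinct_card[symmetric]) (auto intro!: arg_cong[of _ _ card])
  ultimately show ?thesis
    by (simp add: column_tokens_def del: mset_map) 
qed

context row_system
begin

text \<open>Rows increase strictly inside a column, so a column meets every row at most once,
  whatever precedes it.\<close>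

lemma count_columns_rows:
  assumes "R (zx @ concat rs @ zy)" "map (map fst) rs = map down ds"
  shows "count (mset (map snd (concat rs))) r \<le> length rs"
  using assms
proof (induction rs arbitrary: zx ds)
  case (Cons t rs)
  then obtain d ds' where ds: "ds = d # ds'" "map fst t = down d" "map (map fst) rs = map down ds'"
    by (cases ds) auto
  have "R (zx @ t @ (concat rs @ zy))"
    using Cons.prems by simp
  from down_rows_step[OF this ds(2)] have "sorted_wrt (<) (map snd t)"
    using ds(2) by (subst sorted_wrt_iff_nth_Suc_transp) (auto, metis length_down length_map)
  then have "distinct (map snd t)"
    by (simp add: strict_sorted_iff)
  then have "count (mset (map snd t)) r \<le> 1"
    by (simp add: distinct_count_atmost_1 del: mset_map)
  moreover have "count (mset (map snd (concat rs))) r \<le> length rs"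
    using Cons.prems ds by (intro Cons.IH[of "zx @ t"]) auto
  ultimately show ?case by (simp del: mset_map)
qed auto

text \<open>Rewriting the later copies of \<open>s\<close> first brings the columns directly behind
  the first \<open>m\<close> copies; rewriting this part as well yields columns with known rows. Row
  \<open>r\<close> then has \<open>m\<close> letters and one more for each column of height at least
  \<open>r\<close>, while the intermediate columns \<open>ze\<close> contribute at most one each.
  The loss is at most the number of columns shorter than \<open>r\<close>, hence at most
  \<open>r - 1\<close>.\<close>

lemma row_count_lower:
  assumes "distinct s" "set s = {1..n}" "1 \<le> n" "1 \<le> r" "r \<le> n" "m \<le> M" "R z"
    "map fst z = concat (replicate M s) @ columns (ascent_set n s)"
  shows "Suc m \<le> r + count (mset (map snd (take (m * n) z))) r"
proof -
  let ?E = "ascent_set n s"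
  have fin: "finite ?E"
    by (simp add: ascent_set_def)
  have "length s = n"
    using assms(1,2) by (metis card_atLeastAtMost diff_Suc_1 distinct_card)
  then have len: "length (concat (replicate m s)) = m * n"
    by (induction m) auto
  have "replicate M s = replicate m s @ replicate (M - m) s"
    using assms(6) by (metis le_add_diff_inverse replicate_add)
  then have "map fst z = concat (replicate m s) @ (concat (replicate (M - m) s) @ columns ?E)"
    using assms(8) by simp
  then obtain z1 z2 where z: "z = z1 @ z2" "map fst z1 = concat (replicate m s)"
    "map fst z2 = concat (replicate (M - m) s) @ columns ?E"
    by (metis map_eq_append_conv)
  have "length z1 = m * n"
    using z(2) len by (metis length_map)
  then have take: "take (m * n) z = z1"
    using z(1) by simp
  obtain z3 where z3: "R (z1 @ z3 @ [])"
    "map fst z3 = columns ?E @ concat (replicate (M - m) (down n))"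
    using word_equiv_transfer[OF permutation_power_columns_equiv[OF assms(1-3)] _ z(3), of z1 "[]"]
      assms(7) z(1) by auto
  then obtain ze zd where ze: "z3 = ze @ zd" "map fst ze = columns ?E"
    by (auto simp: map_eq_append_conv)
  have "map fst (z1 @ ze) = concat (replicate m s) @ columns ?E"
    using z(2) ze(2) by simp
  then obtain z4 where z4: "R ([] @ z4 @ zd)" "map fst z4 = columns ?E @ concat (replicate m (down n))"
    "mset (map snd z4) = mset (map snd (z1 @ ze))"
    using word_equiv_transfer[OF permutation_power_columns_equiv[OF assms(1-3)], of "[]" "z1 @ ze" zd m]
      z3(1) ze(1) by auto
  have "z4 @ zd = column_tokens n ?E (m + (M - m))"
    using z4(1,2) z3(2) ze
    by (intro column_tokens_unique) (auto simp: replicate_add)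
  also have "\<dots> = column_tokens n ?E m @ concat (replicate (M - m) (down_tokens n))"
    by (simp add: column_tokens_def replicate_add)
  finally have "z4 = column_tokens n ?E m"
  proof (rule append_eq_append_conv[THEN iffD1, THEN conjunct1, rotated])
    have "map fst (down_tokens d) = down d" for d
      by (simp add: down_tokens_def)
    then have "map fst (column_tokens n ?E m) = columns ?E @ concat (replicate m (down n))"
      by (simp add: column_tokens_def columns_def map_concat comp_def)
    then show "length z4 = length (column_tokens n ?E m) \<or>
        length zd = length (concat (replicate (M - m) (down_tokens n)))"
      using z4(2) by (metis length_map)
  qed
  then have "count (mset (map snd (z1 @ ze))) r = card {d \<in> ?E. r \<le> d} + m"
    using z4(3) count_column_tokens[OF assms(4,5) fin] by metis
  then have c1: "count (mset (map snd z1)) r + count (mset (map snd ze)) r = card {d \<in> ?E. r \<le> d} + m"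
    by (simp del: mset_map)
  obtain rs where rs: "ze = concat rs" "map (map fst) rs = map down (sorted_list_of_set ?E)"
    using map_fst_eq_concat[of ze] ze(2) unfolding columns_def by auto
  have c2: "count (mset (map snd ze)) r \<le> card ?E"
    using count_columns_rows[of z1 rs zd, OF _ rs(2)] z3(1) ze rs 
    by (metis append.assoc append_Nil2 length_map length_sorted_list_of_set)
  have "card ?E \<le> card ({d \<in> ?E. r \<le> d} \<union> {1..<r})"
    using fin by (intro card_mono) (auto simp: ascent_set_def)
  also have "\<dots> \<le> card {d \<in> ?E. r \<le> d} + (r - 1)"
    using card_Un_le[of "{d \<in> ?E. r \<le> d}" "{1..<r}"] by simp
  finally show ?thesis
    using c1 c2 assms(4) unfolding take by linarith
qed

end

section \<open>Row insertion\<close>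

text \<open>A tableau is recorded by the function \<open>\<rho>\<close> giving the row of each letter, with \<open>0\<close> for
  absent letters. In \<open>bump \<rho> k x \<rho>' f\<close> the letter \<open>x\<close> is inserted into row \<open>k\<close>; the bumping
  path ends in row \<open>f\<close>.\<close>

inductive bump :: "(nat \<Rightarrow> nat) \<Rightarrow> nat \<Rightarrow> nat \<Rightarrow> (nat \<Rightarrow> nat) \<Rightarrow> nat \<Rightarrow> bool" where
  settle: "(\<forall>y. \<rho> y = k \<longrightarrow> \<not> x < y) \<Longrightarrow> bump \<rho> k x (\<rho>(x := k)) k"
| push: "\<rho> y = k \<Longrightarrow> x < y \<Longrightarrow> (\<forall>z. \<rho> z = k \<longrightarrow> x < z \<longrightarrow> y \<le> z) \<Longrightarrow>
    bump (\<rho>(x := k, y := 0)) (Suc k) y \<rho>' f \<Longrightarrow> bump \<rho> k x \<rho>' f"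

inductive inserted :: "nat list \<Rightarrow> (nat \<Rightarrow> nat) \<Rightarrow> bool" where
  inserted_Nil: "inserted [] (\<lambda>_. 0)"
| inserted_snoc: "inserted ws \<rho> \<Longrightarrow> bump \<rho> 1 x \<rho>' f \<Longrightarrow> inserted (ws @ [x]) \<rho>'"

lemma bump_deterministic: "bump \<rho> k x \<rho>1 f1 \<Longrightarrow> bump \<rho> k x \<rho>2 f2 \<Longrightarrow> \<rho>1 = \<rho>2 \<and> f1 = f2"
proof (induction arbitrary: \<rho>2 f2 rule: bump.induct)
  case (settle \<rho> k x)
  from settle.prems show ?case
    by cases (use settle.hyps in auto)
next
  case (push \<rho> y k x \<rho>' f)
  from push.prems show ?case
  proof cases
    case settle
    then show ?thesis using push.hyps by auto
  next
    case (push y')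
    then have "y \<le> y'" "y' \<le> y"
      using push.hyps(1-3) by auto
    then have "y' = y"
      by simp
    then show ?thesis
      using push.IH push(4) by blast
  qed
qed

lemma inserted_snocE:
  assumes "inserted (ws @ [x]) \<rho>'"
  obtains \<rho> f where "inserted ws \<rho>" "bump \<rho> 1 x \<rho>' f"
  using assms by cases auto

lemma inserted_deterministic: "inserted ws \<rho>1 \<Longrightarrow> inserted ws \<rho>2 \<Longrightarrow> \<rho>1 = \<rho>2"
proof (induction arbitrary: \<rho>2 rule: inserted.induct)
  case inserted_Nil
  then show ?case by (auto elim: inserted.cases)
next
  case (inserted_snoc ws \<rho> x \<rho>' f)
  from inserted_snoc.prems obtain \<rho>3 f' where "inserted ws \<rho>3" "bump \<rho>3 1 x \<rho>2 f'"
    by (rule inserted_snocE)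
  then show ?case
    using inserted_snoc.IH inserted_snoc.hyps bump_deterministic by blast
qed

lemma bump_final_row_ge: "bump \<rho> k x \<rho>' f \<Longrightarrow> k \<le> f"
  by (induction rule: bump.induct) auto

lemma bump_lower_rows:
  "bump \<rho> k x \<rho>' f \<Longrightarrow> \<rho> x = 0 \<Longrightarrow> 1 \<le> j \<Longrightarrow> j < k \<Longrightarrow> \<rho>' z = j \<longleftrightarrow> \<rho> z = j"
  by (induction rule: bump.induct) auto

lemma bump_support:
  "bump \<rho> k x \<rho>' f \<Longrightarrow> 1 \<le> k \<Longrightarrow> \<rho>' z \<noteq> 0 \<longleftrightarrow> \<rho> z \<noteq> 0 \<or> z = x"
  by (induction rule: bump.induct) auto

lemma inserted_support: "inserted ws \<rho> \<Longrightarrow> \<rho> z \<noteq> 0 \<longleftrightarrow> z \<in> set ws"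
proof (induction rule: inserted.induct)
  case (inserted_snoc ws \<rho> x \<rho>' f)
  then show ?case
    using bump_support[OF inserted_snoc.hyps(2), of z] by auto
qed simp

lemma bump_row_bounds:
  "bump \<rho> k x \<rho>' f \<Longrightarrow> (\<forall>v. \<rho> v \<le> N) \<Longrightarrow> k \<le> Suc N \<Longrightarrow> f \<le> Suc N \<and> (\<forall>v. \<rho>' v \<le> max N f)"
proof (induction arbitrary: N rule: bump.induct)
  case (settle \<rho> k x)
  then show ?case by (auto simp: le_max_iff_disj)
next
  case (push \<rho> y k x \<rho>' f)
  have "k \<le> N"
    using push.hyps(1) push.prems(1) by blast
  then show ?case
    using push.prems by (intro push.IH) auto
qed

text \<open>The row bumping lemma: in each row the larger letter bumps a larger letter, so its path
  ends no lower. When the second path enters row \<open>k\<close>, it has already altered the rows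
  above; hence \<open>\<tau>\<close> has to agree with \<open>\<rho>'\<close> only from row
  \<open>k\<close> on.\<close>

lemma bump_path_mono:
  "bump \<rho> k x \<rho>' f \<Longrightarrow> \<rho> x = 0 \<Longrightarrow> 1 \<le> k \<Longrightarrow> x < x' \<Longrightarrow> \<rho>' x' < k \<Longrightarrow>
   (\<And>j z. k \<le> j \<Longrightarrow> \<tau> z = j \<longleftrightarrow> \<rho>' z = j) \<Longrightarrow> bump \<tau> k x' \<tau>' f' \<Longrightarrow> f' \<le> f"
proof (induction arbitrary: x' \<tau> \<tau>' f' rule: bump.induct)
  case (settle \<rho> k x)
  from settle.prems(6) show ?case
  proof cases
    case (push y)
    then have "(\<rho>(x := k)) y = k"
      using settle.prems(5)[of k y] by auto
    then have "y \<le> x"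
      using settle.hyps by (auto simp: not_less split: if_splits)
    then show ?thesis
      using push settle.prems by simp
  qed simp
next
  case (push \<rho> y k x \<rho>' f)
  from push.prems(6) show ?case
  proof cases
    case settle
    then show ?thesis
      using bump_final_row_ge[OF push.hyps(4)] by simp
  next
    case (push y')
    note p = push
    have "\<rho>' y' = k"
      using push.prems p by blast
    then have "(\<rho>(x := k, y := 0)) y' = k"
      using bump_lower_rows[OF push.hyps(4), of k y'] push.prems by auto
    then have y': "y' \<noteq> y" "\<rho> y' = k \<or> y' = x"
      using push.prems by (auto split: if_splits)
    then have "y < y'"
      using p push.hyps push.prems by fastforce
    show ?thesis
    proof (rule push.IH[OF _ _ \<open>y < y'\<close> _ _ p(4)])
      fix j z assume "Suc k \<le> j"
      then show "(\<tau>(x' := k, y' := 0)) z = j \<longleftrightarrow> \<rho>' z = j"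
        using push.prems(5)[of j z] push.prems(4) \<open>\<rho>' y' = k\<close> by auto
    qed (use \<open>\<rho>' y' = k\<close> in auto)
  qed
qed

text \<open>The first path ends in row \<open>Suc N\<close> at the lowest, and by
  \<open>bump_path_mono\<close> no later path ends lower than the one before it. The induction
  therefore carries the last path along.\<close>

lemma inserted_append_increasing:
  assumes "inserted ws \<rho>" "\<forall>v. \<rho> v \<le> N" "sorted_wrt (<) vs" "set ws \<inter> set vs = {}"
    "inserted (ws @ vs) \<rho>'"
  shows "\<forall>v. \<rho>' v \<le> Suc N"
proof -
  have "(\<forall>v. \<rho>' v \<le> Suc N) \<and> (vs \<noteq> [] \<longrightarrow> (\<exists>\<rho>0 f. inserted (ws @ butlast vs) \<rho>0 \<and>
      bump \<rho>0 1 (last vs) \<rho>' f \<and> f \<le> Suc N))"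
    using assms(3-5)
  proof (induction vs arbitrary: \<rho>' rule: rev_induct)
    case Nil
    then show ?case
      using inserted_deterministic[OF assms(1)] assms(2) by (auto simp: le_SucI)
  next
    case (snoc x vs)
    from snoc.prems(3) obtain \<rho>1 f where i1: "inserted (ws @ vs) \<rho>1" "bump \<rho>1 1 x \<rho>' f"
      using inserted_snocE[of "ws @ vs" x \<rho>'] by (metis append_assoc)
    have IH: "\<forall>v. \<rho>1 v \<le> Suc N" "vs \<noteq> [] \<longrightarrow> (\<exists>\<rho>0 f. inserted (ws @ butlast vs) \<rho>0 \<and>
      bump \<rho>0 1 (last vs) \<rho>1 f \<and> f \<le> Suc N)"
      using snoc.IH[OF _ _ i1(1)] snoc.prems by (auto simp: sorted_wrt_append)
    have x: "x \<notin> set (ws @ vs)"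
      using snoc.prems by (auto simp: sorted_wrt_append)
    have "f \<le> Suc N"
    proof (cases "vs = []")
      case True
      then have "\<rho>1 = \<rho>"
        using i1(1) assms(1) inserted_deterministic by simp
      then show ?thesis
        using bump_row_bounds[OF i1(2), of N] assms(2) by auto
    next
      case False
      with IH(2) obtain \<rho>0 f0 where i0: "inserted (ws @ butlast vs) \<rho>0"
        "bump \<rho>0 1 (last vs) \<rho>1 f0" "f0 \<le> Suc N"
        by blast
      have "last vs \<in> set vs" "distinct (butlast vs @ [last vs])"
        using False snoc.prems by (auto simp: sorted_wrt_append strict_sorted_iff)
      then have l: "last vs < x" "last vs \<notin> set (ws @ butlast vs)"
        using snoc.prems by (auto simp: sorted_wrt_append)
      have "\<rho>0 (last vs) = 0"
        using inserted_support[OF i0(1)] l by blast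
      moreover have "\<rho>1 x = 0"
        using inserted_support[OF i1(1)] x by blast
      ultimately have "f \<le> f0"
        using bump_path_mono[OF i0(2) _ _ l(1) _ _ i1(2)] by simp
      then show ?thesis
        using i0 by simp
    qed
    moreover have "\<forall>v. \<rho>' v \<le> Suc N"
      using bump_row_bounds[OF i1(2), of "Suc N"] IH(1) \<open>f \<le> Suc N\<close> by auto
    ultimately show ?case
      using i1 by auto
  qed
  then show ?thesis by blast
qed

text \<open>The letter in hand also has a smaller letter in row \<open>k - 1\<close>. When
  \<open>x\<close> displaces \<open>y\<close>, it becomes the witness for \<open>y\<close> on its
  way down and for every letter that relied on \<open>y\<close>.\<close>

lemma bump_above:
  "bump \<rho> k x \<rho>' f \<Longrightarrow> \<rho> x = 0 \<Longrightarrow> 1 \<le> k \<Longrightarrow> (\<And>v. 1 < \<rho> v \<Longrightarrow> \<exists>v'<v. Suc (\<rho> v') = \<rho> v) \<Longrightarrow>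
   (1 < k \<Longrightarrow> \<exists>v'<x. Suc (\<rho> v') = k) \<Longrightarrow> 1 < \<rho>' v \<Longrightarrow> \<exists>v'<v. Suc (\<rho>' v') = \<rho>' v"
proof (induction arbitrary: v rule: bump.induct)
  case (settle \<rho> k x)
  have *: "\<rho> v' = (\<rho>(x := k)) v'" if "\<rho> v' \<noteq> 0" for v'
    using that settle.prems by auto
  show ?case
  proof (cases "v = x")
    case True
    then obtain v' where "v' < x" "Suc (\<rho> v') = k"
      using settle.prems by auto
    then show ?thesis
      using True settle.prems(1) by auto
  next
    case False
    then obtain v' where "v' < v" "Suc (\<rho> v') = \<rho> v" "1 < \<rho> v"
      using settle.prems by auto
    then show ?thesis
      using False settle.prems(1) by (intro exI[of _ v']) auto
  qed
next
  case (push \<rho> y k x \<rho>' f)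
  show ?case
  proof (rule push.IH)
    fix v assume v: "1 < (\<rho>(x := k, y := 0)) v"
    show "\<exists>v'<v. Suc ((\<rho>(x := k, y := 0)) v') = (\<rho>(x := k, y := 0)) v"
    proof (cases "v = x")
      case True
      then obtain v' where "v' < x" "Suc (\<rho> v') = k"
        using push.prems(4) v by (auto split: if_splits)
      then show ?thesis
        using True v push.hyps by (intro exI[of _ v']) auto
    next
      case False
      then obtain v' where v': "v' < v" "Suc (\<rho> v') = \<rho> v" "1 < \<rho> v" "v \<noteq> y"
        using push.prems(3)[of v] v by (auto split: if_splits)
      then show ?thesis
        using False push.hyps push.prems(1)
        by (cases "v' = y"; intro exI[of _ "if v' = y then x else v'"]) auto
    qed
  next
    show "\<exists>v'<y. Suc ((\<rho>(x := k, y := 0)) v') = Suc k"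
      using push.hyps by (intro exI[of _ x]) auto
  qed (use push.prems in auto)
qed

lemma inserted_above:
  "inserted ws \<rho> \<Longrightarrow> distinct ws \<Longrightarrow> 1 < \<rho> v \<Longrightarrow> \<exists>v'<v. Suc (\<rho> v') = \<rho> v"
proof (induction arbitrary: v rule: inserted.induct)
  case (inserted_snoc ws \<rho> x \<rho>' f)
  have "\<rho> x = 0"
    using inserted_support[OF inserted_snoc.hyps(1)] inserted_snoc.prems by auto
  then show ?case
    using bump_above[OF inserted_snoc.hyps(2)] inserted_snoc by auto
qed auto

subsection \<open>Insertion of lists of rows\<close>

text \<open>Rows above \<open>k\<close> are left open, so that the relation can descend with the
  recursion of \<open>tableau_insert\<close>.\<close>

definition rows_rep :: "nat \<Rightarrow> nat list list \<Rightarrow> (nat \<Rightarrow> nat) \<Rightarrow> bool" where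
  "rows_rep k P \<rho> \<longleftrightarrow> (\<forall>j<length P. sorted_wrt (<) (P ! j) \<and> set (P ! j) = {v. \<rho> v = k + j}) \<and>
     (\<forall>v. \<rho> v < k + length P)"

lemma row_insert_None:
  "row_insert x r = (r', None) \<Longrightarrow> r' = r @ [x] \<and> (\<forall>y\<in>set r. \<not> x < y)"
  by (induction r arbitrary: r') (auto split: if_splits prod.splits)

lemma row_insert_Some:
  "row_insert x r = (r', Some y) \<Longrightarrow> sorted_wrt (<) r \<Longrightarrow> x \<notin> set r \<Longrightarrow>
   y \<in> set r \<and> x < y \<and> (\<forall>z\<in>set r. x < z \<longrightarrow> y \<le> z) \<and> set r' = insert x (set r - {y}) \<and>
   sorted_wrt (<) r'"
proof (induction r arbitrary: r')
  case (Cons a r)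
  show ?case
  proof (cases "x < a")
    case True
    then show ?thesis using Cons.prems by auto (meson less_trans)
  next
    case False
    then obtain r'' where r'': "row_insert x r = (r'', Some y)" "r' = a # r''"
      using Cons.prems(1) by (auto split: prod.splits)
    then show ?thesis
      using Cons.IH[OF r''(1)] Cons.prems False by auto
  qed
qed auto

lemma rows_rep_insert:
  "rows_rep k P \<rho> \<Longrightarrow> \<rho> x = 0 \<Longrightarrow> 1 \<le> k \<Longrightarrow>
   \<exists>\<rho>' f. bump \<rho> k x \<rho>' f \<and> rows_rep k (tableau_insert x P) \<rho>'"
proof (induction P arbitrary: k x \<rho>)
  case Nil
  then have "bump \<rho> k x (\<rho>(x := k)) k" "rows_rep k [[x]] (\<rho>(x := k))"
    by (auto intro!: settle simp: rows_rep_def less_Suc_eq)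
  then show ?case by auto
next
  case (Cons r P)
  have r: "sorted_wrt (<) r" "set r = {v. \<rho> v = k}"
    and P: "\<forall>j<length P. sorted_wrt (<) (P ! j) \<and> set (P ! j) = {v. \<rho> v = Suc k + j}"
      "\<forall>v. \<rho> v < Suc k + length P"
    using Cons.prems(1) by (auto simp: rows_rep_def All_less_Suc2)
  have x: "x \<notin> set r"
    using r Cons.prems by auto
  have rep_Cons: "rows_rep k (r' # P') \<rho>'" if "rows_rep (Suc k) P' \<rho>'" "sorted_wrt (<) r'"
    "set r' = {v. \<rho>' v = k}" for r' P' \<rho>'
    using that by (auto simp: rows_rep_def All_less_Suc2)
  show ?case
  proof (cases "row_insert x r")
    case (Pair r' o')
    show ?thesis
    proof (cases o')
      case None
      with Pair row_insert_None have r': "r' = r @ [x]" "\<forall>y\<in>set r. \<not> x < y"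
        by auto
      have "bump \<rho> k x (\<rho>(x := k)) k"
        by (rule settle) (use r r' in auto)
      moreover have "rows_rep (Suc k) P (\<rho>(x := k))"
        using P Cons.prems(2) by (auto simp: rows_rep_def)
      then have "rows_rep k (r' # P) (\<rho>(x := k))"
        by (rule rep_Cons)
          (use r r' x in \<open>auto simp: sorted_wrt_append not_less le_less split: if_splits\<close>)
      ultimately show ?thesis
        using Pair None by auto
    next
      case (Some y)
      with Pair row_insert_Some[OF _ r(1) x] have y: "y \<in> set r" "x < y"
        "\<forall>z\<in>set r. x < z \<longrightarrow> y \<le> z" "set r' = insert x (set r - {y})" "sorted_wrt (<) r'"
        by auto
      let ?\<rho> = "\<rho>(x := k, y := 0)"
      have "rows_rep (Suc k) P ?\<rho>"
        using P Cons.prems(2) r y by (auto simp: rows_rep_def)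
      from Cons.IH[OF this, of y, OF fun_upd_same] obtain \<rho>' f where \<rho>': "bump ?\<rho> (Suc k) y \<rho>' f"
        "rows_rep (Suc k) (tableau_insert y P) \<rho>'"
        by (auto simp del: fun_upd_apply)
      have "bump \<rho> k x \<rho>' f"
        by (rule push[OF _ _ _ \<rho>'(1)]) (use y r in auto)
      moreover have "set r' = {v. \<rho>' v = k}"
        using bump_lower_rows[OF \<rho>'(1), of k] Cons.prems y r by auto
      with \<rho>' y have "rows_rep k (r' # tableau_insert y P) \<rho>'"
        by (intro rep_Cons) auto
      ultimately show ?thesis
        using Pair Some by auto
    qed
  qed
qed

lemma inserted_rows_rep:
  "distinct ws \<Longrightarrow> \<exists>\<rho>. inserted ws \<rho> \<and> rows_rep 1 (insertion_rows ws) \<rho>"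
proof (induction ws rule: rev_induct)
  case Nil
  then show ?case
    by (auto intro!: exI[of _ "\<lambda>_. 0"] inserted_Nil simp: insertion_rows_def rows_rep_def)
next
  case (snoc x ws)
  then obtain \<rho> where \<rho>: "inserted ws \<rho>" "rows_rep 1 (insertion_rows ws) \<rho>"
    by auto
  have "\<rho> x = 0"
    using inserted_support[OF \<rho>(1)] snoc.prems by auto
  from rows_rep_insert[OF \<rho>(2) this] obtain \<rho>' f where "bump \<rho> 1 x \<rho>' f"
    "rows_rep 1 (tableau_insert x (insertion_rows ws)) \<rho>'"
    by auto
  then show ?case
    using inserted_snoc[OF \<rho>(1)] by (auto simp: insertion_rows_def)
qed

section \<open>Restriction to small letters\<close>

definition restrict_rows :: "nat \<Rightarrow> (nat \<Rightarrow> nat) \<Rightarrow> nat \<Rightarrow> nat" where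
  "restrict_rows N \<rho> v = (if v \<le> N then \<rho> v else 0)"

lemma restrict_bump_large:
  "bump \<rho> k x \<rho>' f \<Longrightarrow> N < x \<Longrightarrow> restrict_rows N \<rho>' = restrict_rows N \<rho>"
  by (induction rule: bump.induct) (auto simp: restrict_rows_def fun_eq_iff)

text \<open>A letter bumps only larger letters. As soon as the displaced letter exceeds
  \<open>N\<close>, the restricted insertion has settled and the rest of the path is invisible to
  it.\<close>

lemma restrict_bump:
  "bump \<rho> k x \<rho>' f \<Longrightarrow> x \<le> N \<Longrightarrow> 1 \<le> k \<Longrightarrow> \<exists>f'. bump (restrict_rows N \<rho>) k x (restrict_rows N \<rho>') f'"
proof (induction rule: bump.induct)
  case (settle \<rho> k x)
  have eq: "restrict_rows N (\<rho>(x := k)) = (restrict_rows N \<rho>)(x := k)"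
    using settle.prems by (auto simp: restrict_rows_def fun_eq_iff)
  show ?case
    unfolding eq by (rule exI, rule bump.settle) (use settle in \<open>auto simp: restrict_rows_def split: if_splits\<close>)
next
  case (push \<rho> y k x \<rho>' f)
  show ?case
  proof (cases "y \<le> N")
    case True
    have eq: "restrict_rows N (\<rho>(x := k, y := 0)) = (restrict_rows N \<rho>)(x := k, y := 0)"
      using push.prems by (auto simp: restrict_rows_def fun_eq_iff)
    have "1 \<le> Suc k"
      by simp
    from push.IH[OF True this] obtain f' where
      "bump ((restrict_rows N \<rho>)(x := k, y := 0)) (Suc k) y (restrict_rows N \<rho>') f'"
      unfolding eq by blast
    then have "bump (restrict_rows N \<rho>) k x (restrict_rows N \<rho>') f'"
      by (rule bump.push[rotated -1]) (use push True in \<open>auto simp: restrict_rows_def\<close>)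
    then show ?thesis ..
  next
    case False
    then have "restrict_rows N \<rho>' = restrict_rows N (\<rho>(x := k, y := 0))"
      using restrict_bump_large[OF push.hyps(4)] by simp
    also have "\<dots> = (restrict_rows N \<rho>)(x := k)"
      using False push by (auto simp: restrict_rows_def fun_eq_iff)
    finally have eq: "restrict_rows N \<rho>' = (restrict_rows N \<rho>)(x := k)" .
    show ?thesis
      unfolding eq
      by (rule exI, rule bump.settle) (use push False in \<open>auto simp: restrict_rows_def split: if_splits\<close>)
  qed
qed

lemma restrict_inserted:
  "inserted ws \<rho> \<Longrightarrow> inserted (filter (\<lambda>v. v \<le> N) ws) (restrict_rows N \<rho>)"
proof (induction rule: inserted.induct)
  case inserted_Nil
  then show ?case
    using inserted.inserted_Nil by (simp add: restrict_rows_def[abs_def])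
next
  case (inserted_snoc ws \<rho> x \<rho>' f)
  show ?case
  proof (cases "x \<le> N")
    case True
    then show ?thesis
      using restrict_bump[OF inserted_snoc.hyps(2) True] inserted.inserted_snoc inserted_snoc.IH
      by fastforce
  next
    case False
    then show ?thesis
      using restrict_bump_large[OF inserted_snoc.hyps(2)] inserted_snoc.IH by simp
  qed
qed

subsection \<open>Adjacent letters and exchanges in row insertion\<close>

definition types_ok :: "(nat \<Rightarrow> nat) \<Rightarrow> (nat \<Rightarrow> nat) \<Rightarrow> bool" where
  "types_ok cls \<rho> \<longleftrightarrow> (\<forall>v. \<rho> v \<noteq> 0 \<longrightarrow> \<rho> (Suc v) \<noteq> 0 \<longrightarrow>
     (cls v < cls (Suc v) \<longrightarrow> \<rho> (Suc v) \<le> \<rho> v) \<and> (cls (Suc v) < cls v \<longrightarrow> \<rho> v < \<rho> (Suc v)))"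

text \<open>The letter in hand counts as lying between rows \<open>k - 1\<close> and
  \<open>k\<close>; under this reading all four comparisons are those of \<open>types_ok\<close>. In
  particular \<open>Suc x\<close> may still stand in row \<open>k\<close> if its class is smaller,
  because \<open>x\<close> is then about to bump it.\<close>

definition hand_ok :: "(nat \<Rightarrow> nat) \<Rightarrow> (nat \<Rightarrow> nat) \<Rightarrow> nat \<Rightarrow> nat \<Rightarrow> bool" where
  "hand_ok cls \<rho> k x \<longleftrightarrow> \<rho> x = 0 \<and> 1 \<le> k \<and> types_ok cls \<rho> \<and>
     (\<forall>v. x = Suc v \<longrightarrow> \<rho> v \<noteq> 0 \<longrightarrow> (cls v < cls x \<longrightarrow> k \<le> \<rho> v) \<and> (cls x < cls v \<longrightarrow> \<rho> v < k)) \<and>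
     (\<rho> (Suc x) \<noteq> 0 \<longrightarrow> (cls x < cls (Suc x) \<longrightarrow> \<rho> (Suc x) < k) \<and>
        (cls (Suc x) < cls x \<longrightarrow> k \<le> \<rho> (Suc x)))"

lemma types_okD:
  assumes "types_ok cls \<rho>" "\<rho> v \<noteq> 0" "\<rho> (Suc v) \<noteq> 0"
  shows "cls v < cls (Suc v) \<Longrightarrow> \<rho> (Suc v) \<le> \<rho> v" "cls (Suc v) < cls v \<Longrightarrow> \<rho> v < \<rho> (Suc v)"
  using assms by (auto simp: types_ok_def)

lemma hand_okD:
  assumes "hand_ok cls \<rho> k x"
  shows "\<rho> x = 0" "1 \<le> k" "types_ok cls \<rho>"
    "x = Suc v \<Longrightarrow> \<rho> v \<noteq> 0 \<Longrightarrow> cls v < cls x \<Longrightarrow> k \<le> \<rho> v"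
    "x = Suc v \<Longrightarrow> \<rho> v \<noteq> 0 \<Longrightarrow> cls x < cls v \<Longrightarrow> \<rho> v < k"
    "\<rho> (Suc x) \<noteq> 0 \<Longrightarrow> cls x < cls (Suc x) \<Longrightarrow> \<rho> (Suc x) < k"
    "\<rho> (Suc x) \<noteq> 0 \<Longrightarrow> cls (Suc x) < cls x \<Longrightarrow> k \<le> \<rho> (Suc x)"
  using assms by (auto simp: hand_ok_def)

lemma hand_ok_settle:
  assumes "hand_ok cls \<rho> k x" "\<forall>y. \<rho> y = k \<longrightarrow> \<not> x < y"
  shows "types_ok cls (\<rho>(x := k))"
  unfolding types_ok_def
proof (intro allI impI)
  fix v assume v: "(\<rho>(x := k)) v \<noteq> 0" "(\<rho>(x := k)) (Suc v) \<noteq> 0"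
  note h = hand_okD[OF assms(1)]
  have "\<rho> (Suc x) \<noteq> k"
    using assms(2) by auto
  then show "(cls v < cls (Suc v) \<longrightarrow> (\<rho>(x := k)) (Suc v) \<le> (\<rho>(x := k)) v) \<and>
      (cls (Suc v) < cls v \<longrightarrow> (\<rho>(x := k)) v < (\<rho>(x := k)) (Suc v))"
    using v h(4,5)[of v] h(6,7) types_okD[OF h(3), of v] by (auto split: if_splits)
qed

lemma hand_ok_push:
  assumes "hand_ok cls \<rho> k x" "\<rho> y = k" "x < y" "\<forall>z. \<rho> z = k \<longrightarrow> x < z \<longrightarrow> y \<le> z"
  shows "hand_ok cls (\<rho>(x := k, y := 0)) (Suc k) y"
proof -
  note h = hand_okD[OF assms(1)]
  let ?\<rho> = "\<rho>(x := k, y := 0)"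
  \<comment> \<open>If \<open>Suc x\<close> stands in row \<open>k\<close>, it is the least letter
    above \<open>x\<close> there and is the one bumped.\<close>
  have Suc_x: "Suc x = y \<or> \<rho> (Suc x) < k \<or> k < \<rho> (Suc x)"
    using assms(3,4) by (metis Suc_leI le_antisym lessI linorder_neqE_nat)
  have "types_ok cls ?\<rho>"
    unfolding types_ok_def
  proof (intro allI impI)
    fix v assume v: "?\<rho> v \<noteq> 0" "?\<rho> (Suc v) \<noteq> 0"
    then show "(cls v < cls (Suc v) \<longrightarrow> ?\<rho> (Suc v) \<le> ?\<rho> v) \<and>
        (cls (Suc v) < cls v \<longrightarrow> ?\<rho> v < ?\<rho> (Suc v))"
      using h(4,5)[of v] h(6,7) types_okD[OF h(3), of v] Suc_x by (auto split: if_splits)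
  qed
  moreover have "(cls v < cls y \<longrightarrow> Suc k \<le> ?\<rho> v) \<and> (cls y < cls v \<longrightarrow> ?\<rho> v < Suc k)"
    if "y = Suc v" "?\<rho> v \<noteq> 0" for v
  proof (cases "v = x")
    case True
    then show ?thesis
      using that h(2,6) assms(2) by auto
  next
    case False
    then have "x < v" "\<rho> v \<noteq> 0"
      using that assms(3) by auto
    then have "\<rho> v \<noteq> k"
      using assms(4) that by auto
    then show ?thesis
      using types_okD[OF h(3), of v] that False assms(2) h(2) \<open>\<rho> v \<noteq> 0\<close> by auto
  qed
  moreover have "(cls y < cls (Suc y) \<longrightarrow> ?\<rho> (Suc y) < Suc k) \<and>
      (cls (Suc y) < cls y \<longrightarrow> Suc k \<le> ?\<rho> (Suc y))" if "?\<rho> (Suc y) \<noteq> 0"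
    using types_okD[OF h(3), of y] that assms(2,3) h(2) by auto
  ultimately show ?thesis
    by (auto simp: hand_ok_def)
qed

lemma bump_types_ok: "bump \<rho> k x \<rho>' f \<Longrightarrow> hand_ok cls \<rho> k x \<Longrightarrow> types_ok cls \<rho>'"
proof (induction rule: bump.induct)
  case (settle \<rho> k x)
  then show ?case using hand_ok_settle by blast
next
  case (push \<rho> y k x \<rho>' f)
  then show ?case using hand_ok_push by blast
qed

text \<open>Letters arrive by increasing class, so the new letter has maximal class; the comparisons
  this leaves are with row \<open>1\<close> and hold for every letter present.\<close>

lemma hand_ok_start:
  assumes "inserted ws \<rho>" "types_ok cls \<rho>" "x \<notin> set ws" "\<forall>v\<in>set ws. cls v \<le> cls x"
  shows "hand_ok cls \<rho> 1 x"
proof -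
  have "\<rho> x = 0" and le: "cls v \<le> cls x" if "\<rho> v \<noteq> 0" for v
    using inserted_support[OF assms(1)] assms(3,4) that by auto
  moreover have "\<rho> x = 0"
    using inserted_support[OF assms(1)] assms(3) by blast
  ultimately show ?thesis
    using assms(2) le by (auto simp: hand_ok_def not_less[symmetric])
qed

lemma inserted_types_ok:
  "inserted ws \<rho> \<Longrightarrow> distinct ws \<Longrightarrow> sorted_wrt (\<lambda>v w. cls v \<le> cls w) ws \<Longrightarrow> types_ok cls \<rho>"
proof (induction rule: inserted.induct)
  case inserted_Nil
  then show ?case by (simp add: types_ok_def)
next
  case (inserted_snoc ws \<rho> x \<rho>' f)
  have "hand_ok cls \<rho> 1 x"
    by (rule hand_ok_start[OF inserted_snoc.hyps(1)])
      (use inserted_snoc in \<open>auto simp: sorted_wrt_append\<close>)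
  then show ?case
    using bump_types_ok inserted_snoc.hyps by blast
qed

section \<open>Insertion under the exchange of two consecutive letters\<close>

abbreviation swap :: "nat \<Rightarrow> nat \<Rightarrow> nat" where
  "swap t \<equiv> transpose t (Suc t)"

lemma swap_eq_swap_iff [simp]: "swap t x = swap t y \<longleftrightarrow> x = y"
  by (metis transpose_involutory)

lemma swap_strict_mono: "p < q \<Longrightarrow> \<not> (p = t \<and> q = Suc t) \<Longrightarrow> swap t p < swap t q"
  by (auto simp: transpose_def)

lemma fun_upd_comp_swap: "(\<rho>(x := k)) \<circ> swap t = (\<rho> \<circ> swap t)(swap t x := k)"
  by (rule ext) (auto simp: transpose_def)

text \<open>Renaming \<open>t\<close> and \<open>Suc t\<close> into each other reverses only their
  mutual comparison. An insertion step compares the letter in hand and the letters of row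
  \<open>k\<close>, so outside the three excluded situations it commutes with the renaming.\<close>

definition no_conflict :: "(nat \<Rightarrow> nat) \<Rightarrow> nat \<Rightarrow> nat \<Rightarrow> nat \<Rightarrow> bool" where
  "no_conflict \<rho> k x t \<longleftrightarrow> \<not> (x = t \<and> \<rho> (Suc t) = k) \<and> \<not> (x = Suc t \<and> \<rho> t = k) \<and>
     \<not> (\<rho> t = k \<and> \<rho> (Suc t) = k)"

lemma no_conflict_settle:
  assumes "no_conflict \<rho> k x t" "\<forall>y. \<rho> y = k \<longrightarrow> \<not> x < y"
  shows "\<forall>y. (\<rho> \<circ> swap t) y = k \<longrightarrow> \<not> swap t x < y"
proof (intro allI impI notI)
  fix y assume y: "(\<rho> \<circ> swap t) y = k" "swap t x < y"
  have "swap t (swap t x) < swap t y"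
    using y assms(1) by (intro swap_strict_mono) (auto simp: no_conflict_def transpose_def)
  then show False
    using assms(2) y by auto
qed

lemma no_conflict_push:
  assumes "no_conflict \<rho> k x t" "\<rho> y = k" "x < y" "\<forall>z. \<rho> z = k \<longrightarrow> x < z \<longrightarrow> y \<le> z"
  shows "(\<rho> \<circ> swap t) (swap t y) = k" "swap t x < swap t y"
    "\<forall>z. (\<rho> \<circ> swap t) z = k \<longrightarrow> swap t x < z \<longrightarrow> swap t y \<le> z"
proof -
  show "swap t x < swap t y"
    using assms by (intro swap_strict_mono) (auto simp: no_conflict_def)
  show "\<forall>z. (\<rho> \<circ> swap t) z = k \<longrightarrow> swap t x < z \<longrightarrow> swap t y \<le> z"
  proof (intro allI impI)
    fix z assume z: "(\<rho> \<circ> swap t) z = k" "swap t x < z"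
    have "swap t (swap t x) < swap t z"
      using z assms(1) by (intro swap_strict_mono) (auto simp: no_conflict_def transpose_def)
    then have "y \<le> swap t z"
      using assms(4) z by auto
    then consider "y = swap t z" | "y < swap t z"
      by linarith
    then show "swap t y \<le> z"
    proof cases
      case 2
      have "swap t y < swap t (swap t z)"
        using z(1) assms(1,2) by (intro swap_strict_mono[OF 2]) (auto simp: no_conflict_def)
      then show ?thesis by simp
    qed simp
  qed
qed (use assms in auto)

definition opposite :: "(nat \<Rightarrow> nat) \<Rightarrow> (nat \<Rightarrow> nat) \<Rightarrow> nat \<Rightarrow> bool" where
  "opposite cls cls' v \<longleftrightarrow> cls v < cls (Suc v) \<and> cls' (Suc v) < cls' v \<or>
     cls (Suc v) < cls v \<and> cls' v < cls' (Suc v)"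

text \<open>The letter \<open>a\<close> is the witness. If one of its two successors in hand met the
  other in row \<open>k\<close>, the rule for \<open>a\<close> and \<open>Suc a\<close> in one
  tableau and the reversed rule in the other would place \<open>a\<close> both above row
  \<open>k\<close> and not above it. If both already stood in row \<open>k\<close>, the strict rule
  for this pair would fail in one of the tableaux.\<close>

lemma opposite_no_conflict:
  assumes "hand_ok cls \<rho> k x" "hand_ok cls' (\<rho> \<circ> swap (Suc a)) k (swap (Suc a) x)"
    "opposite cls cls' a" "opposite cls cls' (Suc a)"
    "(\<forall>v\<in>{Suc a, Suc (Suc a)}. \<rho> v \<noteq> 0 \<or> x = v) \<longrightarrow> \<rho> a \<noteq> 0 \<or> x = a"
  shows "no_conflict \<rho> k x (Suc a)"
proof -
  let ?\<rho> = "\<rho> \<circ> swap (Suc a)"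
  note h = hand_okD[OF assms(1)] and h' = hand_okD[OF assms(2)]
  have sw: "?\<rho> a = \<rho> a" "?\<rho> (Suc a) = \<rho> (Suc (Suc a))" "?\<rho> (Suc (Suc a)) = \<rho> (Suc a)"
    by (auto simp: transpose_def)
  have "\<not> (\<rho> (Suc a) = k \<and> \<rho> (Suc (Suc a)) = k)"
    using types_okD[OF h(3), of "Suc a"] types_okD[OF h'(3), of "Suc a"] assms(4) h(2)
    unfolding sw by (auto simp: opposite_def)
  moreover have "\<not> (x = Suc a \<and> \<rho> (Suc (Suc a)) = k)"
  proof
    assume x: "x = Suc a \<and> \<rho> (Suc (Suc a)) = k"
    then have "\<rho> a \<noteq> 0"
      using assms(5) h(2) by auto
    then show False
      using h(4,5)[of a] types_okD[OF h'(3), of a] assms(3) x h(2) unfolding sw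
      by (auto simp: opposite_def)
  qed
  moreover have "\<not> (x = Suc (Suc a) \<and> \<rho> (Suc a) = k)"
  proof
    assume x: "x = Suc (Suc a) \<and> \<rho> (Suc a) = k"
    then have "\<rho> a \<noteq> 0" "swap (Suc a) x = Suc a"
      using assms(5) h(2) by auto
    then show False
      using h'(4,5)[of a] types_okD[OF h(3), of a] assms(3) x h(2) unfolding sw
      by (auto simp: opposite_def)
  qed
  ultimately show ?thesis
    by (simp add: no_conflict_def)
qed

lemma bump_swap_calm:
  "bump \<rho> k x \<rho>' f \<Longrightarrow> hand_ok cls \<rho> k x \<Longrightarrow>
   hand_ok cls' (\<rho> \<circ> swap (Suc a)) k (swap (Suc a) x) \<Longrightarrow>
   opposite cls cls' a \<Longrightarrow> opposite cls cls' (Suc a) \<Longrightarrow>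
   (\<forall>v\<in>{Suc a, Suc (Suc a)}. \<rho> v \<noteq> 0 \<or> x = v) \<longrightarrow> \<rho> a \<noteq> 0 \<or> x = a \<Longrightarrow>
   bump (\<rho> \<circ> swap (Suc a)) k (swap (Suc a) x) (\<rho>' \<circ> swap (Suc a)) f"
proof (induction rule: bump.induct)
  case (settle \<rho> k x)
  note nc = opposite_no_conflict[OF settle.prems]
  show ?case
    unfolding fun_upd_comp_swap
    by (rule bump.settle, rule no_conflict_settle[OF nc settle.hyps])
next
  case (push \<rho> y k x \<rho>' f)
  note nc = opposite_no_conflict[OF push.prems]
  note p = no_conflict_push[OF nc push.hyps(1-3)]
  have h: "hand_ok cls (\<rho>(x := k, y := 0)) (Suc k) y"
    by (rule hand_ok_push[OF push.prems(1) push.hyps(1-3)])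
  have h': "hand_ok cls' (\<rho>(x := k, y := 0) \<circ> swap (Suc a)) (Suc k) (swap (Suc a) y)"
    unfolding fun_upd_comp_swap by (rule hand_ok_push[OF push.prems(2) p])
  have "bump (\<rho>(x := k, y := 0) \<circ> swap (Suc a)) (Suc k) (swap (Suc a) y) (\<rho>' \<circ> swap (Suc a)) f"
    by (rule push.IH[OF h h' push.prems(3,4)])
      (use push.hyps push.prems(5) hand_okD(1,2)[OF push.prems(1)] in \<open>auto split: if_splits\<close>)
  then show ?case
    unfolding fun_upd_comp_swap by (rule bump.push[OF p])
qed

text \<open>Now the largest letter is the witness. If \<open>a\<close> and \<open>Suc a\<close>
  compete in row \<open>k\<close>, the rules force \<open>Suc (Suc a)\<close> into row
  \<open>k\<close> as well; one insertion then bumps \<open>Suc a\<close> and the other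
  \<open>Suc (Suc a)\<close>. From there on the tableaux differ by the exchange of these two, and
  \<open>bump_swap_calm\<close> finishes the path.\<close>

lemma bump_swap_high:
  "bump \<rho> k x \<rho>' f \<Longrightarrow> hand_ok cls \<rho> k x \<Longrightarrow> hand_ok cls' (\<rho> \<circ> swap a) k (swap a x) \<Longrightarrow>
   cls' = cls \<circ> swap a \<Longrightarrow> between (cls (Suc (Suc a))) (cls a) (cls (Suc a)) \<Longrightarrow>
   (\<forall>v\<in>{a, Suc a}. \<rho> v \<noteq> 0 \<or> x = v) \<longrightarrow> \<rho> (Suc (Suc a)) \<noteq> 0 \<or> x = Suc (Suc a) \<Longrightarrow>
   bump (\<rho> \<circ> swap a) k (swap a x) (\<rho>' \<circ> swap a) f \<or>
   bump (\<rho> \<circ> swap a) k (swap a x) (\<rho>' \<circ> swap (Suc a)) f \<and>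
     (\<forall>v\<in>{a, Suc a, Suc (Suc a)}. \<rho> v \<noteq> 0 \<or> x = v)"
proof (induction rule: bump.induct)
  case (settle \<rho> k x)
  note h = hand_okD[OF settle.prems(1)] and h' = hand_okD[OF settle.prems(2)]
  let ?p = "Suc (Suc a)"
  have sw: "(\<rho> \<circ> swap a) a = \<rho> (Suc a)" "(\<rho> \<circ> swap a) (Suc a) = \<rho> a" "(\<rho> \<circ> swap a) ?p = \<rho> ?p"
    by (auto simp: transpose_def)
  have csw: "cls' a = cls (Suc a)" "cls' (Suc a) = cls a" "cls' ?p = cls ?p"
    unfolding settle.prems(3) by (auto simp: transpose_def)
  have "no_conflict \<rho> k x a"
  proof -
    have "\<not> (\<rho> a = k \<and> \<rho> (Suc a) = k)"
      using types_okD[OF h(3), of a] types_okD[OF h'(3), of a] settle.prems(4) h(2)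
      unfolding sw csw by (auto simp: between_def)
    \<comment> \<open>A conflict would put the witness into row \<open>k\<close>; being larger than
      \<open>x\<close>, it would prevent \<open>x\<close> from settling.\<close>
    moreover have "\<not> (x = Suc a \<and> \<rho> a = k)"
    proof
      assume x: "x = Suc a \<and> \<rho> a = k"
      then have "\<rho> ?p \<noteq> 0" "swap a x = a"
        using settle.prems(5) h(2) by auto
      moreover have "\<rho> ?p \<noteq> k"
        using settle.hyps x by auto
      ultimately show False
        using h'(6,7) h(6,7) types_okD[OF h'(3), of "Suc a"] x settle.prems(4) h(2)
        unfolding sw csw by (auto simp: between_def sw csw)
    qed
    ultimately show ?thesis
      using settle.hyps by (auto simp: no_conflict_def)
  qed
  then have "bump (\<rho> \<circ> swap a) k (swap a x) ((\<rho> \<circ> swap a)(swap a x := k)) k"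
    by (intro bump.settle no_conflict_settle settle.hyps)
  then show ?case
    unfolding fun_upd_comp_swap by blast
next
  case (push \<rho> y k x \<rho>' f)
  note h = hand_okD[OF push.prems(1)] and h' = hand_okD[OF push.prems(2)]
  let ?p = "Suc (Suc a)"
  have sw: "(\<rho> \<circ> swap a) a = \<rho> (Suc a)" "(\<rho> \<circ> swap a) (Suc a) = \<rho> a" "(\<rho> \<circ> swap a) ?p = \<rho> ?p"
    by (auto simp: transpose_def)
  have csw: "cls' a = cls (Suc a)" "cls' (Suc a) = cls a" "cls' ?p = cls ?p"
    unfolding push.prems(3) by (auto simp: transpose_def)
  have opp: "opposite cls cls' a" "opposite cls cls' (Suc a)"
    using push.prems(4) by (auto simp: opposite_def csw between_def)
  have hp: "hand_ok cls (\<rho>(x := k, y := 0)) (Suc k) y"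
    by (rule hand_ok_push[OF push.prems(1) push.hyps(1-3)])
  have both: "\<not> (\<rho> a = k \<and> \<rho> (Suc a) = k)"
    using types_okD[OF h(3), of a] types_okD[OF h'(3), of a] push.prems(4) h(2)
    unfolding sw csw by (auto simp: between_def)
  show ?case
  proof (cases "no_conflict \<rho> k x a")
    case True
    note p = no_conflict_push[OF True push.hyps(1-3)]
    have h': "hand_ok cls' (\<rho>(x := k, y := 0) \<circ> swap a) (Suc k) (swap a y)"
      unfolding fun_upd_comp_swap by (rule hand_ok_push[OF push.prems(2) p])
    have "bump (\<rho>(x := k, y := 0) \<circ> swap a) (Suc k) (swap a y) (\<rho>' \<circ> swap a) f \<or>
      bump (\<rho>(x := k, y := 0) \<circ> swap a) (Suc k) (swap a y) (\<rho>' \<circ> swap (Suc a)) f \<and>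
     (\<forall>v\<in>{a, Suc a, Suc (Suc a)}. (\<rho>(x := k, y := 0)) v \<noteq> 0 \<or> y = v)"
      by (rule push.IH[OF hp h' push.prems(3,4)])
        (use push.hyps push.prems(5) h(1,2) in \<open>auto split: if_splits\<close>)
    then show ?thesis
    proof (elim disjE conjE)
      assume "bump (\<rho>(x := k, y := 0) \<circ> swap a) (Suc k) (swap a y) (\<rho>' \<circ> swap a) f"
      then show ?thesis
        unfolding fun_upd_comp_swap using bump.push[OF p] by blast
    next
      assume *: "bump (\<rho>(x := k, y := 0) \<circ> swap a) (Suc k) (swap a y) (\<rho>' \<circ> swap (Suc a)) f"
        "\<forall>v\<in>{a, Suc a, Suc (Suc a)}. (\<rho>(x := k, y := 0)) v \<noteq> 0 \<or> y = v"
      have "\<forall>v\<in>{a, Suc a, Suc (Suc a)}. \<rho> v \<noteq> 0 \<or> x = v"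
        using *(2) push.hyps(1) h(2) by (auto split: if_splits)
      with *(1) show ?thesis
        unfolding fun_upd_comp_swap using bump.push[OF p] by blast
    qed
  next
    case False
    then consider "x = a" "\<rho> (Suc a) = k" | "x = Suc a" "\<rho> a = k"
      using both by (auto simp: no_conflict_def)
    then show ?thesis
    proof cases
      case 1
      have p0: "\<rho> ?p \<noteq> 0" "swap a x = Suc a"
        using push.prems(5) 1 h(2) by auto
      have lt: "cls (Suc a) < cls ?p" "cls ?p < cls a"
        using h(6) 1 h(2) push.prems(4) by (auto simp: between_def)
      have "\<rho> ?p \<le> k"
        using types_okD(1)[OF h(3), of "Suc a"] p0 1 lt h(2) by auto
      moreover have "k \<le> \<rho> ?p"
        using h'(7) p0 lt unfolding p0(2) sw csw by auto
      ultimately have pk: "\<rho> ?p = k"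
        by simp
      have y: "y = Suc a"
        using push.hyps(2,3) 1 by (metis Suc_leI le_antisym lessI)
      then have sy: "swap (Suc a) y = ?p"
        by simp
      have eq: "\<rho>(x := k, y := 0) \<circ> swap (Suc a) = (\<rho> \<circ> swap a)(Suc a := k, ?p := 0)"
        using 1 pk y by (auto simp: fun_eq_iff transpose_def)
      have pu: "(\<rho> \<circ> swap a) ?p = k" "Suc a < ?p"
        "\<forall>z. (\<rho> \<circ> swap a) z = k \<longrightarrow> Suc a < z \<longrightarrow> ?p \<le> z"
        using pk by (auto simp: transpose_def)
      have h2: "hand_ok cls' (\<rho>(x := k, y := 0) \<circ> swap (Suc a)) (Suc k) (swap (Suc a) y)"
        unfolding eq sy by (rule hand_ok_push[OF _ pu]) (use push.prems(2) p0(2) in simp)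
      have "bump (\<rho>(x := k, y := 0) \<circ> swap (Suc a)) (Suc k) (swap (Suc a) y) (\<rho>' \<circ> swap (Suc a)) f"
        by (rule bump_swap_calm[OF push.hyps(4) hp h2 opp]) (use 1 y h(2) in auto)
      then have "bump (\<rho> \<circ> swap a) k (swap a x) (\<rho>' \<circ> swap (Suc a)) f"
        unfolding eq p0(2) sy by (rule bump.push[OF pu])
      moreover have "\<forall>v\<in>{a, Suc a, ?p}. \<rho> v \<noteq> 0 \<or> x = v"
        using 1 p0 h(2) by auto
      ultimately show ?thesis
        by blast
    next
      case 2
      have p0: "\<rho> ?p \<noteq> 0" "swap a x = a"
        using push.prems(5) 2 h(2) by auto
      have lt: "cls a < cls ?p" "cls ?p < cls (Suc a)"
        using h'(6) 2 h(2) push.prems(4) unfolding p0(2) sw csw by (auto simp: between_def)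
      have "\<rho> ?p \<le> k"
        using types_okD(1)[OF h'(3), of "Suc a"] p0 2 lt h(2) unfolding sw csw by auto
      moreover have "k \<le> \<rho> ?p"
        using h(7) p0 lt 2 by auto
      ultimately have pk: "\<rho> ?p = k"
        by simp
      have y: "y = ?p"
        using push.hyps(2,3) 2 pk by (metis Suc_leI le_antisym lessI)
      then have sy: "swap (Suc a) y = Suc a"
        by simp
      have eq: "\<rho>(x := k, y := 0) \<circ> swap (Suc a) = (\<rho> \<circ> swap a)(a := k, Suc a := 0)"
        using 2 pk y by (auto simp: fun_eq_iff transpose_def)
      have pu: "(\<rho> \<circ> swap a) (Suc a) = k" "a < Suc a"
        "\<forall>z. (\<rho> \<circ> swap a) z = k \<longrightarrow> a < z \<longrightarrow> Suc a \<le> z"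
        using 2 by (auto simp: transpose_def)
      have h2: "hand_ok cls' (\<rho>(x := k, y := 0) \<circ> swap (Suc a)) (Suc k) (swap (Suc a) y)"
        unfolding eq sy by (rule hand_ok_push[OF _ pu]) (use push.prems(2) p0(2) in simp)
      have "bump (\<rho>(x := k, y := 0) \<circ> swap (Suc a)) (Suc k) (swap (Suc a) y) (\<rho>' \<circ> swap (Suc a)) f"
        by (rule bump_swap_calm[OF push.hyps(4) hp h2 opp]) (use 2 y h(2) in auto)
      then have "bump (\<rho> \<circ> swap a) k (swap a x) (\<rho>' \<circ> swap (Suc a)) f"
        unfolding eq p0(2) sy by (rule bump.push[OF pu])
      moreover have "\<forall>v\<in>{a, Suc a, ?p}. \<rho> v \<noteq> 0 \<or> x = v"
        using 2 p0 h(2) by auto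
      ultimately show ?thesis
        by blast
    qed
  qed
qed

lemma inserted_prefix: "inserted (ws @ vs) \<rho> \<Longrightarrow> \<exists>\<rho>'. inserted ws \<rho>'"
proof (induction vs arbitrary: \<rho> rule: rev_induct)
  case (snoc x vs)
  then show ?case
    using inserted_snocE[of "ws @ vs" x \<rho>] by (metis append_assoc)
qed auto

lemma prefix_class_closed:
  assumes "sorted_wrt (\<lambda>v w. cls v \<le> (cls w :: nat)) (ws @ vs)" "v \<in> set ws" "w \<in> set (ws @ vs)"
    "cls w < cls v"
  shows "w \<in> set ws"
  using assms by (fastforce simp: sorted_wrt_append)

text \<open>The class of the witness is smaller than the larger of the two exchanged classes. As
  letters arrive by increasing class, a prefix containing both exchanged letters contains the
  witness, which is the presence condition of \<open>bump_swap_calm\<close>.\<close>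

lemma inserted_swap_low:
  assumes "distinct W" "sorted_wrt (\<lambda>v w. cls v \<le> cls w) W" "cls' = cls \<circ> swap (Suc a)"
    "between (cls a) (cls (Suc a)) (cls (Suc (Suc a)))" "{a, Suc a, Suc (Suc a)} \<subseteq> set W"
    "W = ws @ vs" "inserted ws \<rho>"
  shows "inserted (map (swap (Suc a)) ws) (\<rho> \<circ> swap (Suc a))"
  using assms(6,7)
proof (induction ws arbitrary: vs \<rho> rule: rev_induct)
  case Nil
  then have "\<rho> = (\<lambda>_. 0)"
    using inserted_deterministic inserted_Nil by blast
  then show ?case
    using inserted_Nil by (simp add: comp_def)
next
  case (snoc x ws)
  let ?\<pi> = "swap (Suc a)"
  obtain \<rho>0 f where i: "inserted ws \<rho>0" "bump \<rho>0 1 x \<rho> f"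
    using inserted_snocE[OF snoc.prems(2)] .
  have W: "W = ws @ (x # vs)"
    using snoc.prems by simp
  have x: "x \<notin> set ws" "\<forall>v\<in>set ws. cls v \<le> cls x" "distinct ws"
    "sorted_wrt (\<lambda>v w. cls v \<le> cls w) ws"
    using assms(1,2) W by (auto simp: sorted_wrt_append)
  have i': "inserted (map ?\<pi> ws) (\<rho>0 \<circ> ?\<pi>)"
    by (rule snoc.IH[OF W i(1)])
  have "hand_ok cls \<rho>0 1 x"
    using hand_ok_start[OF i(1) inserted_types_ok[OF i(1) x(3,4)] x(1,2)] .
  moreover have "hand_ok cls' (\<rho>0 \<circ> ?\<pi>) 1 (?\<pi> x)"
  proof (rule hand_ok_start[OF i'])
    show "types_ok cls' (\<rho>0 \<circ> ?\<pi>)"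
      by (rule inserted_types_ok[OF i']) (use x assms(3) in \<open>auto simp: distinct_map sorted_wrt_map intro: inj_on_subset[OF inj_transpose]\<close>)
  qed (use x assms(3) in auto)
  moreover have "opposite cls cls' a" "opposite cls cls' (Suc a)"
    using assms(4) unfolding assms(3) by (auto simp: opposite_def between_def transpose_def)
  moreover have "(\<forall>v\<in>{Suc a, Suc (Suc a)}. \<rho>0 v \<noteq> 0 \<or> x = v) \<longrightarrow> \<rho>0 a \<noteq> 0 \<or> x = a"
  proof
    assume "\<forall>v\<in>{Suc a, Suc (Suc a)}. \<rho>0 v \<noteq> 0 \<or> x = v"
    then have *: "Suc a \<in> set (ws @ [x])" "Suc (Suc a) \<in> set (ws @ [x])"
      using inserted_support[OF i(1)] by auto
    have "a \<in> set (ws @ [x])"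
      using prefix_class_closed[of cls "ws @ [x]" vs _ a] * assms(2,4,5) snoc.prems(1)
      unfolding between_def by (metis insert_subset)
    then show "\<rho>0 a \<noteq> 0 \<or> x = a"
      using inserted_support[OF i(1), of a] by auto
  qed
  ultimately have "bump (\<rho>0 \<circ> ?\<pi>) 1 (?\<pi> x) (\<rho> \<circ> ?\<pi>) f"
    using bump_swap_calm[OF i(2)] by blast
  from inserted_snoc[OF i' this] show ?case
    by (simp only: map_append list.map)
qed

text \<open>When the tableaux begin to differ by the exchange of \<open>Suc a\<close> and
  \<open>Suc (Suc a)\<close>, all three letters are present. Later letters are fixed by both
  transpositions, so the words may keep differing by the first exchange while the tableaux differ by
  the second.\<close>

lemma inserted_swap_high:
  assumes "distinct W" "sorted_wrt (\<lambda>v w. cls v \<le> cls w) W" "cls' = cls \<circ> swap a"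
    "between (cls (Suc (Suc a))) (cls a) (cls (Suc a))" "{a, Suc a, Suc (Suc a)} \<subseteq> set W"
    "W = ws @ vs" "inserted ws \<rho>"
  shows "inserted (map (swap a) ws) (\<rho> \<circ> swap a) \<or>
    inserted (map (swap a) ws) (\<rho> \<circ> swap (Suc a)) \<and> {a, Suc a, Suc (Suc a)} \<subseteq> set ws"
  using assms(6,7)
proof (induction ws arbitrary: vs \<rho> rule: rev_induct)
  case Nil
  then have "\<rho> = (\<lambda>_. 0)"
    using inserted_deterministic inserted_Nil by blast
  then show ?case
    using inserted_Nil by (simp add: comp_def)
next
  case (snoc x ws)
  let ?\<pi> = "swap a" and ?\<pi>' = "swap (Suc a)"
  obtain \<rho>0 f where i: "inserted ws \<rho>0" "bump \<rho>0 1 x \<rho> f"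
    using inserted_snocE[OF snoc.prems(2)] .
  have W: "W = ws @ (x # vs)"
    using snoc.prems by simp
  have x: "x \<notin> set ws" "\<forall>v\<in>set ws. cls v \<le> cls x" "distinct ws"
    "sorted_wrt (\<lambda>v w. cls v \<le> cls w) ws"
    using assms(1,2) W by (auto simp: sorted_wrt_append)
  have h: "hand_ok cls \<rho>0 1 x"
    using hand_ok_start[OF i(1) inserted_types_ok[OF i(1) x(3,4)] x(1,2)] .
  have h': "hand_ok cls' \<rho>1 1 (?\<pi> x)" if i': "inserted (map ?\<pi> ws) \<rho>1" for \<rho>1
  proof (rule hand_ok_start[OF i'])
    show "types_ok cls' \<rho>1"
      by (rule inserted_types_ok[OF i']) (use x assms(3) in \<open>auto simp: distinct_map sorted_wrt_map intro: inj_on_subset[OF inj_transpose]\<close>)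
  qed (use x assms(3) in auto)
  from snoc.IH[OF W i(1)] show ?case
  proof (elim disjE conjE)
    assume i': "inserted (map ?\<pi> ws) (\<rho>0 \<circ> ?\<pi>)"
    have pres: "(\<forall>v\<in>{a, Suc a}. \<rho>0 v \<noteq> 0 \<or> x = v) \<longrightarrow> \<rho>0 (Suc (Suc a)) \<noteq> 0 \<or> x = Suc (Suc a)"
    proof
      assume "\<forall>v\<in>{a, Suc a}. \<rho>0 v \<noteq> 0 \<or> x = v"
      then have *: "a \<in> set (ws @ [x])" "Suc a \<in> set (ws @ [x])"
        using inserted_support[OF i(1)] by auto
      have "Suc (Suc a) \<in> set (ws @ [x])"
        using prefix_class_closed[of cls "ws @ [x]" vs _ "Suc (Suc a)"] * assms(2,4,5) snoc.prems(1)
        unfolding between_def by (metis insert_subset)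
      then show "\<rho>0 (Suc (Suc a)) \<noteq> 0 \<or> x = Suc (Suc a)"
        using inserted_support[OF i(1), of "Suc (Suc a)"] by auto
    qed
    from bump_swap_high[OF i(2) h h'[OF i'] assms(3,4) pres]
    show ?case
    proof (elim disjE conjE)
      assume "bump (\<rho>0 \<circ> ?\<pi>) 1 (?\<pi> x) (\<rho> \<circ> ?\<pi>) f"
      from inserted_snoc[OF i' this] show ?thesis
        unfolding map_append list.map by blast
    next
      assume *: "bump (\<rho>0 \<circ> ?\<pi>) 1 (?\<pi> x) (\<rho> \<circ> ?\<pi>') f"
        "\<forall>v\<in>{a, Suc a, Suc (Suc a)}. \<rho>0 v \<noteq> 0 \<or> x = v"
      then have "{a, Suc a, Suc (Suc a)} \<subseteq> set (ws @ [x])"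
        using inserted_support[OF i(1)] by auto
      with inserted_snoc[OF i' *(1)] show ?thesis
        unfolding map_append list.map by blast
    qed
  next
    assume i': "inserted (map ?\<pi> ws) (\<rho>0 \<circ> ?\<pi>')" and sub: "{a, Suc a, Suc (Suc a)} \<subseteq> set ws"
    have x': "?\<pi> x = ?\<pi>' x"
      using sub x(1) by (auto simp: transpose_def)
    have opp: "opposite cls cls' a" "opposite cls cls' (Suc a)"
      using assms(4) unfolding assms(3) by (auto simp: opposite_def between_def transpose_def)
    have "bump (\<rho>0 \<circ> ?\<pi>') 1 (?\<pi>' x) (\<rho> \<circ> ?\<pi>') f"
      by (rule bump_swap_calm[OF i(2) h h'[OF i', unfolded x'] opp])
        (use sub inserted_support[OF i(1), of a] in auto)
    from inserted_snoc[OF i' this] sub have "inserted (map ?\<pi> (ws @ [x])) (\<rho> \<circ> ?\<pi>')"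
      by (simp only: map_append list.map x')
    moreover have "{a, Suc a, Suc (Suc a)} \<subseteq> set (ws @ [x])"
      using sub by auto
    ultimately show ?case
      by blast
  qed
qed

subsection \<open>The row system of the insertion tableau\<close>

definition class_block :: "nat list \<Rightarrow> nat \<Rightarrow> nat list" where
  "class_block u i = filter (\<lambda>v. u ! (v - 1) = i) [1..<Suc (length u)]"

text \<open>This is the inverse, in one-line notation, of the standardization of \<open>u\<close>.
  Exchanging adjacent distinct entries of \<open>u\<close> therefore renames two letters here
  without moving any position.\<close>

definition class_word :: "nat \<Rightarrow> nat list \<Rightarrow> nat list" where
  "class_word n u = concat (map (class_block u) [1..<Suc n])"

lemma set_class_block: "set (class_block u i) = {v. 1 \<le> v \<and> v \<le> length u \<and> u ! (v - 1) = i}"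
  by (auto simp: class_block_def simp del: upt_Suc)

lemma sorted_class_block: "sorted_wrt (<) (class_block u i)"
  unfolding class_block_def by (intro sorted_wrt_filter sorted_wrt_upt)

lemma class_word_Suc: "class_word (Suc n) u = class_word n u @ class_block u (Suc n)"
  by (simp add: class_word_def)

lemma set_class_word:
  "set (class_word n u) = {v. 1 \<le> v \<and> v \<le> length u \<and> 1 \<le> u ! (v - 1) \<and> u ! (v - 1) \<le> n}"
  by (auto simp: class_word_def set_class_block simp del: upt_Suc)

lemma distinct_class_word: "distinct (class_word n u)"
proof (induction n)
  case (Suc n)
  then show ?case
    using sorted_class_block[of u "Suc n"]
    by (auto simp: class_word_Suc set_class_word set_class_block strict_sorted_iff)
qed (simp add: class_word_def)

lemma sorted_class_word: "sorted_wrt (\<lambda>v w. u ! (v - 1) \<le> u ! (w - 1)) (class_word n u)"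
proof (induction n)
  case (Suc n)
  have "sorted_wrt (\<lambda>v w. u ! (v - 1) \<le> u ! (w - 1)) (class_block u (Suc n))"
    by (rule sorted_wrt_mono_rel[OF _ sorted_class_block]) (auto simp: set_class_block)
  with Suc show ?case
    by (auto simp: class_word_Suc sorted_wrt_append set_class_word set_class_block)
qed (simp add: class_word_def)

text \<open>The word consists of \<open>n\<close> increasing blocks, each of which adds at most one
  row.\<close>

lemma inserted_class_word_rows: "inserted (class_word n u) \<rho> \<Longrightarrow> \<rho> v \<le> n"
proof (induction n arbitrary: \<rho> v)
  case 0
  then show ?case
    using inserted_deterministic[OF _ inserted_Nil] by (auto simp: class_word_def)
next
  case (Suc n)
  then obtain \<rho>0 where \<rho>0: "inserted (class_word n u) \<rho>0"
    using inserted_prefix[of "class_word n u"] by (metis class_word_Suc)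
  have "\<forall>v. \<rho> v \<le> Suc n"
    by (rule inserted_append_increasing[OF \<rho>0 _ sorted_class_block])
      (use Suc \<rho>0 in \<open>auto simp: class_word_Suc set_class_word set_class_block\<close>)
  then show ?case by blast
qed

text \<open>The two renamed letters have distinct classes and so belong to different blocks; this is
  why renaming keeps each block increasing.\<close>

lemma class_block_swap:
  assumes "c \<noteq> d"
  shows "class_block (x @ d # c # y) i = map (swap (Suc (length x))) (class_block (x @ c # d # y) i)"
proof -
  let ?t = "Suc (length x)" and ?L = "Suc (length x + Suc (Suc (length y)))"
  have upt: "[1..<?L] = [1..<?t] @ [?t, Suc ?t] @ [Suc (Suc ?t)..<?L]"
    using upt_add_eq_append[of 1 ?t "Suc (Suc (length y))"] by (simp add: upt_conv_Cons del: upt_Suc)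
  have A: "filter (\<lambda>v. (x @ d # c # y) ! (v - 1) = i) [1..<?t] =
      map (swap ?t) (filter (\<lambda>v. (x @ c # d # y) ! (v - 1) = i) [1..<?t])"
  proof -
    have "filter (\<lambda>v. (x @ d # c # y) ! (v - 1) = i) [1..<?t] =
        filter (\<lambda>v. (x @ c # d # y) ! (v - 1) = i) [1..<?t]"
      by (rule filter_cong) (auto simp: nth_append simp del: upt_Suc)
    also have "\<dots> = map (swap ?t) (filter (\<lambda>v. (x @ c # d # y) ! (v - 1) = i) [1..<?t])"
      by (rule map_idI[symmetric]) (auto simp: transpose_def simp del: upt_Suc)
    finally show ?thesis .
  qed
  have B: "filter (\<lambda>v. (x @ d # c # y) ! (v - 1) = i) [Suc (Suc ?t)..<?L] =
      map (swap ?t) (filter (\<lambda>v. (x @ c # d # y) ! (v - 1) = i) [Suc (Suc ?t)..<?L])"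
  proof -
    have "filter (\<lambda>v. (x @ d # c # y) ! (v - 1) = i) [Suc (Suc ?t)..<?L] =
        filter (\<lambda>v. (x @ c # d # y) ! (v - 1) = i) [Suc (Suc ?t)..<?L]"
    proof (rule filter_cong)
      fix v assume "v \<in> set [Suc (Suc ?t)..<?L]"
      then obtain j where "v - 1 = length x + Suc (Suc j)"
        by (auto simp del: upt_Suc intro!: that[of "v - 1 - length x - 2"])
      then show "(x @ d # c # y) ! (v - 1) = i \<longleftrightarrow> (x @ c # d # y) ! (v - 1) = i"
        by (simp add: nth_append)
    qed simp
    also have "\<dots> = map (swap ?t) (filter (\<lambda>v. (x @ c # d # y) ! (v - 1) = i) [Suc (Suc ?t)..<?L])"
      by (rule map_idI[symmetric]) (auto simp: transpose_def simp del: upt_Suc)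
    finally show ?thesis .
  qed
  have len: "Suc (length (x @ d # c # y)) = ?L" "Suc (length (x @ c # d # y)) = ?L"
    by auto
  have C: "filter (\<lambda>v. (x @ d # c # y) ! (v - 1) = i) [?t, Suc ?t] =
      map (swap ?t) (filter (\<lambda>v. (x @ c # d # y) ! (v - 1) = i) [?t, Suc ?t])"
    using assms by (auto simp: nth_append)
  show ?thesis
    unfolding class_block_def len upt filter_append map_append A B C ..
qed

lemma class_word_swap:
  assumes "c \<noteq> d"
  shows "class_word n (x @ d # c # y) = map (swap (Suc (length x))) (class_word n (x @ c # d # y))"
  unfolding class_word_def map_concat map_map comp_def class_block_swap[OF assms] ..

lemma nth_swap_list: "(x @ d # c # y) ! k = (x @ c # d # y) ! (swap (length x) k)"
proof -
  consider "k = length x" | "k = Suc (length x)" | "k < length x" | "Suc (length x) < k"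
    by linarith
  then show ?thesis
  proof cases
    case 4
    then obtain j where "k = length x + Suc (Suc j)"
      using that[of "k - Suc (Suc (length x))"] by simp
    then show ?thesis
      by (simp add: nth_append transpose_def)
  qed (auto simp: nth_append transpose_def)
qed

lemma swap_Suc: "swap (Suc t) (Suc k) = Suc (swap t k)"
  by (auto simp: transpose_def)

definition insertion_system :: "nat \<Rightarrow> (nat \<times> nat) list \<Rightarrow> bool" where
  "insertion_system n z \<longleftrightarrow> (\<forall>p\<in>set z. 1 \<le> fst p \<and> fst p \<le> n) \<and>
     (\<exists>\<rho>. inserted (class_word n (map fst z)) \<rho> \<and> (\<forall>k<length z. snd (z ! k) = \<rho> (Suc k)))"

lemma set_class_word_tokens:
  assumes "\<forall>p\<in>set z. 1 \<le> fst p \<and> fst p \<le> n"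
  shows "set (class_word n (map fst z)) = {1..length z}"
  using assms by (auto simp: set_class_word)


lemma insertion_row_system: "row_system n (insertion_system n)"
proof
  fix x c r c' r' y
  assume "insertion_system n (x @ (c, r) # (c', r') # y)"
  then obtain \<rho> where cl: "\<forall>p\<in>set (x @ (c, r) # (c', r') # y). 1 \<le> fst p \<and> fst p \<le> n"
    and i: "inserted (class_word n (map fst (x @ (c, r) # (c', r') # y))) \<rho>" (is "inserted ?W \<rho>")
    and \<rho>: "\<And>k. k < length (x @ (c, r) # (c', r') # y) \<Longrightarrow> snd ((x @ (c, r) # (c', r') # y) ! k) = \<rho> (Suc k)"
    unfolding insertion_system_def by blast
  let ?cls = "\<lambda>v. map fst (x @ (c, r) # (c', r') # y) ! (v - 1)"
  let ?t = "Suc (length x)"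
  have t: "types_ok ?cls \<rho>"
    by (rule inserted_types_ok[OF i distinct_class_word sorted_class_word])
  have "\<rho> ?t = r" "\<rho> (Suc ?t) = r'"
    using \<rho>[of "length x"] \<rho>[of "Suc (length x)"] by (auto simp: nth_append)
  moreover have "\<rho> ?t \<noteq> 0" "\<rho> (Suc ?t) \<noteq> 0"
    using inserted_support[OF i] set_class_word_tokens[OF cl] by auto
  moreover have "?cls ?t = c" "?cls (Suc ?t) = c'"
    by (auto simp: nth_append)
  ultimately show "c < c' \<Longrightarrow> r' \<le> r" "c' < c \<Longrightarrow> r < r'"
    using types_okD[OF t, of ?t] by auto
next
  fix x c r y
  assume "insertion_system n (x @ (c, r) # y)"
  then obtain \<rho> where cl: "\<forall>p\<in>set (x @ (c, r) # y). 1 \<le> fst p \<and> fst p \<le> n"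
    and i: "inserted (class_word n (map fst (x @ (c, r) # y))) \<rho>"
    and \<rho>: "\<And>k. k < length (x @ (c, r) # y) \<Longrightarrow> snd ((x @ (c, r) # y) ! k) = \<rho> (Suc k)"
    unfolding insertion_system_def by blast
  let ?t = "Suc (length x)"
  have r: "\<rho> ?t = r"
    using \<rho>[of "length x"] by (auto simp: nth_append)
  have supp: "\<rho> v \<noteq> 0 \<longleftrightarrow> v \<in> {1..length (x @ (c, r) # y)}" for v
    using inserted_support[OF i] set_class_word_tokens[OF cl] by auto
  show "1 \<le> r \<and> r \<le> n"
    using supp[of ?t] inserted_class_word_rows[OF i, of ?t] r by auto
  have "\<exists>p\<in>set x. r \<le> Suc (snd p)" if "\<not> r \<le> 1"
  proof -
    from that obtain v where v: "v < ?t" "Suc (\<rho> v) = r"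
      using inserted_above[OF i distinct_class_word, of ?t] r by auto
    then have "v \<noteq> 0"
      using supp[of v] that by auto
    then obtain k where k: "v = Suc k" "k < length x"
      using v by (cases v) auto
    then have "snd (x ! k) = \<rho> v"
      using \<rho>[of k] by (simp add: nth_append)
    then show "\<exists>p\<in>set x. r \<le> Suc (snd p)"
      using v k by (intro bexI[of _ "x ! k"]) auto
  qed
  then show "r \<le> 1 \<or> (\<exists>p\<in>set x. r \<le> Suc (snd p))"
    by blast
next
  fix x p q s y
  assume R: "insertion_system n (x @ [p, q, s] @ y)" and bt: "between (fst p) (fst q) (fst s)"
  let ?z = "x @ [p, q, s] @ y" and ?z' = "x @ [p, s, q] @ y" and ?a = "Suc (length x)"
  obtain \<rho> where cl: "\<forall>p\<in>set ?z. 1 \<le> fst p \<and> fst p \<le> n"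
    and i: "inserted (class_word n (map fst ?z)) \<rho>"
    and \<rho>: "\<And>k. k < length ?z \<Longrightarrow> snd (?z ! k) = \<rho> (Suc k)"
    using R unfolding insertion_system_def by blast
  let ?cls = "\<lambda>v. map fst ?z ! (v - 1)"
  have "inserted (map (swap (Suc ?a)) (class_word n (map fst ?z))) (\<rho> \<circ> swap (Suc ?a))"
  proof (rule inserted_swap_low[OF distinct_class_word sorted_class_word refl _ _ _ i, where vs = "[]"])
    show "between (?cls ?a) (?cls (Suc ?a)) (?cls (Suc (Suc ?a)))"
      using bt by (simp add: nth_append)
    show "{?a, Suc ?a, Suc (Suc ?a)} \<subseteq> set (class_word n (map fst ?z))"
      unfolding set_class_word_tokens[OF cl] by auto
  qed simp
  moreover have "class_word n (map fst ?z') = map (swap (Suc ?a)) (class_word n (map fst ?z))"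
    using class_word_swap[of "fst q" "fst s" n "map fst x @ [fst p]" "map fst y"] bt
    by (auto simp: between_def)
  moreover have "snd (?z' ! k) = (\<rho> \<circ> swap (Suc ?a)) (Suc k)" if "k < length ?z'" for k
    using nth_swap_list[of "x @ [p]" s q y k] \<rho>[of "swap ?a k"] that
    by (auto simp: swap_Suc transpose_def)
  ultimately show "insertion_system n ?z'"
    using cl unfolding insertion_system_def by auto
next
  fix x cq rq cs rs cp rp y
  assume R: "insertion_system n (x @ [(cq, rq), (cs, rs), (cp, rp)] @ y)" and bt: "between cp cq cs"
  let ?z = "x @ [(cq, rq), (cs, rs), (cp, rp)] @ y" and ?a = "Suc (length x)"
  let ?z1 = "x @ [(cs, rs), (cq, rq), (cp, rp)] @ y" and ?z2 = "x @ [(cs, rq), (cq, rp), (cp, rs)] @ y"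
  obtain \<rho> where cl: "\<forall>p\<in>set ?z. 1 \<le> fst p \<and> fst p \<le> n"
    and i: "inserted (class_word n (map fst ?z)) \<rho>"
    and \<rho>: "\<And>k. k < length ?z \<Longrightarrow> snd (?z ! k) = \<rho> (Suc k)"
    using R unfolding insertion_system_def by blast
  let ?cls = "\<lambda>v. map fst ?z ! (v - 1)"
  have "inserted (map (swap ?a) (class_word n (map fst ?z))) (\<rho> \<circ> swap ?a) \<or>
      inserted (map (swap ?a) (class_word n (map fst ?z))) (\<rho> \<circ> swap (Suc ?a)) \<and>
      {?a, Suc ?a, Suc (Suc ?a)} \<subseteq> set (class_word n (map fst ?z))"
  proof (rule inserted_swap_high[OF distinct_class_word sorted_class_word refl _ _ _ i, where vs = "[]"])
    show "between (?cls (Suc (Suc ?a))) (?cls ?a) (?cls (Suc ?a))"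
      using bt by (simp add: nth_append)
    show "{?a, Suc ?a, Suc (Suc ?a)} \<subseteq> set (class_word n (map fst ?z))"
      unfolding set_class_word_tokens[OF cl] by auto
  qed simp
  moreover have "class_word n (map fst ?z1) = map (swap ?a) (class_word n (map fst ?z))"
    using class_word_swap[of cq cs n "map fst x" "cp # map fst y"] bt
    by (auto simp: between_def)
  moreover have "map fst ?z2 = map fst ?z1"
    by simp
  moreover have "snd (?z1 ! k) = (\<rho> \<circ> swap ?a) (Suc k)" if "k < length ?z1" for k
    using nth_swap_list[of x "(cs, rs)" "(cq, rq)" "(cp, rp) # y" k] \<rho>[of "swap (length x) k"] that
    by (auto simp: swap_Suc transpose_def)
  \<comment> \<open>In the second alternative classes and rows follow different transpositions, so
    only the row components of \<open>?z2\<close> and \<open>?z\<close> are compared.\<close>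
  moreover have "snd (?z2 ! k) = (\<rho> \<circ> swap (Suc ?a)) (Suc k)" if "k < length ?z2" for k
  proof -
    have "snd (?z2 ! k) = map snd ?z2 ! k"
      by (rule nth_map[symmetric]) (rule that)
    also have "\<dots> = map snd ?z ! (swap ?a k)"
      using nth_swap_list[of "map snd x @ [rq]" rp rs "map snd y" k] by simp
    also have "\<dots> = \<rho> (Suc (swap ?a k))"
      using \<rho>[of "swap ?a k"] that by (subst nth_map) (auto simp: transpose_def)
    finally show ?thesis
      by (simp add: swap_Suc)
  qed
  ultimately show "insertion_system n ?z1 \<or> insertion_system n ?z2"
    using cl unfolding insertion_system_def by auto
qed

section \<open>Sliding\<close>

definition nw :: "box \<Rightarrow> box \<Rightarrow> bool" where
  "nw x y \<longleftrightarrow> fst x \<le> fst y \<and> snd x \<le> snd y"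

definition neighbours :: "box \<Rightarrow> box \<Rightarrow> box \<Rightarrow> bool" where
  "neighbours h g g' \<longleftrightarrow> g = right_of h \<and> g' = below h \<or> g = below h \<and> g' = right_of h"

lemma nw_trans: "nw x y \<Longrightarrow> nw y z \<Longrightarrow> nw x z"
  by (auto simp: nw_def)

lemma nw_refl [simp]: "nw x x"
  by (auto simp: nw_def)

lemma neighboursD:
  assumes "neighbours h g g'"
  shows "nw h g" "nw h g'" "g \<noteq> h" "g' \<noteq> h" "g \<noteq> g'" "neighbours h g' g"
  using assms by (auto simp: neighbours_def right_of_def below_def nw_def prod_eq_iff)

lemma neighbours_cases_nw:
  assumes "neighbours h g g'" "nw h y" "y \<noteq> h"
  shows "nw g y \<or> nw g' y"
  using assms by (auto simp: neighbours_def right_of_def below_def nw_def prod_eq_iff)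

lemma young_diagram_nw:
  assumes "young_diagram L" "y \<in> L" "nw x y" "1 \<le> fst x" "1 \<le> snd x"
  shows "x \<in> L"
proof -
  have "{1..fst y} \<times> {1..snd y} \<subseteq> L"
    using assms(1,2) unfolding young_diagram_def by (cases y) fastforce
  then show ?thesis
    using assms(3-5) by (cases x) (auto simp: nw_def)
qed

lemma young_diagram_pos: "young_diagram L \<Longrightarrow> y \<in> L \<Longrightarrow> 1 \<le> fst y \<and> 1 \<le> snd y"
  by (auto simp: young_diagram_def)

text \<open>One form for both directions, so that later arguments are symmetric in the right and the
  lower neighbour. The equivalence says that the move is forced.\<close>

lemma slides_move:
  assumes "neighbours h g g'" "U g = Some p" "\<And>q. U g' = Some q \<Longrightarrow> p < q"
  shows "slides U h T y \<longleftrightarrow> slides (U(h := Some p, g := None)) g T y"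
proof
  assume "slides (U(h := Some p, g := None)) g T y"
  then show "slides U h T y"
    using assms by (auto simp: neighbours_def intro: slides.intros)
next
  assume "slides U h T y"
  then show "slides (U(h := Some p, g := None)) g T y"
  proof cases
    case stop
    then show ?thesis using assms by (auto simp: neighbours_def)
  next
    case (move_right p')
    then show ?thesis
      using assms by (force simp: neighbours_def dest: less_asym)
  next
    case (move_below p')
    then show ?thesis
      using assms by (force simp: neighbours_def dest: less_asym)
  qed
qed

definition nx :: "(nat \<Rightarrow> nat) \<Rightarrow> nat \<Rightarrow> nat \<Rightarrow> nat" where
  "nx cls i e = (LEAST v. e < v \<and> cls v = i)"

text \<open>Each class has to recur forever in order that \<open>nx\<close>, which takes the place
  of adding \<open>n\<close>, always finds a letter.\<close>

definition good_classes :: "nat \<Rightarrow> (nat \<Rightarrow> nat) \<Rightarrow> bool" where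
  "good_classes n cls \<longleftrightarrow> (\<forall>v\<ge>1. cls v \<in> {1..n}) \<and> (\<forall>i\<in>{1..n}. \<forall>N. \<exists>v>N. cls v = i)"

lemma nx:
  assumes "good_classes n cls" "i \<in> {1..n}"
  shows "e < nx cls i e" "cls (nx cls i e) = i" "e < v \<Longrightarrow> cls v = i \<Longrightarrow> nx cls i e \<le> v"
proof -
  have "\<exists>v. e < v \<and> cls v = i"
    using assms by (auto simp: good_classes_def)
  from LeastI_ex[OF this] show "e < nx cls i e" "cls (nx cls i e) = i"
    unfolding nx_def by auto
  show "e < v \<Longrightarrow> cls v = i \<Longrightarrow> nx cls i e \<le> v"
    unfolding nx_def by (rule Least_le) simp
qed

declare split_paired_All [simp del] split_paired_Ex [simp del]

section \<open>Invariants of the sliding procedure\<close>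

locale diagonal =
  fixes n :: nat and lp :: "box set" and b :: "nat \<Rightarrow> box"
  assumes n_pos: "1 \<le> n"
    and young: "young_diagram lp"
    and b_in: "i \<in> {1..n} \<Longrightarrow> b i \<in> lp"
    and b_row: "i \<in> {1..n} \<Longrightarrow> fst (b i) = Suc n - i"
    and b_col: "i \<in> {1..n} \<Longrightarrow> j \<in> {1..n} \<Longrightarrow> i < j \<Longrightarrow> snd (b i) < snd (b j)"
    and row_end: "y \<in> lp \<Longrightarrow> fst y \<le> n \<and> snd y \<le> snd (b (Suc n - fst y))"
begin

lemma lp_pos: "y \<in> lp \<Longrightarrow> 1 \<le> fst y \<and> 1 \<le> snd y"
  using young young_diagram_pos by blast

lemma lp_nw: "y \<in> lp \<Longrightarrow> nw x y \<Longrightarrow> 1 \<le> fst x \<Longrightarrow> 1 \<le> snd x \<Longrightarrow> x \<in> lp"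
  using young young_diagram_nw by blast

lemma b_less:
  assumes "i \<in> {1..n}" "j \<in> {1..n}" "i < j"
  shows "fst (b j) < fst (b i)" "snd (b i) < snd (b j)"
  using b_row[OF assms(1)] b_row[OF assms(2)] b_col[OF assms] assms by auto

text \<open>Each \<open>b i\<close> ends its row of \<open>lp\<close>, and the rows below end
  strictly further left, so nothing of \<open>lp\<close> lies to the south-east of it.\<close>

lemma b_maximal:
  assumes "i \<in> {1..n}" "y \<in> lp" "nw (b i) y"
  shows "y = b i"
proof -
  let ?j = "Suc n - fst y"
  have y: "1 \<le> fst y" "fst y \<le> n" "snd y \<le> snd (b ?j)"
    using lp_pos[OF assms(2)] row_end[OF assms(2)] by auto
  have j: "?j \<in> {1..n}" "?j \<le> i"
    using y assms(1,3) b_row[OF assms(1)] by (auto simp: nw_def)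
  have "?j = i"
  proof (rule ccontr)
    assume "?j \<noteq> i"
    then have "snd (b ?j) < snd (b i)"
      using b_col[OF j(1) assms(1)] j by simp
    then show False
      using y assms(3) by (simp add: nw_def)
  qed
  then have "fst y = fst (b i)" "snd y = snd (b i)"
    using y assms(1,3) b_row[OF assms(1)] by (auto simp: nw_def)
  then show ?thesis
    by (simp add: prod_eq_iff)
qed

lemma b_nw_b: "i \<in> {1..n} \<Longrightarrow> j \<in> {1..n} \<Longrightarrow> nw (b i) (b j) \<Longrightarrow> i = j"
  using b_maximal[of i "b j"] b_in[of j] b_row[of i] b_row[of j] by auto

lemma b_inj: "i \<in> {1..n} \<Longrightarrow> j \<in> {1..n} \<Longrightarrow> b i = b j \<longleftrightarrow> i = j"
  using b_nw_b[of i j] nw_refl[of "b i"] by metis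

lemma b_not_neighbour:
  "i \<in> {1..n} \<Longrightarrow> neighbours (b i) g g' \<Longrightarrow> g \<notin> lp"
  using b_maximal[of i g] neighboursD(1,3)[of "b i" g g'] by blast

text \<open>\<open>e i\<close> is the latest letter of class \<open>i\<close>, kept apart from the
  filling because \<open>b i\<close> is empty when a slide ends there. Call \<open>b (cls p)\<close>
  the home box of \<open>p\<close>. Letters stay north-west of their home box, and letters
  north-west of any \<open>b i\<close> are at most \<open>e i\<close>; these two clauses locate new
  and absent letters. The clauses on consecutive letters strengthen the rules on rows to
  boxes.\<close>

definition core_inv :: "(nat \<Rightarrow> nat) \<Rightarrow> (nat \<Rightarrow> nat) \<Rightarrow> (box \<rightharpoonup> nat) \<Rightarrow> bool" where
  "core_inv cls e U \<longleftrightarrow>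
     (\<forall>x y p q. U x = Some p \<longrightarrow> U y = Some q \<longrightarrow> nw x y \<longrightarrow> x \<noteq> y \<longrightarrow> p < q) \<and>
     (\<forall>x y p. U x = Some p \<longrightarrow> U y = Some p \<longrightarrow> x = y) \<and>
     ran U = {v. 1 \<le> v \<and> v \<le> e (cls v)} \<and>
     (\<forall>x p. U x = Some p \<longrightarrow> nw x (b (cls p))) \<and>
     (\<forall>x p. \<forall>i\<in>{1..n}. U x = Some p \<longrightarrow> nw x (b i) \<longrightarrow> p \<le> e i) \<and>
     (\<forall>x y v. U x = Some v \<longrightarrow> U y = Some (Suc v) \<longrightarrow> cls v < cls (Suc v) \<longrightarrow>
        snd x < snd y \<and> fst y \<le> fst x) \<and>
     (\<forall>x y v. U x = Some v \<longrightarrow> U y = Some (Suc v) \<longrightarrow> cls (Suc v) < cls v \<longrightarrow>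
        fst x < fst y \<and> snd y \<le> snd x) \<and>
     (\<forall>i\<in>{1..n}. 1 \<le> e i \<and> cls (e i) = i) \<and> good_classes n cls"

definition hole_inv :: "(nat \<Rightarrow> nat) \<Rightarrow> (nat \<Rightarrow> nat) \<Rightarrow> (box \<rightharpoonup> nat) \<Rightarrow> box \<Rightarrow> bool" where
  "hole_inv cls e U h \<longleftrightarrow> core_inv cls e U \<and> dom U \<subseteq> lp \<and> h \<in> lp \<and> U h = None \<and>
     (\<forall>x y. x \<in> insert h (dom U) \<longrightarrow> y \<in> lp \<longrightarrow> nw x y \<longrightarrow> y \<in> insert h (dom U)) \<and>
     (\<forall>i\<in>{1..n}. b i \<noteq> h \<longrightarrow> U (b i) = Some (e i))"

definition rest_inv :: "(nat \<Rightarrow> nat) \<Rightarrow> (nat \<Rightarrow> nat) \<Rightarrow> (box \<rightharpoonup> nat) \<Rightarrow> bool" where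
  "rest_inv cls e U \<longleftrightarrow> core_inv cls e U \<and> dom U \<subseteq> lp \<and>
     (\<forall>x y. x \<in> dom U \<longrightarrow> y \<in> lp \<longrightarrow> nw x y \<longrightarrow> y \<in> dom U) \<and>
     (\<forall>i\<in>{1..n}. U (b i) = Some (e i))"

lemma core_invD:
  assumes "core_inv cls e U"
  shows "U x = Some p \<Longrightarrow> U y = Some q \<Longrightarrow> nw x y \<Longrightarrow> x \<noteq> y \<Longrightarrow> p < q"
    "U x = Some p \<Longrightarrow> U y = Some p \<Longrightarrow> x = y"
    "ran U = {v. 1 \<le> v \<and> v \<le> e (cls v)}"
    "U x = Some p \<Longrightarrow> nw x (b (cls p))"
    "i \<in> {1..n} \<Longrightarrow> U x = Some p \<Longrightarrow> nw x (b i) \<Longrightarrow> p \<le> e i"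
    "U x = Some v \<Longrightarrow> U y = Some (Suc v) \<Longrightarrow> cls v < cls (Suc v) \<Longrightarrow> snd x < snd y \<and> fst y \<le> fst x"
    "U x = Some v \<Longrightarrow> U y = Some (Suc v) \<Longrightarrow> cls (Suc v) < cls v \<Longrightarrow> fst x < fst y \<and> snd y \<le> snd x"
    "i \<in> {1..n} \<Longrightarrow> 1 \<le> e i" "i \<in> {1..n} \<Longrightarrow> cls (e i) = i" "good_classes n cls"
  using assms unfolding core_inv_def by blast+

lemma core_inv_class:
  assumes "core_inv cls e U" "U x = Some p"
  shows "1 \<le> p" "cls p \<in> {1..n}"
proof -
  show "1 \<le> p"
    using core_invD(3)[OF assms(1)] ranI[of U x p] assms(2) by auto
  then show "cls p \<in> {1..n}"
    using core_invD(10)[OF assms(1)] by (simp add: good_classes_def)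
qed

lemma hole_invD:
  assumes "hole_inv cls e U h"
  shows "core_inv cls e U" "dom U \<subseteq> lp" "h \<in> lp" "U h = None"
    "x \<in> insert h (dom U) \<Longrightarrow> y \<in> lp \<Longrightarrow> nw x y \<Longrightarrow> y \<in> insert h (dom U)"
    "i \<in> {1..n} \<Longrightarrow> b i \<noteq> h \<Longrightarrow> U (b i) = Some (e i)"
  using assms unfolding hole_inv_def by blast+

lemma hole_inv_min:
  assumes inv: "hole_inv cls e U h" and nb: "neighbours h g g'" "U g = Some p"
    and min: "\<And>q. U g' = Some q \<Longrightarrow> p < q"
    and y: "U y = Some v" "nw h y"
  shows "p \<le> v"
proof -
  note I = hole_invD[OF inv] and C = core_invD[OF hole_invD(1)[OF inv]]
  have "y \<in> lp" "y \<noteq> h"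
    using y I by auto
  then consider "nw g y" | "nw g' y"
    using neighbours_cases_nw[OF nb(1) y(2)] by blast
  then show ?thesis
  proof cases
    case 1
    then show ?thesis
      using C(1)[OF nb(2) y(1) 1] nb(2) y(1) by (cases "g = y") auto
  next
    case 2
    have "g' \<in> lp"
      using lp_nw[OF \<open>y \<in> lp\<close> 2] lp_pos[OF I(3)] nb(1)
      by (auto simp: neighbours_def right_of_def below_def)
    then have "g' \<in> dom U"
      using I(5)[of h g'] neighboursD[OF nb(1)] by auto
    then obtain q where q: "U g' = Some q"
      by auto
    then have "p < q" "g' = y \<or> q < v"
      using min C(1)[OF q y(1) 2] by auto
    then show ?thesis
      using q y(1) by auto
  qed
qed

text \<open>The moved letter \<open>p\<close> is least among the letters south-east of the hole
  (\<open>F1\<close>), and \<open>Suc p\<close> cannot lie properly south-east of \<open>g'\<close>,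
  where the entry already exceeds \<open>p\<close> (\<open>F3\<close>). These two facts give the
  rules for \<open>p\<close> and its neighbours in value at the new place.\<close>

lemma hole_inv_move:
  assumes inv: "hole_inv cls e U h" and nb: "neighbours h g g'" "U g = Some p"
    and min: "\<And>q. U g' = Some q \<Longrightarrow> p < q"
  shows "hole_inv cls e (U(h := Some p, g := None)) g"
proof -
  note I = hole_invD[OF inv] and C = core_invD[OF hole_invD(1)[OF inv]]
  note N = neighboursD[OF nb(1)]
  let ?U = "U(h := Some p, g := None)"
  have F1: "p \<le> v" if "U y = Some v" "nw h y" for y v
    using hole_inv_min[OF inv nb min that] .
  have F3: "v \<noteq> Suc p" if "U y = Some v" "nw g' y" "g' \<noteq> y" for y v
  proof -
    have "y \<in> lp"
      using that I(2) by auto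
    then have "g' \<in> lp"
      using lp_nw[OF \<open>y \<in> lp\<close> that(2)] lp_pos[OF I(3)] nb(1)
      by (auto simp: neighbours_def right_of_def below_def)
    then obtain q where q: "U g' = Some q"
      using I(5)[of h g'] N by auto
    then show ?thesis
      using min[OF q] C(1)[OF q that(1,2,3)] by simp
  qed
  have glp: "g \<in> lp"
    using nb(2) I(2) by auto
  have bh: "b i \<noteq> h" if "i \<in> {1..n}" for i
    using b_not_neighbour[OF that] nb(1) glp by metis
  have dom: "insert g (dom ?U) = insert h (dom U)"
    using nb(2) by auto
  have inj: "x = g" if "U x = Some p" for x
    using C(2)[OF that nb(2)] .
  have eqU: "?U x = Some v \<longleftrightarrow> x = h \<and> v = p \<or> x \<noteq> h \<and> x \<noteq> g \<and> U x = Some v" for x v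
    using N by auto
  have "core_inv cls e ?U"
    unfolding core_inv_def
  proof (intro conjI allI impI ballI)
    fix x y v w assume xy: "?U x = Some v" "?U y = Some w" "nw x y" "x \<noteq> y"
    show "v < w"
    proof (cases "x = h")
      case True
      then have *: "v = p" "U y = Some w" "y \<noteq> g"
        using xy unfolding eqU by auto
      moreover have "w \<noteq> p"
        using inj[of y] * by auto
      ultimately show ?thesis
        using F1[of y w] xy True by simp
    next
      case False
      then have x: "U x = Some v" "x \<noteq> g"
        using xy unfolding eqU by auto
      show ?thesis
      proof (cases "y = h")
        case True
        then show ?thesis
          using C(1)[OF x(1) nb(2)] nw_trans[OF xy(3)] N(1) x xy(2) unfolding eqU by auto
      next
        case False
        then show ?thesis
          using C(1)[OF x(1) _ xy(3,4)] xy(2) unfolding eqU by auto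
      qed
    qed
  next
    fix x y v assume "?U x = Some v" "?U y = Some v"
    then show "x = y"
      unfolding eqU using inj C(2)[of x v y] by metis
  next
    have "ran ?U = ran U"
    proof (rule set_eqI)
      fix v
      have "v \<in> ran ?U \<longleftrightarrow> v = p \<or> (\<exists>x. x \<noteq> h \<and> x \<noteq> g \<and> U x = Some v)"
        unfolding ran_def mem_Collect_eq eqU by blast
      also have "\<dots> \<longleftrightarrow> (\<exists>x. U x = Some v)"
        using nb(2) I(4) by (metis option.distinct(1) option.inject)
      finally show "v \<in> ran ?U \<longleftrightarrow> v \<in> ran U"
        by (simp add: ran_def)
    qed
    then show "ran ?U = {v. 1 \<le> v \<and> v \<le> e (cls v)}"
      using C(3) by simp
  next
    fix x v assume "?U x = Some v"
    then show "nw x (b (cls v))"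
      unfolding eqU using C(4)[of x v] C(4)[OF nb(2)] nw_trans[OF N(1), of "b (cls p)"] by auto
  next
    fix x v i assume i: "i \<in> {1..n}" and x: "?U x = Some v" "nw x (b i)"
    show "v \<le> e i"
    proof (cases "x = h")
      case True
      then show ?thesis
        using F1[OF I(6)[OF i bh[OF i]]] x unfolding eqU by auto
    next
      case False
      then show ?thesis
        using C(5)[OF i, of x v] x unfolding eqU by auto
    qed
  next
    fix x y v assume xy: "?U x = Some v" "?U y = Some (Suc v)" "cls v < cls (Suc v)"
    consider "x = h" "v = p" "U y = Some (Suc p)" | "y = h" "Suc v = p" "U x = Some v"
      | "U x = Some v" "U y = Some (Suc v)"
      using xy(1,2) unfolding eqU by auto
    then have "snd x < snd y \<and> fst y \<le> fst x"
    proof cases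
      case 1
      have *: "snd g < snd y" "fst y \<le> fst g"
        using C(6)[OF nb(2) 1(3)] xy(3) 1(2) by auto
      have "fst y \<le> fst h"
      proof (rule ccontr)
        assume "\<not> fst y \<le> fst h"
        then have "nw g' y" "g' \<noteq> y"
          using * nb(1) by (auto simp: neighbours_def right_of_def below_def nw_def)
        then show False
          using F3[OF 1(3)] by simp
      qed
      then show ?thesis
        using * 1(1) N(1) by (auto simp: nw_def)
    next
      case 2
      have "snd x < snd g" "fst g \<le> fst x"
        using C(6)[OF 2(3), of g] nb(2) 2(2) xy(3) by auto
      then show ?thesis
        using F1[OF 2(3)] 2(1,2) N(1) by (force simp: nw_def not_less)
    next
      case 3
      then show ?thesis
        using C(6)[OF 3 xy(3)] by simp
    qed
    then show "snd x < snd y" "fst y \<le> fst x"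
      by auto
  next
    fix x y v assume xy: "?U x = Some v" "?U y = Some (Suc v)" "cls (Suc v) < cls v"
    consider "x = h" "v = p" "U y = Some (Suc p)" | "y = h" "Suc v = p" "U x = Some v"
      | "U x = Some v" "U y = Some (Suc v)"
      using xy(1,2) unfolding eqU by auto
    then have "fst x < fst y \<and> snd y \<le> snd x"
    proof cases
      case 1
      have *: "fst g < fst y" "snd y \<le> snd g"
        using C(7)[OF nb(2) 1(3)] xy(3) 1(2) by auto
      have "snd y \<le> snd h"
      proof (rule ccontr)
        assume "\<not> snd y \<le> snd h"
        then have "nw g' y" "g' \<noteq> y"
          using * nb(1) by (auto simp: neighbours_def right_of_def below_def nw_def)
        then show False
          using F3[OF 1(3)] by simp
      qed
      then show ?thesis
        using * 1(1) N(1) by (auto simp: nw_def)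
    next
      case 2
      have "fst x < fst g" "snd g \<le> snd x"
        using C(7)[OF 2(3), of g] nb(2) 2(2) xy(3) by auto
      then show ?thesis
        using F1[OF 2(3)] 2(1,2) N(1) by (force simp: nw_def not_less)
    next
      case 3
      then show ?thesis
        using C(7)[OF 3 xy(3)] by simp
    qed
    then show "fst x < fst y" "snd y \<le> snd x"
      by auto
  qed (use C(8,9,10) in auto)
  moreover have "?U (b i) = Some (e i)" if "i \<in> {1..n}" "b i \<noteq> g" for i
    using that bh[OF that(1)] I(6)[OF that(1)] by simp
  moreover have "dom ?U \<subseteq> lp"
    using I(2,3) by auto
  ultimately show ?thesis
    unfolding hole_inv_def dom using glp I(5) by (auto simp del: insert_iff)
qed

text \<open>The hole together with the filled boxes is closed to the south-east within
  \<open>lp\<close>, so an empty right neighbour means the end of a row. Consequently every slide is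
  followed by a refill.\<close>

lemma hole_inv_stop:
  assumes "hole_inv cls e U h" "U (right_of h) = None"
  shows "\<exists>i\<in>{1..n}. h = b i"
proof -
  note I = hole_invD[OF assms(1)]
  have h: "1 \<le> fst h" "fst h \<le> n" "snd h \<le> snd (b (Suc n - fst h))"
    using lp_pos[OF I(3)] row_end[OF I(3)] by auto
  let ?i = "Suc n - fst h"
  have i: "?i \<in> {1..n}"
    using h by auto
  then have i: "?i \<in> {1..n}" "fst (b ?i) = fst h"
    using h b_row[OF i] by auto
  have "snd h = snd (b ?i)"
  proof (rule ccontr)
    assume "snd h \<noteq> snd (b ?i)"
    then have "nw (right_of h) (b ?i)"
      using h i by (auto simp: nw_def right_of_def)
    then have "right_of h \<in> lp"
      using lp_nw[OF b_in[OF i(1)]] lp_pos[OF I(3)] by (auto simp: right_of_def)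
    then have "right_of h \<in> insert h (dom U)"
      using I(5)[of h "right_of h"] by (auto simp: nw_def right_of_def)
    then show False
      using assms(2) by (auto simp: right_of_def prod_eq_iff)
  qed
  then show ?thesis
    using i by (intro bexI[of _ ?i]) (auto simp: prod_eq_iff)
qed

lemma slides_inv:
  "slides U h U' y \<Longrightarrow> hole_inv cls e U h \<Longrightarrow> hole_inv cls e U' y \<and> (\<exists>i\<in>{1..n}. y = b i)"
proof (induction rule: slides.induct)
  case (stop T x)
  then show ?case
    using hole_inv_stop by blast
next
  case (move_right T x a T' y)
  have "hole_inv cls e (T(x := Some a, right_of x := None)) (right_of x)"
    by (rule hole_inv_move[OF move_right.prems, of _ "below x"])
      (use move_right.hyps in \<open>auto simp: neighbours_def\<close>)
  then show ?case
    by (rule move_right.IH)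
next
  case (move_below T x a T' y)
  have "hole_inv cls e (T(x := Some a, below x := None)) (below x)"
    by (rule hole_inv_move[OF move_below.prems, of _ "right_of x"])
      (use move_below.hyps in \<open>auto simp: neighbours_def\<close>)
  then show ?case
    by (rule move_below.IH)
qed

lemma neighbours_exists:
  assumes "hole_inv cls e U h" "\<not> (U (right_of h) = None \<and> U (below h) = None)"
  obtains g g' p where "neighbours h g g'" "U g = Some p" "\<And>q. U g' = Some q \<Longrightarrow> p < q"
proof -
  note C = core_invD[OF hole_invD(1)[OF assms(1)]]
  have ne: "right_of h \<noteq> below h"
    by (auto simp: right_of_def below_def)
  have nb: "neighbours h (right_of h) (below h)" "neighbours h (below h) (right_of h)"
    by (auto simp: neighbours_def)
  show ?thesis
  proof (cases "U (right_of h)")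
    case None
    then obtain p where "U (below h) = Some p"
      using assms(2) by auto
    then show ?thesis
      using that[OF nb(2)] None by simp
  next
    case r: (Some p)
    show ?thesis
    proof (cases "U (below h)")
      case None
      then show ?thesis
        using that[OF nb(1) r] by simp
    next
      case (Some q)
      then have "p \<noteq> q"
        using C(2) r ne by blast
      then show ?thesis
        using that[OF nb(1) r] that[OF nb(2) Some] r Some by (cases "p < q") auto
    qed
  qed
qed

lemma slides_exists: "hole_inv cls e U h \<Longrightarrow> \<exists>U' y. slides U h U' y"
proof (induction "card {y \<in> lp. nw h y}" arbitrary: U h rule: less_induct)
  case less
  show ?case
  proof (cases "U (right_of h) = None \<and> U (below h) = None")
    case True
    then show ?thesis
      using slides.stop by blast
  next
    case False
    then obtain g g' p where g: "neighbours h g g'" "U g = Some p" "\<And>q. U g' = Some q \<Longrightarrow> p < q"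
      using neighbours_exists[OF less.prems] by metis
    have "h \<in> {y \<in> lp. nw h y}" "h \<notin> {y \<in> lp. nw g y}"
      using hole_invD(3)[OF less.prems] g(1)
      by (auto simp: neighbours_def right_of_def below_def nw_def)
    moreover have "{y \<in> lp. nw g y} \<subseteq> {y \<in> lp. nw h y}"
      using neighboursD(1)[OF g(1)] nw_trans by blast
    ultimately have "{y \<in> lp. nw g y} \<subset> {y \<in> lp. nw h y}"
      by blast
    then have "card {y \<in> lp. nw g y} < card {y \<in> lp. nw h y}"
      using young by (intro psubset_card_mono) (auto simp: young_diagram_def)
    from less.hyps[OF this hole_inv_move[OF less.prems g]] show ?thesis
      using slides_move[of h g g' U p, OF g] by blast
  qed
qed

lemma rest_inv_start:
  assumes "rest_inv cls e T" "corner (lp - dom T) x"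
  shows "hole_inv cls e T x"
proof -
  have x: "x \<in> lp" "T x = None" and y: "young_diagram (lp - dom T - {x})"
    using assms(2) by (auto simp: corner_def)
  have "y \<in> insert x (dom T)" if "nw x y" "y \<in> lp" for y
  proof (rule ccontr)
    assume "y \<notin> insert x (dom T)"
    then have "x \<in> lp - dom T - {x}"
      using young_diagram_nw[OF y _ that(1)] that lp_pos[OF x(1)] by auto
    then show False by simp
  qed
  then show ?thesis
    using assms(1) x unfolding rest_inv_def hole_inv_def by blast
qed

text \<open>A letter north-west of \<open>b i\<close> is at most \<open>e i\<close>. So the
  successor of the new letter is not there, and its predecessor only if it is \<open>e i\<close>, of
  the same class. A neighbour in value of another class is north-west of its home box but not of
  \<open>b i\<close>, hence on the side of \<open>b i\<close> that its class prescribes.\<close>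

lemma refill_inv:
  assumes inv: "hole_inv cls e U (b i)" and i: "i \<in> {1..n}"
  shows "rest_inv cls (e(i := nx cls i (e i))) (U(b i := Some (nx cls i (e i))))"
proof -
  note I = hole_invD[OF inv] and C = core_invD[OF hole_invD(1)[OF inv]]
  define v where "v = nx cls i (e i)"
  have v: "e i < v" "cls v = i" "\<And>w. e i < w \<Longrightarrow> cls w = i \<Longrightarrow> v \<le> w"
    using nx[OF C(10) i] unfolding v_def by auto
  let ?e = "e(i := v)" and ?U = "U(b i := Some v)"
  have eqU: "?U x = Some w \<longleftrightarrow> x = b i \<and> w = v \<or> x \<noteq> b i \<and> U x = Some w" for x w
    by auto
  have e_le: "e j \<le> ?e j" for j
    using v(1) by simp
  have new: "U x \<noteq> Some v" for x
    using C(3) v(1,2) ranI[of U x v] by auto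
  have nwb: "w \<le> e i" if "U x = Some w" "nw x (b i)" for x w
    using C(5)[OF i that] .
  have cl: "cls w \<in> {1..n}" "nw x (b (cls w))" if "U x = Some w" for x w
    using core_inv_class[OF I(1) that] C(4)[OF that] by auto
  have pred: "\<not> nw x (b i)" if "U x = Some w" "v = Suc w" "cls w \<noteq> cls v" for x w
  proof
    assume "nw x (b i)"
    then have "w = e i"
      using nwb[OF that(1)] v(1) that(2) by simp
    then show False
      using C(9)[OF i] v(2) that(3) by simp
  qed
  have succ: "\<not> nw x (b i)" if "U x = Some (Suc v)" for x
    using nwb[OF that] v(1) by auto
  have "core_inv cls ?e ?U"
    unfolding core_inv_def
  proof (intro conjI allI impI ballI)
    fix x y p q assume xy: "?U x = Some p" "?U y = Some q" "nw x y" "x \<noteq> y"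
    show "p < q"
    proof (cases "y = b i")
      case True
      then show ?thesis
        using nwb[of x p] xy v(1) unfolding eqU by auto
    next
      case False
      then have "U y = Some q"
        using xy unfolding eqU by auto
      moreover from this have "y \<in> lp"
        using I(2) by auto
      then have "x \<noteq> b i"
        using b_maximal[OF i, of y] xy False by auto
      ultimately show ?thesis
        using xy C(1) unfolding eqU by blast
    qed
  next
    fix x y p assume "?U x = Some p" "?U y = Some p"
    then show "x = y"
      unfolding eqU using new C(2) by metis
  next
    have "ran ?U = insert v (ran U)"
    proof (rule set_eqI)
      fix w
      have "w \<in> ran ?U \<longleftrightarrow> w = v \<or> (\<exists>x. x \<noteq> b i \<and> U x = Some w)"
        unfolding ran_def mem_Collect_eq eqU by blast
      also have "\<dots> \<longleftrightarrow> w = v \<or> (\<exists>x. U x = Some w)"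
        using I(4) by (metis option.distinct(1))
      finally show "w \<in> ran ?U \<longleftrightarrow> w \<in> insert v (ran U)"
        by (simp add: ran_def)
    qed
    also have "\<dots> = {w. 1 \<le> w \<and> w \<le> ?e (cls w)}"
      unfolding C(3) using v by (auto, metis not_le_imp_less le_antisym)
    finally show "ran ?U = {w. 1 \<le> w \<and> w \<le> ?e (cls w)}" .
  next
    fix x p assume "?U x = Some p"
    then show "nw x (b (cls p))"
      unfolding eqU using C(4)[of x p] v(2) by auto
  next
    fix x p j assume j: "j \<in> {1..n}" and x: "?U x = Some p" "nw x (b j)"
    show "p \<le> ?e j"
    proof (cases "x = b i")
      case True
      then show ?thesis
        using b_nw_b[OF i j] x unfolding eqU by auto
    next
      case False
      then show ?thesis
        using C(5)[OF j _ x(2)] x(1) e_le[of j] unfolding eqU by (meson le_trans)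
    qed
  next
    fix x y w assume xy: "?U x = Some w" "?U y = Some (Suc w)" "cls w < cls (Suc w)"
    consider "x = b i" "w = v" "U y = Some (Suc v)" | "y = b i" "v = Suc w" "U x = Some w"
      | "U x = Some w" "U y = Some (Suc w)"
      using xy(1,2) unfolding eqU by auto
    then have "snd x < snd y \<and> fst y \<le> fst x"
    proof cases
      case 1
      then show ?thesis
        using succ[OF 1(3)] b_less[OF i cl(1)[OF 1(3)]] cl(2)[OF 1(3)] xy(3) v(2)
        by (auto simp: nw_def not_le)
    next
      case 2
      then show ?thesis
        using pred[OF 2(3)] b_less[OF cl(1)[OF 2(3)] i] cl(2)[OF 2(3)] xy(3) v(2)
        by (auto simp: nw_def not_le)
    next
      case 3
      then show ?thesis
        using C(6)[OF 3 xy(3)] by simp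
    qed
    then show "snd x < snd y" "fst y \<le> fst x"
      by auto
  next
    fix x y w assume xy: "?U x = Some w" "?U y = Some (Suc w)" "cls (Suc w) < cls w"
    consider "x = b i" "w = v" "U y = Some (Suc v)" | "y = b i" "v = Suc w" "U x = Some w"
      | "U x = Some w" "U y = Some (Suc w)"
      using xy(1,2) unfolding eqU by auto
    then have "fst x < fst y \<and> snd y \<le> snd x"
    proof cases
      case 1
      then show ?thesis
        using succ[OF 1(3)] b_less[OF cl(1)[OF 1(3)] i] cl(2)[OF 1(3)] xy(3) v(2)
        by (auto simp: nw_def not_le)
    next
      case 2
      then show ?thesis
        using pred[OF 2(3)] b_less[OF i cl(1)[OF 2(3)]] cl(2)[OF 2(3)] xy(3) v(2)
        by (auto simp: nw_def not_le)
    next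
      case 3
      then show ?thesis
        using C(7)[OF 3 xy(3)] by simp
    qed
    then show "fst x < fst y" "snd y \<le> snd x"
      by auto
  next
    fix j assume "j \<in> {1..n}"
    then show "1 \<le> ?e j" "cls (?e j) = j"
      using C(8,9) v by auto
  qed (use C(10) in auto)
  moreover have "?U (b j) = Some (?e j)" if "j \<in> {1..n}" for j
    using I(6)[OF that] b_inj[OF that i] by auto
  moreover have "dom ?U = insert (b i) (dom U)"
    by simp
  ultimately show ?thesis
    unfolding rest_inv_def v_def[symmetric] using I(2,3,5) by (auto simp del: insert_iff fun_upd_apply)
qed

end

subsection \<open>Exchanges of adjacent letters during slides\<close>

definition map_filling :: "(nat \<Rightarrow> nat) \<Rightarrow> (box \<rightharpoonup> nat) \<Rightarrow> (box \<rightharpoonup> nat)" where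
  "map_filling f U = (\<lambda>x. map_option f (U x))"

lemma map_filling_Some [simp]: "U x = Some p \<Longrightarrow> map_filling f U x = Some (f p)"
  by (simp add: map_filling_def)

lemma map_filling_None [simp]: "map_filling f U x = None \<longleftrightarrow> U x = None"
  by (simp add: map_filling_def)

lemma map_filling_SomeD: "map_filling f U x = Some q \<Longrightarrow> \<exists>p. U x = Some p \<and> q = f p"
  by (auto simp: map_filling_def)

lemma map_filling_upd: "map_filling f (U(x := o1)) = (map_filling f U)(x := map_option f o1)"
  by (auto simp: map_filling_def)

lemma dom_map_filling [simp]: "dom (map_filling f U) = dom U"
  by (auto simp: dom_def)

context diagonal
begin

lemma present_iff:
  assumes "core_inv cls e U"
  shows "(\<exists>x. U x = Some v) \<longleftrightarrow> 1 \<le> v \<and> v \<le> e (cls v)"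
  using core_invD(3)[OF assms] by (auto simp: ran_def)

text \<open>The home boxes of \<open>p\<close> and \<open>q\<close> lie on either side of
  \<open>b c\<close>. The boxes \<open>g\<close> and \<open>g'\<close> are one row and one column
  apart, and the strict steps of the diagonal absorb this difference, so both are north-west of
  \<open>b c\<close>.\<close>

lemma competing_letters_home:
  assumes inv: "hole_inv cls e U h" and nb: "neighbours h g g'"
    and U: "U g = Some p" "U g' = Some q" and c: "between c (cls p) (cls q)"
  shows "p \<le> e c" "q \<le> e c"
proof -
  note C = hole_invD(1)[OF inv]
  have cl: "cls p \<in> {1..n}" "cls q \<in> {1..n}"
    using core_inv_class[OF C] U by blast+
  then have cn: "c \<in> {1..n}"
    using c by (auto simp: between_def)
  have nw: "nw g (b (cls p))" "nw g' (b (cls q))"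
    using core_invD(4)[OF C] U by blast+
  have "nw g (b c) \<and> nw g' (b c)"
    using c
    unfolding between_def
  proof
    assume "cls p < c \<and> c < cls q"
    then show ?thesis
      using nw b_less[OF cl(1) cn] b_less[OF cn cl(2)] nb
      by (auto simp: nw_def neighbours_def right_of_def below_def)
  next
    assume "cls q < c \<and> c < cls p"
    then show ?thesis
      using nw b_less[OF cl(2) cn] b_less[OF cn cl(1)] nb
      by (auto simp: nw_def neighbours_def right_of_def below_def)
  qed
  then show "p \<le> e c" "q \<le> e c"
    using core_invD(5)[OF C cn] U by blast+
qed

text \<open>The box of \<open>a\<close> is related to \<open>g\<close> by the rule of the first
  filling and to \<open>g'\<close> by the opposite rule of the second. At most the hole satisfies
  both, and the hole is empty.\<close>

lemma competing_letters_witness: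
  assumes inv: "hole_inv cls e U h" "hole_inv cls' e' (map_filling (swap (Suc a)) U) h"
    and nb: "neighbours h g g'" and U: "U g = Some (Suc a)" "U g' = Some (Suc (Suc a))" "U x = Some a"
    and opp: "opposite cls cls' a"
  shows False
proof -
  note C = core_invD[OF hole_invD(1)[OF inv(1)]] and C' = core_invD[OF hole_invD(1)[OF inv(2)]]
  let ?U = "map_filling (swap (Suc a)) U"
  have U': "?U g' = Some (Suc a)" "?U x = Some a"
    using U by (auto simp: transpose_def)
  have "x = h"
    using opp C(6)[OF U(3,1)] C(7)[OF U(3,1)] C'(6)[OF U'(2,1)] C'(7)[OF U'(2,1)] nb
    by (auto simp: opposite_def neighbours_def right_of_def below_def prod_eq_iff)
  then show False
    using U(3) hole_invD(4)[OF inv(1)] by simp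
qed

text \<open>The presence of \<open>a\<close> is either given or follows from the conflict: if its
  class lies between those of the competitors, they are north-west of its home box, so
  \<open>e (cls a)\<close> is already at least \<open>Suc a\<close>.\<close>

lemma calm_order:
  assumes inv: "hole_inv cls e U h" "hole_inv cls' e' (map_filling (swap (Suc a)) U) h"
    and nb: "neighbours h g g'" "U g = Some p" "\<And>q. U g' = Some q \<Longrightarrow> p < q"
    and opp: "opposite cls cls' a" and a: "1 \<le> a"
      "a \<le> e (cls a) \<or> between (cls a) (cls (Suc a)) (cls (Suc (Suc a)))"
    and q: "map_filling (swap (Suc a)) U g' = Some q"
  shows "swap (Suc a) p < q"
proof -
  obtain q0 where q0: "U g' = Some q0" "q = swap (Suc a) q0"
    using map_filling_SomeD[OF q] by blast
  have "\<not> (p = Suc a \<and> q0 = Suc (Suc a))"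
  proof
    assume *: "p = Suc a \<and> q0 = Suc (Suc a)"
    have "a \<le> e (cls a)"
      using a(2) competing_letters_home(1)[OF inv(1) nb(1,2) q0(1), of "cls a"] * by auto
    then obtain x where "U x = Some a"
      using present_iff[OF hole_invD(1)[OF inv(1)]] a(1) by blast
    then show False
      using competing_letters_witness[OF inv nb(1) _ _ _ opp] nb(2) q0 * by blast
  qed
  then show ?thesis
    using swap_strict_mono nb(3)[OF q0(1)] q0(2) by blast
qed

lemma slides_swap_calm:
  "slides U h T y \<Longrightarrow> hole_inv cls e U h \<Longrightarrow> hole_inv cls' e' (map_filling (swap (Suc a)) U) h \<Longrightarrow>
   opposite cls cls' a \<Longrightarrow> 1 \<le> a \<Longrightarrow>
   a \<le> e (cls a) \<or> between (cls a) (cls (Suc a)) (cls (Suc (Suc a))) \<Longrightarrow>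
   slides (map_filling (swap (Suc a)) U) h (map_filling (swap (Suc a)) T) y"
proof (induction rule: slides.induct)
  case (stop T x)
  then show ?case
    by (intro slides.stop) auto
next
  case (move_right U h p T y)
  let ?g = "right_of h" and ?g' = "below h" and ?f = "map_filling (swap (Suc a))"
  have nb: "neighbours h ?g ?g'"
    by (simp add: neighbours_def)
  have min: "swap (Suc a) p < q" if "?f U ?g' = Some q" for q
    using calm_order[OF move_right.prems(1,2) nb move_right.hyps(1,2) move_right.prems(3-5) that] .
  have gU: "?f U ?g = Some (swap (Suc a) p)"
    using move_right.hyps(1) by simp
  have eq: "?f (U(h := Some p, ?g := None)) = (?f U)(h := Some (swap (Suc a) p), ?g := None)"
    by (simp add: map_filling_upd)
  have "slides (?f (U(h := Some p, ?g := None))) ?g (?f T) y"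
    using hole_inv_move[OF move_right.prems(1) nb move_right.hyps(1,2)]
      hole_inv_move[OF move_right.prems(2) nb gU min] move_right.prems(3-5)
    unfolding eq[symmetric] by (intro move_right.IH)
  then show ?case
    unfolding eq using slides_move[of h ?g ?g' "?f U", OF nb gU min] by blast
next
  case (move_below U h p T y)
  let ?g = "below h" and ?g' = "right_of h" and ?f = "map_filling (swap (Suc a))"
  have nb: "neighbours h ?g ?g'"
    by (simp add: neighbours_def)
  have min: "swap (Suc a) p < q" if "?f U ?g' = Some q" for q
    using calm_order[OF move_below.prems(1,2) nb move_below.hyps(1,2) move_below.prems(3-5) that] .
  have gU: "?f U ?g = Some (swap (Suc a) p)"
    using move_below.hyps(1) by simp
  have eq: "?f (U(h := Some p, ?g := None)) = (?f U)(h := Some (swap (Suc a) p), ?g := None)"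
    by (simp add: map_filling_upd)
  have "slides (?f (U(h := Some p, ?g := None))) ?g (?f T) y"
    using hole_inv_move[OF move_below.prems(1) nb move_below.hyps(1,2)]
      hole_inv_move[OF move_below.prems(2) nb gU min] move_below.prems(3-5)
    unfolding eq[symmetric] by (intro move_below.IH)
  then show ?case
    unfolding eq using slides_move[of h ?g ?g' "?f U", OF nb gU min] by blast
qed

definition diag_box :: "box \<Rightarrow> box" where
  "diag_box h = (Suc (fst h), Suc (snd h))"

lemma neighbours_diag_box:
  assumes "neighbours h g g'"
  shows "\<exists>x. neighbours g (diag_box h) x \<and> x \<noteq> h \<and> x \<noteq> g \<and> x \<noteq> g'"
    "diag_box h \<noteq> h" "diag_box h \<noteq> g" "diag_box h \<noteq> g'"
proof -
  from assms consider "g = right_of h" "g' = below h" | "g = below h" "g' = right_of h"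
    by (auto simp: neighbours_def)
  then show "\<exists>x. neighbours g (diag_box h) x \<and> x \<noteq> h \<and> x \<noteq> g \<and> x \<noteq> g'"
  proof cases
    case 1
    have "neighbours g (diag_box h) (right_of g) \<and> right_of g \<noteq> h \<and> right_of g \<noteq> g \<and> right_of g \<noteq> g'"
      unfolding 1 by (cases h) (simp add: neighbours_def right_of_def below_def diag_box_def)
    then show ?thesis by blast
  next
    case 2
    have "neighbours g (diag_box h) (below g) \<and> below g \<noteq> h \<and> below g \<noteq> g \<and> below g \<noteq> g'"
      unfolding 2 by (cases h) (simp add: neighbours_def right_of_def below_def diag_box_def)
    then show ?thesis by blast
  qed
  show "diag_box h \<noteq> h" "diag_box h \<noteq> g" "diag_box h \<noteq> g'"
    using assms by (cases h; auto simp: neighbours_def right_of_def below_def diag_box_def)+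
qed

text \<open>The other neighbour of \<open>g\<close> holds nothing smaller than the diagonal box, so
  the hole is forced through \<open>g\<close> into that box. With \<open>g\<close> and
  \<open>g'\<close> interchanged the statement applies to the exchanged filling, whose hole goes
  around the other side of the square and reaches the same box.\<close>

lemma slides_square:
  assumes inv: "hole_inv cls e U h" and nb: "neighbours h g g'"
    and U: "U g = Some a" "U g' = Some (Suc a)" "U (diag_box h) = Some (Suc (Suc a))"
  defines "U3 \<equiv> U(h := Some a, g := Some (Suc (Suc a)), diag_box h := None)"
  shows "slides U h T y \<longleftrightarrow> slides U3 (diag_box h) T y" "hole_inv cls e U3 (diag_box h)"
proof -
  note I = hole_invD[OF inv] and C = core_invD[OF hole_invD(1)[OF inv]]
  let ?d = "diag_box h"
  obtain x where x: "neighbours g ?d x" "x \<noteq> h" "x \<noteq> g" "x \<noteq> g'"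
    using neighbours_diag_box(1)[OF nb] by blast
  note d = neighbours_diag_box(2-4)[OF nb]
  let ?U2 = "U(h := Some a, g := None)"
  have min1: "a < q" if "U g' = Some q" for q
    using that U(2) by simp
  have min2: "Suc (Suc a) < q" if "?U2 x = Some q" for q
  proof -
    have q: "U x = Some q"
      using that x by simp
    have "a < q"
      using C(1)[OF U(1) q] neighboursD(2,4)[OF x(1)] by blast
    moreover have "q \<noteq> Suc a"
      using C(2)[OF U(2)] q x by blast
    moreover have "q \<noteq> Suc (Suc a)"
      using C(2)[OF U(3)] q neighboursD(5)[OF x(1)] by blast
    ultimately show ?thesis by simp
  qed
  have d2: "?U2 ?d = Some (Suc (Suc a))"
    using U(3) d by simp
  have eq: "?U2(g := Some (Suc (Suc a)), ?d := None) = U3"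
    unfolding U3_def by auto
  show "slides U h T y \<longleftrightarrow> slides U3 ?d T y"
    using slides_move[of h g g' U, OF nb U(1) min1] slides_move[of g ?d x ?U2, OF x(1) d2 min2] unfolding eq by blast
  show "hole_inv cls e U3 ?d"
    using hole_inv_move[OF hole_inv_move[OF inv nb U(1) min1] x(1) d2 min2] unfolding eq .
qed

text \<open>If the two exchanged letters compete for the hole, the types of the neighbouring pairs force
  the third letter into the opposite corner of the square, and after two moves the relation between
  the two fillings becomes the exchange of the two larger letters.\<close>

lemma slides_conflict:
  assumes inv: "hole_inv cls e U h" "hole_inv cls' e' (map_filling (swap a) U) h"
    and nb: "neighbours h g g'" and U: "U g = Some a" "U g' = Some (Suc a)"
    and cls': "cls' = cls \<circ> swap a" and bt: "between (cls (Suc (Suc a))) (cls a) (cls (Suc a))"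
    and sl: "slides U h T y"
  shows "slides (map_filling (swap a) U) h (map_filling (swap (Suc a)) T) y"
    "\<forall>v\<in>{a, Suc a, Suc (Suc a)}. v \<le> e (cls v)"
proof -
  note C = core_invD[OF hole_invD(1)[OF inv(1)]] and C' = core_invD[OF hole_invD(1)[OF inv(2)]]
  let ?p = "Suc (Suc a)" and ?U = "map_filling (swap a) U" and ?d = "diag_box h"
  have csw: "cls' a = cls (Suc a)" "cls' (Suc a) = cls a" "cls' ?p = cls ?p"
    unfolding cls' by (auto simp: transpose_def)
  have pos: "1 \<le> a"
    using core_inv_class(1)[OF hole_invD(1)[OF inv(1)] U(1)] .
  have cn: "cls a \<in> {1..n}" "cls (Suc a) \<in> {1..n}"
    using core_inv_class(2)[OF hole_invD(1)[OF inv(1)]] U by blast+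
  then have "cls ?p \<in> {1..n}"
    using bt by (auto simp: between_def)
  then have "cls (e (cls ?p)) = cls ?p"
    using C(9) by blast
  \<comment> \<open>The latest letter of the witness class is at least \<open>Suc a\<close> but has
    a different class from \<open>Suc a\<close>; so it is at least \<open>?p\<close>, and
    \<open>?p\<close> is present.\<close>
  then have "e (cls ?p) \<noteq> Suc a"
    using bt by (auto simp: between_def)
  moreover have "Suc a \<le> e (cls ?p)"
    using competing_letters_home(2)[OF inv(1) nb U bt] .
  ultimately have "?p \<le> e (cls ?p)"
    by simp
  then obtain x where x: "U x = Some ?p"
    using present_iff[OF hole_invD(1)[OF inv(1)], of ?p] by auto
  have U': "?U g' = Some a" "?U g = Some (Suc a)" "?U x = Some ?p"
    using U x by (auto simp: transpose_def)
  have "x = ?d"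
    using bt C(6)[OF U] C(7)[OF U] C(6)[OF U(2) x] C(7)[OF U(2) x] C'(6)[OF U'(2,3)] C'(7)[OF U'(2,3)] nb
    unfolding csw
    by (auto simp: between_def neighbours_def right_of_def below_def diag_box_def prod_eq_iff)
  then have d: "U ?d = Some ?p" "?U ?d = Some ?p"
    using x U' by auto
  have dne: "?d \<noteq> h" "?d \<noteq> g" "?d \<noteq> g'"
    using neighbours_diag_box(2-4)[OF nb] by auto
  note N = neighboursD[OF nb]
  let ?U3 = "U(h := Some a, g := Some ?p, ?d := None)"
  let ?V3 = "?U(h := Some a, g' := Some ?p, ?d := None)"
  note sq = slides_square[OF inv(1) nb U d(1)]
  note sq' = slides_square[OF inv(2) N(6) U'(1,2) d(2)]
  have eq: "?V3 = map_filling (swap (Suc a)) ?U3"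
  proof
    fix z
    consider "z = h" | "z = g" | "z = g'" | "z = ?d" | "z \<noteq> h" "z \<noteq> g" "z \<noteq> g'" "z \<noteq> ?d"
      by blast
    then show "?V3 z = map_filling (swap (Suc a)) ?U3 z"
    proof cases
      case 5
      show ?thesis
      proof (cases "U z")
        case (Some q)
        then have "q \<noteq> a" "q \<noteq> Suc a" "q \<noteq> ?p"
          using C(2)[OF Some] U d 5 by blast+
        then show ?thesis
          using 5 Some by (simp add: map_filling_def transpose_def)
      qed (use 5 in \<open>simp add: map_filling_def\<close>)
    qed (use N dne U' U in \<open>auto simp: map_filling_def transpose_def\<close>)
  qed
  have pres: "v \<le> e (cls v)" if "U z = Some v" for z v
    using present_iff[OF hole_invD(1)[OF inv(1)], of v] that by blast
  have opp: "opposite cls cls' a"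
    using bt by (auto simp: opposite_def between_def csw)
  have "slides (map_filling (swap (Suc a)) ?U3) ?d (map_filling (swap (Suc a)) T) y"
    using slides_swap_calm[OF _ sq(2) _ opp pos] sq'(2) sq(1) sl pres[OF U(1)] unfolding eq by blast
  then show "slides ?U h (map_filling (swap (Suc a)) T) y"
    using sq'(1) unfolding eq by blast
  show "\<forall>v\<in>{a, Suc a, ?p}. v \<le> e (cls v)"
    using pres U d by blast
qed

lemma slides_swap_high_step:
  assumes inv: "hole_inv cls e U h" "hole_inv cls' e' (map_filling (swap a) U) h"
    and nb: "neighbours h g g'" "U g = Some p" "\<And>q. U g' = Some q \<Longrightarrow> p < q"
    and cls': "cls' = cls \<circ> swap a" and bt: "between (cls (Suc (Suc a))) (cls a) (cls (Suc a))"
    and sl: "slides (U(h := Some p, g := None)) g T y"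
    and IH: "hole_inv cls e (U(h := Some p, g := None)) g \<Longrightarrow>
      hole_inv cls' e' (map_filling (swap a) (U(h := Some p, g := None))) g \<Longrightarrow>
      slides (map_filling (swap a) (U(h := Some p, g := None))) g (map_filling (swap a) T) y \<or>
      slides (map_filling (swap a) (U(h := Some p, g := None))) g (map_filling (swap (Suc a)) T) y \<and>
      (\<forall>v\<in>{a, Suc a, Suc (Suc a)}. v \<le> e (cls v))"
  shows "slides (map_filling (swap a) U) h (map_filling (swap a) T) y \<or>
      slides (map_filling (swap a) U) h (map_filling (swap (Suc a)) T) y \<and>
      (\<forall>v\<in>{a, Suc a, Suc (Suc a)}. v \<le> e (cls v))"
proof (cases "p = a \<and> U g' = Some (Suc a)")
  case True
  have "slides U h T y"
    using slides_move[of h g g' U p, OF nb] sl by blast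
  then show ?thesis
    using slides_conflict[OF inv nb(1) _ _ cls' bt] True nb(2) by blast
next
  case False
  let ?f = "map_filling (swap a)"
  have min: "swap a p < q" if q: "?f U g' = Some q" for q
  proof -
    obtain q0 where q0: "U g' = Some q0" "q = swap a q0"
      using map_filling_SomeD[OF q] by blast
    have "\<not> (p = a \<and> q0 = Suc a)"
      using False q0(1) by auto
    then show ?thesis
      using swap_strict_mono[OF nb(3)[OF q0(1)]] q0(2) by simp
  qed
  have gU: "?f U g = Some (swap a p)"
    using nb(2) by simp
  have eq: "?f (U(h := Some p, g := None)) = (?f U)(h := Some (swap a p), g := None)"
    by (simp add: map_filling_upd)
  from IH[OF hole_inv_move[OF inv(1) nb]] hole_inv_move[OF inv(2) nb(1) gU min]
  show ?thesis
    unfolding eq using slides_move[of h g g' "?f U", OF nb(1) gU min] by blast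
qed

lemma slides_swap_high:
  "slides U h T y \<Longrightarrow> hole_inv cls e U h \<Longrightarrow> hole_inv cls' e' (map_filling (swap a) U) h \<Longrightarrow>
   cls' = cls \<circ> swap a \<Longrightarrow> between (cls (Suc (Suc a))) (cls a) (cls (Suc a)) \<Longrightarrow>
   slides (map_filling (swap a) U) h (map_filling (swap a) T) y \<or>
   slides (map_filling (swap a) U) h (map_filling (swap (Suc a)) T) y \<and>
   (\<forall>v\<in>{a, Suc a, Suc (Suc a)}. v \<le> e (cls v))"
proof (induction rule: slides.induct)
  case (stop T x)
  have "slides (map_filling (swap a) T) x (map_filling (swap a) T) x"
    by (intro slides.stop) (use stop in auto)
  then show ?case ..
next
  case (move_right U h p T y)
  show ?case
    by (rule slides_swap_high_step[of cls e U h cls' e' a "right_of h" "below h" p])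
      (use move_right in \<open>auto simp: neighbours_def simp del: fun_upd_apply\<close>)
next
  case (move_below U h p T y)
  show ?case
    by (rule slides_swap_high_step[of cls e U h cls' e' a "below h" "right_of h" p])
      (use move_below in \<open>auto simp: neighbours_def simp del: fun_upd_apply\<close>)
qed

end

subsection \<open>Runs with a general sequence of refills\<close>

text \<open>Only letters of class \<open>i\<close> are compared, and \<open>t\<close> and
  \<open>Suc t\<close> are not both of that class. The alternative \<open>e < t\<close> serves the
  start of a run, where \<open>e\<close> is \<open>0\<close>.\<close>

lemma nx_swap:
  assumes "good_classes n cls" "i \<in> {1..n}" "cls t \<noteq> cls (Suc t)" "cls e = i \<or> e < t"
    "cls' = cls \<circ> swap t"
  shows "nx cls' i (swap t e) = swap t (nx cls i e)"
proof -
  note N = nx[OF assms(1,2), of e]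
  let ?v = "nx cls i e"
  have *: "\<not> (e = t \<and> w = Suc t)" "\<not> (e = Suc t \<and> w = t)" "\<not> (?v = t \<and> w = Suc t)" if "cls w = i" for w
    using that assms(3,4) N(2) by auto
  show ?thesis
    unfolding nx_def[of cls']
  proof (rule Least_equality)
    show "swap t e < swap t ?v \<and> cls' (swap t ?v) = i"
      using swap_strict_mono[OF N(1), of t] *(1)[OF N(2)] N(2) assms(5) by simp
  next
    fix w assume w: "swap t e < w \<and> cls' w = i"
    have c: "cls (swap t w) = i"
      using w assms(5) by simp
    have "\<not> (swap t e = t \<and> w = Suc t)"
      using *(2)[OF c] by (auto simp: transpose_def split: if_splits)
    then have "swap t (swap t e) < swap t w"
      using w by (intro swap_strict_mono) auto
    then have "?v \<le> swap t w"
      using N(3)[OF _ c] by simp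
    then consider "?v = swap t w" | "?v < swap t w"
      by linarith
    then show "swap t ?v \<le> w"
    proof cases
      case 2
      then have "swap t ?v < swap t (swap t w)"
        using *(3)[OF c] by (intro swap_strict_mono) auto
      then show ?thesis by simp
    qed simp
  qed
qed

context diagonal
begin

lemma initial_filling_b: "i \<in> {1..n} \<Longrightarrow> initial_filling n b w (b i) = Some (w i)"
proof -
  assume i: "i \<in> {1..n}"
  have "distinct (map fst (map (\<lambda>i. (b i, w i)) [1..<Suc n]))"
    using b_inj by (auto simp: distinct_map inj_on_def comp_def simp del: upt_Suc)
  then show ?thesis
    unfolding initial_filling_def using i
    by (intro map_of_is_SomeI) (auto simp del: upt_Suc)
qed

lemma initial_filling_SomeD:
  "initial_filling n b w x = Some p \<Longrightarrow> \<exists>i\<in>{1..n}. x = b i \<and> p = w i"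
  unfolding initial_filling_def by (force dest!: map_of_SomeD simp del: upt_Suc)

lemma initial_filling_iff:
  "initial_filling n b w x = Some p \<longleftrightarrow> (\<exists>i\<in>{1..n}. x = b i \<and> p = w i)"
  using initial_filling_b initial_filling_SomeD by blast

lemma map_filling_initial:
  assumes "\<And>i. i \<in> {1..n} \<Longrightarrow> w' i = f (w i)"
  shows "initial_filling n b w' = map_filling f (initial_filling n b w)"
proof
  fix x
  show "initial_filling n b w' x = map_filling f (initial_filling n b w) x"
  proof (cases "\<exists>i\<in>{1..n}. x = b i")
    case True
    then show ?thesis
      using initial_filling_b assms by auto
  next
    case False
    then show ?thesis
      using initial_filling_SomeD by (metis map_filling_None option.exhaust)
  qed
qed

lemma initial_inv:
  assumes "good_classes n cls"
  shows "rest_inv cls (\<lambda>i. nx cls i 0) (initial_filling n b (\<lambda>i. nx cls i 0))"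
proof -
  let ?e = "\<lambda>i. nx cls i 0"
  let ?T = "initial_filling n b ?e"
  note N = nx[OF assms]
  have dom: "dom ?T = b ` {1..n}"
    using initial_filling_iff[of ?e] by (auto simp: dom_def)
  have cl: "cls v \<in> {1..n}" if "1 \<le> v" for v
    using assms that by (simp add: good_classes_def)
  have "core_inv cls ?e ?T"
    unfolding core_inv_def initial_filling_iff
  proof (intro conjI allI impI ballI)
    show "ran ?T = {v. 1 \<le> v \<and> v \<le> ?e (cls v)}"
    proof (intro set_eqI iffI)
      fix v assume "v \<in> ran ?T"
      then obtain i where "i \<in> {1..n}" "v = ?e i"
        using initial_filling_iff by (auto simp: ran_def)
      then show "v \<in> {v. 1 \<le> v \<and> v \<le> ?e (cls v)}"
        using N(1)[of i 0] N(2)[of i 0] by auto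
    next
      fix v assume "v \<in> {v. 1 \<le> v \<and> v \<le> ?e (cls v)}"
      then have "v = ?e (cls v)" "cls v \<in> {1..n}"
        using N(3)[OF cl, of v 0 v] cl[of v] by auto
      then show "v \<in> ran ?T"
        using initial_filling_b ranI by metis
    qed
  next
    fix x y p q assume "\<exists>i\<in>{1..n}. x = b i \<and> p = ?e i" "\<exists>i\<in>{1..n}. y = b i \<and> q = ?e i" "nw x y" "x \<noteq> y"
    then show "p < q"
      using b_nw_b by blast
  next
    fix x y p assume "\<exists>i\<in>{1..n}. x = b i \<and> p = ?e i" "\<exists>i\<in>{1..n}. y = b i \<and> p = ?e i"
    then show "x = y"
      using N(2) by metis
  next
    fix x p assume "\<exists>i\<in>{1..n}. x = b i \<and> p = ?e i"
    then show "nw x (b (cls p))"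
      using N(2) by auto
  next
    fix x p i assume "i \<in> {1..n}" "\<exists>i\<in>{1..n}. x = b i \<and> p = ?e i" "nw x (b i)"
    then show "p \<le> ?e i"
      using b_nw_b by blast
  next
    fix x y v assume *: "\<exists>i\<in>{1..n}. x = b i \<and> v = ?e i" "\<exists>i\<in>{1..n}. y = b i \<and> Suc v = ?e i"
      "cls v < cls (Suc v)"
    then obtain i j where "i \<in> {1..n}" "x = b i" "j \<in> {1..n}" "y = b j" "cls v = i" "cls (Suc v) = j"
      using N(2) by metis
    then show "snd x < snd y" "fst y \<le> fst x"
      using b_less[of i j] *(3) by auto
  next
    fix x y v assume *: "\<exists>i\<in>{1..n}. x = b i \<and> v = ?e i" "\<exists>i\<in>{1..n}. y = b i \<and> Suc v = ?e i"
      "cls (Suc v) < cls v"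
    then obtain i j where "i \<in> {1..n}" "x = b i" "j \<in> {1..n}" "y = b j" "cls v = i" "cls (Suc v) = j"
      using N(2) by metis
    then show "fst x < fst y" "snd y \<le> snd x"
      using b_less[of j i] *(3) by auto
  next
    fix i assume "i \<in> {1..n}"
    then show "1 \<le> ?e i" "cls (?e i) = i"
      using N(1)[of i 0] N(2)[of i 0] by auto
  qed (rule assms)
  moreover have "y \<in> dom ?T" if "x \<in> dom ?T" "y \<in> lp" "nw x y" for x y
    using that b_maximal unfolding dom by blast
  ultimately show ?thesis
    unfolding rest_inv_def using b_in initial_filling_b dom by auto
qed

text \<open>The list \<open>xs\<close> records the chosen corners, so that runs for different class
  functions can be compared under the same choices.\<close>

inductive run :: "(nat \<Rightarrow> nat) \<Rightarrow> box list \<Rightarrow> (box \<rightharpoonup> nat) \<Rightarrow> (nat \<Rightarrow> nat) \<Rightarrow> bool" for cls where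
  run_start: "run cls [] (initial_filling n b (\<lambda>i. nx cls i 0)) (\<lambda>i. nx cls i 0)"
| run_step: "run cls xs T e \<Longrightarrow> corner (lp - dom T) x \<Longrightarrow> slides T x U (b i) \<Longrightarrow> i \<in> {1..n} \<Longrightarrow>
    run cls (xs @ [x]) (U(b i := Some (nx cls i (e i)))) (e(i := nx cls i (e i)))"

lemma run_inv: "run cls xs T e \<Longrightarrow> good_classes n cls \<Longrightarrow> rest_inv cls e T"
proof (induction rule: run.induct)
  case run_start
  then show ?case
    by (rule initial_inv)
next
  case (run_step xs T e x U i)
  have "hole_inv cls e U (b i)"
    using slides_inv[OF run_step.hyps(3) rest_inv_start[OF run_step.IH[OF run_step.prems] run_step.hyps(2)]]
    by blast
  then show ?case
    by (rule refill_inv[OF _ run_step.hyps(4)])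
qed

lemma rest_invD:
  assumes "rest_inv cls e T"
  shows "core_inv cls e T" "dom T \<subseteq> lp" "i \<in> {1..n} \<Longrightarrow> T (b i) = Some (e i)"
  using assms unfolding rest_inv_def by auto

lemma run_swap_low:
  assumes good: "good_classes n cls" "good_classes n cls'" and cls': "cls' = cls \<circ> swap (Suc a)"
    and bt: "between (cls a) (cls (Suc a)) (cls (Suc (Suc a)))" and a: "1 \<le> a"
  shows "run cls xs T e \<Longrightarrow> \<exists>e'. run cls' xs (map_filling (swap (Suc a)) T) e'"
proof (induction rule: run.induct)
  case run_start
  have "nx cls' i 0 = swap (Suc a) (nx cls i 0)" if "i \<in> {1..n}" for i
    using nx_swap[OF good(1) that, of "Suc a" 0 cls'] bt cls' by (auto simp: between_def)
  then have "initial_filling n b (\<lambda>i. nx cls' i 0) =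
      map_filling (swap (Suc a)) (initial_filling n b (\<lambda>i. nx cls i 0))"
    by (intro map_filling_initial)
  then show ?case
    using run.run_start[of cls'] by metis
next
  case (run_step xs T e x U i)
  let ?f = "map_filling (swap (Suc a))"
  obtain e' where r': "run cls' xs (?f T) e'"
    using run_step.IH by blast
  have inv: "rest_inv cls e T" "rest_inv cls' e' (?f T)"
    using run_inv run_step.hyps(1) r' good by blast+
  have "?f T (b i) = Some (swap (Suc a) (e i))"
    using rest_invD(3)[OF inv(1) run_step.hyps(4)] by simp
  then have e': "e' i = swap (Suc a) (e i)"
    using rest_invD(3)[OF inv(2) run_step.hyps(4)] by simp
  have nx': "nx cls' i (e' i) = swap (Suc a) (nx cls i (e i))"
    unfolding e' by (rule nx_swap[OF good(1) run_step.hyps(4)])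
      (use bt cls' core_invD(9)[OF rest_invD(1)[OF inv(1)] run_step.hyps(4)] in \<open>auto simp: between_def\<close>)
  have c': "corner (lp - dom (?f T)) x"
    using run_step.hyps(2) by simp
  have opp: "opposite cls cls' a"
    using bt unfolding cls' by (auto simp: opposite_def between_def transpose_def)
  have "slides (?f T) x (?f U) (b i)"
    using slides_swap_calm[OF run_step.hyps(3) rest_inv_start[OF inv(1) run_step.hyps(2)]
        rest_inv_start[OF inv(2) c'] opp a] bt by blast
  from run.run_step[OF r' c' this run_step.hyps(4)] show ?case
    unfolding nx' by (auto simp: map_filling_upd simp del: fun_upd_apply)
qed

text \<open>Once the fillings differ by the exchange of the two larger letters, all three letters
  are present. Later refills then use letters fixed by both transpositions, and
  \<open>slides_swap_calm\<close> covers all further slides.\<close>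

lemma run_swap_high:
  assumes good: "good_classes n cls" "good_classes n cls'" and cls': "cls' = cls \<circ> swap a"
    and bt: "between (cls (Suc (Suc a))) (cls a) (cls (Suc a))" and a: "1 \<le> a"
  shows "run cls xs T e \<Longrightarrow> (\<exists>e'. run cls' xs (map_filling (swap a) T) e') \<or>
    (\<exists>e'. run cls' xs (map_filling (swap (Suc a)) T) e') \<and> {a, Suc a, Suc (Suc a)} \<subseteq> ran T"
proof (induction rule: run.induct)
  case run_start
  have "nx cls' i 0 = swap a (nx cls i 0)" if "i \<in> {1..n}" for i
    using nx_swap[OF good(1) that, of a 0 cls'] bt cls' a by (auto simp: between_def)
  then have "initial_filling n b (\<lambda>i. nx cls' i 0) =
      map_filling (swap a) (initial_filling n b (\<lambda>i. nx cls i 0))"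
    by (intro map_filling_initial)
  then show ?case
    using run.run_start[of cls'] by metis
next
  case (run_step xs T e x U i)
  let ?f = "map_filling (swap a)" and ?f' = "map_filling (swap (Suc a))"
  let ?p = "Suc (Suc a)" and ?v = "nx cls i (e i)"
  have i: "i \<in> {1..n}"
    by fact
  have inv: "rest_inv cls e T"
    using run_inv run_step.hyps(1) good by blast
  note hi = rest_inv_start[OF inv run_step.hyps(2)]
  have inv2: "hole_inv cls e U (b i)"
    using slides_inv[OF run_step.hyps(3) hi] by blast
  have inv3: "rest_inv cls (e(i := ?v)) (U(b i := Some ?v))"
    by (rule refill_inv[OF inv2 i])
  note nxi = nx[OF good(1) i, of "e i"]
  have ran_T: "ran T = {v. 1 \<le> v \<and> v \<le> e (cls v)}"
    using core_invD(3)[OF rest_invD(1)[OF inv]] .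
  have v_new: "?v \<noteq> w" if "w \<le> e (cls w)" for w
    using that nxi(1,2) by auto
  have ran_U: "w \<in> ran (U(b i := Some ?v))" if "1 \<le> w" "w \<le> e (cls w)" for w
    using core_invD(3)[OF rest_invD(1)[OF inv3]] that nxi(1) by auto
  have eqf: "map_filling g (U(b i := Some ?v)) = (map_filling g U)(b i := Some (g ?v))" for g
    by (simp add: map_filling_upd)
  from run_step.IH show ?case
  proof (elim disjE conjE exE)
    fix e' assume r': "run cls' xs (?f T) e'"
    have inv': "rest_inv cls' e' (?f T)"
      using run_inv r' good by blast
    have "?f T (b i) = Some (swap a (e i))"
      using rest_invD(3)[OF inv i] by simp
    then have e': "e' i = swap a (e i)"
      using rest_invD(3)[OF inv' i] by simp
    have nx': "nx cls' i (e' i) = swap a ?v"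
      unfolding e' by (rule nx_swap[OF good(1) i])
        (use bt cls' core_invD(9)[OF rest_invD(1)[OF inv] i] in \<open>auto simp: between_def\<close>)
    have c': "corner (lp - dom (?f T)) x"
      using run_step.hyps(2) by simp
    from slides_swap_high[OF run_step.hyps(3) hi rest_inv_start[OF inv' c'] cls' bt]
    show ?thesis
    proof (elim disjE conjE)
      assume "slides (?f T) x (?f U) (b i)"
      from run.run_step[OF r' c' this i] show ?thesis
        unfolding nx' eqf by blast
    next
      assume s: "slides (?f T) x (?f' U) (b i)" and p: "\<forall>v\<in>{a, Suc a, ?p}. v \<le> e (cls v)"
      have "swap a ?v = ?v" "swap (Suc a) ?v = ?v"
        using v_new p by (auto simp: transpose_def)
      then have "nx cls' i (e' i) = swap (Suc a) ?v"
        using nx' by simp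
      with run.run_step[OF r' c' s i] have "\<exists>e'. run cls' (xs @ [x]) (?f' (U(b i := Some ?v))) e'"
        unfolding eqf by metis
      moreover have "{a, Suc a, ?p} \<subseteq> ran (U(b i := Some ?v))"
        using ran_U p a by simp
      ultimately show ?thesis
        by blast
    qed
  next
    fix e' assume r': "run cls' xs (?f' T) e'" and sub: "{a, Suc a, ?p} \<subseteq> ran T"
    have inv': "rest_inv cls' e' (?f' T)"
      using run_inv r' good by blast
    have p: "\<forall>v\<in>{a, Suc a, ?p}. v \<le> e (cls v)"
      using sub unfolding ran_T by auto
    have csw: "cls' w = cls w" if "w \<notin> {a, Suc a, ?p}" for w
      using that unfolding cls' by (auto simp: transpose_def)
    have "{a, Suc a, ?p} \<subseteq> ran (?f' T)"
    proof
      fix w assume w: "w \<in> {a, Suc a, ?p}"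
      then have "swap (Suc a) w \<in> {a, Suc a, ?p}"
        by (auto simp: transpose_def)
      then obtain z where "T z = Some (swap (Suc a) w)"
        using sub by (auto simp: ran_def subset_iff)
      then have "?f' T z = Some w"
        by simp
      then show "w \<in> ran (?f' T)"
        by (rule ranI)
    qed
    then have p': "\<forall>v\<in>{a, Suc a, ?p}. v \<le> e' (cls' v)"
      unfolding core_invD(3)[OF rest_invD(1)[OF inv']] by auto
    have "?f' T (b i) = Some (swap (Suc a) (e i))"
      using rest_invD(3)[OF inv i] by simp
    then have e': "e' i = swap (Suc a) (e i)"
      using rest_invD(3)[OF inv' i] by simp
    have v3: "?v \<notin> {a, Suc a, ?p}"
      using v_new p by blast
    \<comment> \<open>The three letters are consecutive, so exchanging two of them changes no
      comparison with a letter outside the three, even if \<open>e i\<close> is among them.\<close>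
    have lt: "w < e i \<or> w = e i \<longleftrightarrow> w < e' i \<or> w = e' i" if "w \<notin> {a, Suc a, ?p}" for w
      using that unfolding e' by (auto simp: transpose_def split: if_splits)
    have nx': "nx cls' i (e' i) = ?v"
      unfolding nx_def[of cls']
    proof (rule Least_equality)
      show "e' i < ?v \<and> cls' ?v = i"
        using lt[OF v3] nxi(1,2) csw[OF v3] by auto
    next
      fix w assume w: "e' i < w \<and> cls' w = i"
      then have w3: "w \<notin> {a, Suc a, ?p}"
        using p' by (metis not_le)
      then have "e i < w"
        using lt[OF w3] w by (metis less_asym linorder_neqE_nat less_irrefl)
      then show "?v \<le> w"
        using nxi(3) csw[OF w3] w by simp
    qed
    have nx'': "nx cls' i (e' i) = swap (Suc a) ?v"
      unfolding nx' using v3 by (auto simp: transpose_def)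
    have c': "corner (lp - dom (?f' T)) x"
      using run_step.hyps(2) by simp
    have opp: "opposite cls cls' a"
      using bt unfolding cls' by (auto simp: opposite_def between_def transpose_def)
    have "slides (?f' T) x (?f' U) (b i)"
      using slides_swap_calm[OF run_step.hyps(3) hi rest_inv_start[OF inv' c'] opp a] p by blast
    from run.run_step[OF r' c' this i] have "\<exists>e'. run cls' (xs @ [x]) (?f' (U(b i := Some ?v))) e'"
      unfolding eqf nx'' by metis
    moreover have "{a, Suc a, ?p} \<subseteq> ran (U(b i := Some ?v))"
      using ran_U p a by simp
    ultimately show ?thesis
      by blast
  qed
qed

text \<open>A letter not yet used is assigned the row of its home box, where it would enter. Every
  letter thus has a row, which a row system on a long word requires.\<close>

definition row_of :: "(nat \<Rightarrow> nat) \<Rightarrow> (box \<rightharpoonup> nat) \<Rightarrow> nat \<Rightarrow> nat \<Rightarrow> bool" where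
  "row_of cls T v r \<longleftrightarrow> (\<exists>x. T x = Some v \<and> fst x = r) \<or> v \<notin> ran T \<and> r = Suc n - cls v"

lemma row_of_cases:
  assumes "rest_inv cls e T" "1 \<le> v" "row_of cls T v r"
  obtains (present) x where "T x = Some v" "fst x = r" "nw x (b (cls v))" "cls v \<in> {1..n}"
  | (absent) "e (cls v) < v" "r = fst (b (cls v))" "cls v \<in> {1..n}"
proof -
  note C = core_invD[OF rest_invD(1)[OF assms(1)]]
  have c: "cls v \<in> {1..n}"
    using C(10) assms(2) by (simp add: good_classes_def)
  from assms(3) show ?thesis
    unfolding row_of_def
  proof (elim disjE exE conjE)
    fix x assume "T x = Some v" "fst x = r"
    then show ?thesis
      using present C(4) c by blast
  next
    assume "v \<notin> ran T" "r = Suc n - cls v"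
    then show ?thesis
      using absent C(3) assms(2) c b_row[OF c] by (simp add: not_le)
  qed
qed

text \<open>If \<open>v\<close> is present, \<open>Suc v\<close> absent and the claim false, then
  \<open>v\<close> is north-west of the home box of \<open>Suc v\<close>. This forces
  \<open>v\<close> to be the latest letter of that class, although its own class is
  different.\<close>

lemma row_of_asc:
  assumes inv: "rest_inv cls e T" and v: "1 \<le> v" "row_of cls T v r" "row_of cls T (Suc v) r'"
    and lt: "cls v < cls (Suc v)"
  shows "r' \<le> r"
proof -
  note C = core_invD[OF rest_invD(1)[OF inv]]
  have v': "1 \<le> Suc v"
    by simp
  show ?thesis
  proof (cases rule: row_of_cases[OF inv v(1,2), case_names present absent])
    case x: (present x)
    show ?thesis
    proof (cases rule: row_of_cases[OF inv v' v(3), case_names present absent])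
      case y: (present y)
      then show ?thesis
        using C(6)[OF x(1) y(1) lt] x y by simp
    next
      case y: absent
      show ?thesis
      proof (rule ccontr)
        assume "\<not> r' \<le> r"
        then have "nw x (b (cls (Suc v)))"
          using x y b_less[OF x(4) y(3) lt] by (auto simp: nw_def)
        then have "v = e (cls (Suc v))"
          using C(5)[OF y(3) x(1)] y(1) by simp
        then show False
          using C(9)[OF y(3)] lt by simp
      qed
    qed
  next
    case x: absent
    show ?thesis
    proof (cases rule: row_of_cases[OF inv v' v(3), case_names present absent])
      case y: (present y)
      then show ?thesis
        using x b_less[OF x(3) y(4) lt] by (auto simp: nw_def)
    next
      case y: absent
      then show ?thesis
        using x b_less[OF x(3) y(3) lt] by simp
    qed
  qed
qed

lemma row_of_desc:
  assumes inv: "rest_inv cls e T" and v: "1 \<le> v" "row_of cls T v r" "row_of cls T (Suc v) r'"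
    and lt: "cls (Suc v) < cls v"
  shows "r < r'"
proof -
  note C = core_invD[OF rest_invD(1)[OF inv]]
  have v': "1 \<le> Suc v"
    by simp
  show ?thesis
  proof (cases rule: row_of_cases[OF inv v(1,2), case_names present absent])
    case x: (present x)
    show ?thesis
    proof (cases rule: row_of_cases[OF inv v' v(3), case_names present absent])
      case y: (present y)
      then show ?thesis
        using C(7)[OF x(1) y(1) lt] x y by simp
    next
      case y: absent
      then show ?thesis
        using x b_less[OF y(3) x(4) lt] by (auto simp: nw_def)
    qed
  next
    case x: absent
    show ?thesis
    proof (cases rule: row_of_cases[OF inv v' v(3), case_names present absent])
      case y: (present y)
      show ?thesis
      proof (rule ccontr)
        assume "\<not> r < r'"
        then have "nw y (b (cls v))"
          using x y b_less[OF y(4) x(3) lt] by (auto simp: nw_def)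
        then show False
          using C(5)[OF x(3) y(1)] x(1) by simp
      qed
    next
      case y: absent
      then show ?thesis
        using x b_less[OF y(3) x(3) lt] by simp
    qed
  qed
qed

lemma row_of_bounds:
  assumes inv: "rest_inv cls e T" and v: "1 \<le> v" "row_of cls T v r"
  shows "1 \<le> r \<and> r \<le> n"
proof (cases rule: row_of_cases[OF inv v, case_names present absent])
  case (present x)
  then have "x \<in> lp"
    using rest_invD(2)[OF inv] by auto
  then show ?thesis
    using lp_pos[of x] row_end[of x] present by auto
next
  case absent
  then show ?thesis
    using b_row[of "cls v"] by auto
qed

text \<open>An absent letter shares its row with the smaller letter \<open>e (cls v)\<close> in its
  home box. The box above a present letter is filled because the run is complete.\<close>

lemma row_of_above:
  assumes inv: "rest_inv cls e T" and full: "dom T = lp" and v: "1 \<le> v" "row_of cls T v r" "1 < r"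
  shows "\<exists>v'. 1 \<le> v' \<and> v' < v \<and> row_of cls T v' (r - 1)"
proof -
  note C = core_invD[OF rest_invD(1)[OF inv]]
  obtain x w where x: "T x = Some w" "fst x = r" "w \<le> v"
  proof (cases rule: row_of_cases[OF inv v(1,2), case_names present absent])
    case (present x)
    then show ?thesis
      using that by blast
  next
    case absent
    then show ?thesis
      using that[of "b (cls v)" "e (cls v)"] rest_invD(3)[OF inv] by simp
  qed
  let ?y = "(r - 1, snd x)"
  have "x \<in> lp"
    using x full by auto
  then have "?y \<in> lp"
    using lp_nw[of x ?y] lp_pos[of x] x v(3) by (auto simp: nw_def)
  then obtain v' where v': "T ?y = Some v'"
    using full by auto
  then have "v' < w"
    using C(1)[OF v' x(1)] x v(3) by (cases x) (auto simp: nw_def)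
  moreover have "1 \<le> v'"
    using core_inv_class(1)[OF rest_invD(1)[OF inv] v'] .
  moreover have "row_of cls T v' (r - 1)"
    unfolding row_of_def using v' by (metis fst_conv)
  ultimately show ?thesis
    using x(3) by (intro exI[of _ v']) auto
qed

end

text \<open>Beyond the word the classes recur cyclically, so that each occurs infinitely often; the
  value at \<open>0\<close> keeps \<open>0\<close> out of all classes \<open>1..n\<close>.\<close>

definition class_fun :: "nat \<Rightarrow> nat list \<Rightarrow> nat \<Rightarrow> nat" where
  "class_fun n u v = (if v = 0 then 0 else if v \<le> length u then u ! (v - 1) else Suc (v mod n))"

lemma good_class_fun:
  assumes "1 \<le> n" "set u \<subseteq> {1..n}"
  shows "good_classes n (class_fun n u)"
  unfolding good_classes_def
proof (intro conjI allI impI ballI)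
  fix v :: nat assume "1 \<le> v"
  then show "class_fun n u v \<in> {1..n}"
  proof (cases "v \<le> length u")
    case True
    then have "u ! (v - 1) \<in> {1..n}"
      using \<open>1 \<le> v\<close> assms(2) nth_mem[of "v - 1" u] by (intro subsetD[OF assms(2)]) simp
    then show ?thesis
      using True \<open>1 \<le> v\<close> by (simp add: class_fun_def)
  qed (use assms(1) \<open>1 \<le> v\<close> in \<open>auto simp: class_fun_def Suc_le_eq\<close>)
next
  fix i N assume i: "i \<in> {1..n}"
  define v where "v = (i - 1) + n * Suc (N + length u)"
  have "Suc (N + length u) \<le> n * Suc (N + length u)"
    using assms(1) by (cases n) auto
  then have v: "N + length u < v"
    unfolding v_def by linarith
  have "v mod n = i - 1"
    unfolding v_def using i by (subst mod_mult_self2) auto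
  then have "N < v" "class_fun n u v = i"
    using i v by (auto simp: class_fun_def)
  then show "\<exists>v>N. class_fun n u v = i"
    by blast
qed

lemma good_class_fun_tokens:
  assumes "1 \<le> n" "\<forall>p\<in>set z. 1 \<le> fst p \<and> fst p \<le> n"
  shows "good_classes n (class_fun n (map fst z))"
  by (rule good_class_fun[OF assms(1)]) (use assms(2) in \<open>simp add: image_subset_iff\<close>)

lemma class_fun_swap:
  "class_fun n (x @ d # c # y) = class_fun n (x @ c # d # y) \<circ> swap (Suc (length x))"
proof
  fix v
  let ?t = "length x" and ?L = "length x + Suc (Suc (length y))"
  show "class_fun n (x @ d # c # y) v = (class_fun n (x @ c # d # y) \<circ> swap (Suc ?t)) v"
  proof (cases v)
    case 0
    then show ?thesis
      by (simp add: class_fun_def transpose_def)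
  next
    case (Suc k)
    show ?thesis
    proof (cases "k < ?L")
      case True
      then have "swap ?t k < ?L"
        by (auto simp: transpose_def)
      then show ?thesis
        using True Suc nth_swap_list[of x d c y k] by (simp add: class_fun_def swap_Suc)
    next
      case False
      then have "swap ?t k = k"
        by (auto simp: transpose_def)
      then show ?thesis
        using False Suc by (simp add: class_fun_def swap_Suc)
    qed
  qed
qed

context diagonal
begin

definition slide_system :: "box list \<Rightarrow> (nat \<times> nat) list \<Rightarrow> bool" where
  "slide_system xs z \<longleftrightarrow> (\<forall>p\<in>set z. 1 \<le> fst p \<and> fst p \<le> n) \<and>
     (\<exists>T e. run (class_fun n (map fst z)) xs T e \<and> dom T = lp \<and>
        (\<forall>k<length z. row_of (class_fun n (map fst z)) T (Suc k) (snd (z ! k))))"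

lemma slide_systemD:
  assumes "slide_system xs z"
  obtains T e where "good_classes n (class_fun n (map fst z))" "run (class_fun n (map fst z)) xs T e"
    "rest_inv (class_fun n (map fst z)) e T" "dom T = lp"
    "\<And>k. k < length z \<Longrightarrow> row_of (class_fun n (map fst z)) T (Suc k) (snd (z ! k))"
proof -
  obtain T e where T: "run (class_fun n (map fst z)) xs T e" "dom T = lp"
    "\<And>k. k < length z \<Longrightarrow> row_of (class_fun n (map fst z)) T (Suc k) (snd (z ! k))"
    using assms unfolding slide_system_def by blast
  have "good_classes n (class_fun n (map fst z))"
    by (rule good_class_fun_tokens[OF n_pos]) (use assms in \<open>auto simp: slide_system_def\<close>)
  then show ?thesis
    using that T run_inv[OF T(1)] by blast
qed

text \<open>The condition on absent letters preserves their home rows. It is automatic if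
  \<open>cls'\<close> is \<open>cls \<circ> swap t\<close>; in the second alternative of a high move
  it holds because the three letters involved are all present.\<close>

lemma row_of_swap:
  assumes "row_of cls T v r" "\<And>w. w \<notin> ran T \<Longrightarrow> cls' (swap t w) = cls w"
  shows "row_of cls' (map_filling (swap t) T) (swap t v) r"
  using assms(1)
  unfolding row_of_def
proof (elim disjE exE conjE)
  fix x assume "T x = Some v" "fst x = r"
  then show "(\<exists>x. map_filling (swap t) T x = Some (swap t v) \<and> fst x = r) \<or>
      swap t v \<notin> ran (map_filling (swap t) T) \<and> r = Suc n - cls' (swap t v)"
    by (intro disjI1 exI[of _ x]) simp
next
  assume v: "v \<notin> ran T" "r = Suc n - cls v"
  have "swap t v \<notin> ran (map_filling (swap t) T)"
  proof
    assume "swap t v \<in> ran (map_filling (swap t) T)"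
    then obtain x where "map_filling (swap t) T x = Some (swap t v)"
      by (auto simp: ran_def)
    then obtain p where "T x = Some p" "swap t v = swap t p"
      using map_filling_SomeD by blast
    then show False
      using v(1) ranI[of T x p] by simp
  qed
  then show "(\<exists>x. map_filling (swap t) T x = Some (swap t v) \<and> fst x = r) \<or>
      swap t v \<notin> ran (map_filling (swap t) T) \<and> r = Suc n - cls' (swap t v)"
    using assms(2)[OF v(1)] v(2) by simp
qed

lemma slide_row_system: "row_system n (slide_system xs)"
proof
  fix x y :: "(nat \<times> nat) list" and c r c' r'
  let ?z = "x @ (c, r) # (c', r') # y" and ?t = "Suc (length x)"
  let ?cls = "class_fun n (map fst ?z)"
  assume "slide_system xs ?z"
  then obtain T e where inv: "rest_inv ?cls e T"
    and row: "\<And>k. k < length ?z \<Longrightarrow> row_of ?cls T (Suc k) (snd (?z ! k))"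
    by (rule slide_systemD) blast
  have r: "row_of ?cls T ?t r" "row_of ?cls T (Suc ?t) r'"
    using row[of "length x"] row[of ?t] by (auto simp: nth_append)
  have "?cls ?t = c" "?cls (Suc ?t) = c'"
    by (auto simp: class_fun_def nth_append)
  then show "c < c' \<Longrightarrow> r' \<le> r" "c' < c \<Longrightarrow> r < r'"
    using row_of_asc[OF inv _ r] row_of_desc[OF inv _ r] by auto
next
  fix x y :: "(nat \<times> nat) list" and c r
  let ?z = "x @ (c, r) # y" and ?t = "Suc (length x)"
  let ?cls = "class_fun n (map fst ?z)"
  assume "slide_system xs ?z"
  then obtain T e where inv: "good_classes n ?cls" "rest_inv ?cls e T" and full: "dom T = lp"
    and row: "\<And>k. k < length ?z \<Longrightarrow> row_of ?cls T (Suc k) (snd (?z ! k))"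
    by (rule slide_systemD) blast
  have r: "row_of ?cls T ?t r"
    using row[of "length x"] by (auto simp: nth_append)
  show "1 \<le> r \<and> r \<le> n"
    using row_of_bounds[OF inv(2) _ r] by simp
  have "\<exists>p\<in>set x. r \<le> Suc (snd p)" if "\<not> r \<le> 1"
  proof -
    obtain v where v: "1 \<le> v" "v < ?t" "row_of ?cls T v (r - 1)"
      using row_of_above[OF inv(2) full _ r] \<open>\<not> r \<le> 1\<close> by auto
    then obtain k where k: "v = Suc k" "k < length x"
      by (cases v) auto
    then have "row_of ?cls T v (snd (x ! k))"
      using row[of k] by (simp add: nth_append)
    then have "snd (x ! k) = r - 1"
      using v(3) core_invD(2)[OF rest_invD(1)[OF inv(2)]] unfolding row_of_def
      by (metis ranI)
    then show ?thesis
      using k by (intro bexI[of _ "x ! k"]) auto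
  qed
  then show "r \<le> 1 \<or> (\<exists>p\<in>set x. r \<le> Suc (snd p))"
    by blast
next
  fix x y :: "(nat \<times> nat) list" and p q s
  assume R: "slide_system xs (x @ [p, q, s] @ y)" and bt: "between (fst p) (fst q) (fst s)"
  let ?z = "x @ [p, q, s] @ y" and ?z' = "x @ [p, s, q] @ y" and ?a = "Suc (length x)"
  let ?cls = "class_fun n (map fst ?z)" and ?cls' = "class_fun n (map fst ?z')"
  have cl: "\<forall>p\<in>set ?z. 1 \<le> fst p \<and> fst p \<le> n"
    using R unfolding slide_system_def by blast
  obtain T e where T: "good_classes n ?cls" "run ?cls xs T e" "dom T = lp"
    and row: "\<And>k. k < length ?z \<Longrightarrow> row_of ?cls T (Suc k) (snd (?z ! k))"
    using R by (rule slide_systemD) blast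
  have cls': "?cls' = ?cls \<circ> swap (Suc ?a)"
    using class_fun_swap[of n "map fst x @ [fst p]" "fst s" "fst q" "map fst y"] by simp
  have good': "good_classes n ?cls'"
    by (rule good_class_fun_tokens[OF n_pos]) (use cl in auto)
  have "between (?cls ?a) (?cls (Suc ?a)) (?cls (Suc (Suc ?a)))"
    using bt by (simp add: class_fun_def nth_append)
  then obtain e' where "run ?cls' xs (map_filling (swap (Suc ?a)) T) e'"
    using run_swap_low[OF T(1) good' cls' _ _ T(2)] by auto
  moreover have "row_of ?cls' (map_filling (swap (Suc ?a)) T) (Suc k) (snd (?z' ! k))"
    if k: "k < length ?z'" for k
  proof -
    have "swap ?a k < length ?z"
      using k by (auto simp: transpose_def)
    from row_of_swap[OF row[OF this], of ?cls' "Suc ?a"]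
    show ?thesis
      using nth_swap_list[of "x @ [p]" s q y k] unfolding cls' by (simp add: swap_Suc)
  qed
  ultimately show "slide_system xs ?z'"
    unfolding slide_system_def using cl T(3)
    by (intro conjI exI[of _ "map_filling (swap (Suc ?a)) T"] exI[of _ e']) auto
next
  fix x cq rq cs rs cp rp y
  assume R: "slide_system xs (x @ [(cq, rq), (cs, rs), (cp, rp)] @ y)" and bt: "between cp cq cs"
  let ?z = "x @ [(cq, rq), (cs, rs), (cp, rp)] @ y" and ?a = "Suc (length x)"
  let ?z1 = "x @ [(cs, rs), (cq, rq), (cp, rp)] @ y" and ?z2 = "x @ [(cs, rq), (cq, rp), (cp, rs)] @ y"
  let ?cls = "class_fun n (map fst ?z)" and ?cls' = "class_fun n (map fst ?z1)"
  have cl: "\<forall>p\<in>set ?z. 1 \<le> fst p \<and> fst p \<le> n"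
    using R unfolding slide_system_def by blast
  obtain T e where T: "good_classes n ?cls" "run ?cls xs T e" "dom T = lp"
    and row: "\<And>k. k < length ?z \<Longrightarrow> row_of ?cls T (Suc k) (snd (?z ! k))"
    using R by (rule slide_systemD) blast
  have cls': "?cls' = ?cls \<circ> swap ?a"
    using class_fun_swap[of n "map fst x" cs cq "cp # map fst y"] by simp
  have good': "good_classes n ?cls'"
    by (rule good_class_fun_tokens[OF n_pos]) (use cl in auto)
  have z2: "map fst ?z2 = map fst ?z1"
    by simp
  have "between (?cls (Suc (Suc ?a))) (?cls ?a) (?cls (Suc ?a))"
    using bt by (simp add: class_fun_def nth_append)
  then consider e' where "run ?cls' xs (map_filling (swap ?a) T) e'"
    | e' where "run ?cls' xs (map_filling (swap (Suc ?a)) T) e'" "{?a, Suc ?a, Suc (Suc ?a)} \<subseteq> ran T"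
    using run_swap_high[OF T(1) good' cls' _ _ T(2)] by auto
  then show "slide_system xs ?z1 \<or> slide_system xs ?z2"
  proof cases
    case (1 e')
    have "row_of ?cls' (map_filling (swap ?a) T) (Suc k) (snd (?z1 ! k))"
      if k: "k < length ?z1" for k
    proof -
      have "swap (length x) k < length ?z"
        using k by (auto simp: transpose_def)
      from row_of_swap[OF row[OF this], of ?cls' ?a]
      show ?thesis
        using nth_swap_list[of x "(cs, rs)" "(cq, rq)" "(cp, rp) # y" k] unfolding cls'
        by (simp add: swap_Suc)
    qed
    then have "slide_system xs ?z1"
      unfolding slide_system_def using cl T(3) 1
      by (intro conjI exI[of _ "map_filling (swap ?a) T"] exI[of _ e']) auto
    then show ?thesis ..
  next
    case (2 e')
    have csw: "?cls' (swap (Suc ?a) w) = ?cls w" if "w \<notin> ran T" for w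
    proof -
      have "w \<notin> {?a, Suc ?a, Suc (Suc ?a)}"
        using that 2(2) by blast
      then have "swap (Suc ?a) w = w" "swap ?a w = w"
        by (auto simp: transpose_def)
      then show ?thesis
        unfolding cls' by simp
    qed
    have "row_of ?cls' (map_filling (swap (Suc ?a)) T) (Suc k) (snd (?z2 ! k))"
      if k: "k < length ?z2" for k
    proof -
      have *: "swap ?a k < length ?z"
        using k by (auto simp: transpose_def)
      have "snd (?z2 ! k) = map snd ?z2 ! k"
        by (rule nth_map[symmetric]) (rule k)
      also have "\<dots> = map snd ?z ! (swap ?a k)"
        using nth_swap_list[of "map snd x @ [rq]" rp rs "map snd y" k] by simp
      also have "\<dots> = snd (?z ! (swap ?a k))"
        by (rule nth_map[OF *])
      finally have "snd (?z ! (swap ?a k)) = snd (?z2 ! k)" ..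
      with row_of_swap[OF row[OF *] csw]
      show ?thesis
        by (simp add: swap_Suc)
    qed
    then have "slide_system xs ?z2"
      unfolding slide_system_def z2 using cl T(3) 2(1)
      by (intro conjI exI[of _ "map_filling (swap (Suc ?a)) T"] exI[of _ e']) auto
    then show ?thesis ..
  qed
qed

end

section \<open>The theorem\<close>

lemma is_diagonal_steps:
  assumes "is_diagonal n R lp lm b" "1 \<le> i" "i \<le> j" "j \<le> n"
  shows "fst (b j) + (j - i) \<le> fst (b i) \<and> snd (b i) + (j - i) \<le> snd (b j)"
  using assms(3,4)
proof (induction j rule: dec_induct)
  case (step j)
  have "j \<in> {1..<n}"
    using step.hyps step.prems assms(2) by auto
  then have "fst (b (Suc j)) < fst (b j)" "snd (b j) < snd (b (Suc j))"
    using assms(1) unfolding is_diagonal_def by blast+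
  then show ?case
    using step by auto
qed simp

text \<open>Having \<open>n\<close> strictly rising boxes in \<open>n\<close> rows leaves exactly
  one per row. A box of \<open>lp\<close> further right in that row would be off the diagonal, hence
  in \<open>lm\<close>, and would pull \<open>b i\<close> into \<open>lm\<close>. The column bound
  says that row \<open>r\<close> of \<open>lp\<close> has at most \<open>m + 1 - r\<close> boxes,
  which is the number of letters that \<open>row_count_lower\<close> guarantees.\<close>

lemma is_diagonal_diagonal:
  assumes diag: "is_diagonal n ({1..n} \<times> {1..m}) lp lm b" and n: "1 \<le> n"
  shows "diagonal n lp b" "i \<in> {1..n} \<Longrightarrow> snd (b i) + n \<le> m + i"
proof -
  have yp: "young_diagram lp" and ym: "young_diagram lm" and R: "lp \<subseteq> {1..n} \<times> {1..m}"
    and bs: "lp - lm = b ` {1..n}"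
    using diag unfolding is_diagonal_def by auto
  have b_lp: "b i \<in> lp" "b i \<notin> lm" "fst (b i) \<in> {1..n}" "snd (b i) \<in> {1..m}" if "i \<in> {1..n}" for i
  proof -
    have "b i \<in> lp - lm"
      unfolding bs using that by blast
    then show "b i \<in> lp" "b i \<notin> lm" "fst (b i) \<in> {1..n}" "snd (b i) \<in> {1..m}"
      using R by (auto simp: mem_Times_iff)
  qed
  note st = is_diagonal_steps[OF diag]
  have row: "fst (b i) = Suc n - i" if "i \<in> {1..n}" for i
    using st[of 1 i] st[of i n] b_lp(3)[of 1] b_lp(3)[of n] that n by auto
  show "snd (b i) + n \<le> m + i" if "i \<in> {1..n}"
    using st[of i n] b_lp(4)[of n] that n by auto
  show "diagonal n lp b"
  proof
    fix i j assume "i \<in> {1..n}" "j \<in> {1..n}" "i < j"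
    then show "snd (b i) < snd (b j)"
      using st[of i j] by auto
  next
    fix y assume y: "y \<in> lp"
    let ?i = "Suc n - fst y"
    have fy: "1 \<le> fst y" "fst y \<le> n"
      using y R by (auto simp: mem_Times_iff)
    then have i: "?i \<in> {1..n}"
      by auto
    have "snd y \<le> snd (b ?i)"
    proof (rule ccontr)
      assume *: "\<not> snd y \<le> snd (b ?i)"
      have fb: "fst (b ?i) = fst y"
        using row[OF i] fy by simp
      have "y \<notin> lm"
      proof
        assume "y \<in> lm"
        then have "b ?i \<in> lm"
          using young_diagram_nw[OF ym, of y "b ?i"] * fb young_diagram_pos[OF yp b_lp(1)[OF i]]
          by (auto simp: nw_def)
        then show False
          using b_lp(2)[OF i] by simp
      qed
      then have "y \<in> b ` {1..n}"
        using bs y by blast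
      then obtain j where j: "j \<in> {1..n}" "y = b j"
        by blast
      then have "j = ?i"
        using row[OF j(1)] fy by auto
      then show False
        using * j by simp
    qed
    then show "fst y \<le> n \<and> snd y \<le> snd (b ?i)"
      using fy by simp
  qed (use n yp b_lp row in auto)
qed

lemma slides_dom: "slides U h U' y \<Longrightarrow> insert y (dom U') = insert h (dom U)"
proof (induction rule: slides.induct)
  case (move_right T x a T' y)
  have "dom T = insert (right_of x) (dom T)"
    using move_right.hyps(1) by auto
  then show ?case
    using move_right.IH by auto
next
  case (move_below T x a T' y)
  have "dom T = insert (below x) (dom T)"
    using move_below.hyps(1) by auto
  then show ?case
    using move_below.IH by auto
qed simp

lemma nth_concat_replicate:
  assumes "length s = n" "k < M * n"
  shows "concat (replicate M s) ! k = s ! (k mod n)"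
  using assms(2)
proof (induction M arbitrary: k)
  case (Suc M)
  show ?case
  proof (cases "k < n")
    case True
    then show ?thesis
      using assms(1) by (simp add: nth_append)
  next
    case False
    then have "(k - n) mod n = k mod n"
      by (simp add: le_mod_geq)
    then show ?thesis
      using False assms(1) Suc.IH[of "k - n"] Suc.prems by (simp add: nth_append)
  qed
qed simp

lemma length_concat_replicate: "length (concat (replicate M s)) = M * length s"
  by (induction M) auto

text \<open>Serves to compare two rows that are both initial segments of a longer one.\<close>

lemma sorted_nth_initial:
  assumes "sorted_wrt (<) ls" "sorted_wrt (<) (ls' :: nat list)" "set ls' = {v \<in> set ls. v \<le> t}" "k < length ls'"
  shows "ls' ! k = ls ! k"
proof -
  have "ls' = filter (\<lambda>v. v \<le> t) ls"
    using assms(1-3) by (intro strict_sorted_equal) (auto intro: sorted_wrt_filter)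
  also have "\<dots> = takeWhile (\<lambda>v. v \<le> t) ls"
    using assms(1)
  proof (induction ls)
    case (Cons a ls)
    show ?case
    proof (cases "a \<le> t")
      case False
      then have "filter (\<lambda>v. v \<le> t) ls = []"
        using Cons.prems by (auto simp: filter_empty_conv)
      then show ?thesis
        using False by simp
    qed (use Cons in simp)
  qed simp
  finally show ?thesis
    using assms(4) takeWhile_nth by metis
qed

lemma count_mset_map_upt: "count (mset (map f [0..<N])) r = card {k. k < N \<and> f k = r}"
proof -
  have "count (mset (map f [0..<N])) r = length (filter (\<lambda>k. f k = r) [0..<N])"
    by (induction N) auto
  also have "\<dots> = card (set (filter (\<lambda>k. f k = r) [0..<N]))"
    by (rule distinct_card[symmetric]) simp
  also have "set (filter (\<lambda>k. f k = r) [0..<N]) = {k. k < N \<and> f k = r}"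
    by auto
  finally show ?thesis .
qed

section \<open>The given procedure as a special run\<close>

locale diagonal_filling = diagonal +
  fixes m :: nat and w :: "nat \<Rightarrow> nat"
  assumes w: "w permutes {1..n}"
    and b_col_le: "i \<in> {1..n} \<Longrightarrow> snd (b i) + n \<le> m + i"
begin

definition classes :: "nat list" where
  "classes = map (inv w) [1..<Suc n]"

text \<open>At most \<open>card lp\<close> slides take place, each advancing one class by
  \<open>n\<close>; \<open>aug n m w\<close> uses \<open>m\<close> letters of each class; and the
  summand \<open>2\<close> leaves room for the next letter \<open>w i + Suc k * n\<close>, which is
  at most \<open>(k + 2) * n\<close>.\<close>

definition reps :: nat where
  "reps = card lp + m + 2"

text \<open>The class \<open>i\<close> consists of the letters \<open>w i + k * n\<close>; appending the columns to the classes
  of sufficiently many letters makes the word equivalent to one whose rows are known.\<close>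

definition class_list :: "nat list" where
  "class_list = concat (replicate reps classes) @ columns (ascent_set n classes)"

abbreviation "cls \<equiv> class_fun n class_list"

lemma w_range: "i \<in> {1..n} \<Longrightarrow> w i \<in> {1..n}"
  using permutes_in_image[OF w] by blast

lemma classes: "distinct classes" "set classes = {1..n}" "length classes = n"
proof -
  have iw: "inv w permutes {1..n}"
    by (rule permutes_inv[OF w])
  show "distinct classes"
    unfolding classes_def using permutes_inj[OF iw]
    by (simp add: distinct_map inj_on_def inj_def del: upt_Suc)
  have "{1..<Suc n} = {1..n}"
    by auto
  then show "set classes = {1..n}"
    unfolding classes_def using permutes_image[OF iw] by (simp del: upt_Suc)
  show "length classes = n"
    by (simp add: classes_def)
qed

lemma class_list_range: "set class_list \<subseteq> {1..n}"
proof -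
  have E: "ascent_set n classes \<subseteq> {1..<n}" "finite (ascent_set n classes)"
    by (auto simp: ascent_set_def)
  have "set (columns (ascent_set n classes)) \<subseteq> {1..n}"
    using E(1) unfolding columns_def by (fastforce simp: set_down set_sorted_list_of_set[OF E(2)])
  moreover have "set (concat (replicate reps classes)) \<subseteq> {1..n}"
    unfolding classes(2)[symmetric] by auto
  ultimately show ?thesis
    by (simp add: class_list_def)
qed

lemma length_class_list: "reps * n \<le> length class_list"
  by (simp add: class_list_def length_concat_replicate classes(3))

lemma good_cls: "good_classes n cls"
  by (rule good_class_fun[OF n_pos class_list_range])

lemma cls_eq:
  assumes "1 \<le> v" "v \<le> reps * n"
  shows "cls v = inv w (Suc ((v - 1) mod n))"
proof -
  have "cls v = class_list ! (v - 1)"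
    using assms length_class_list by (simp add: class_fun_def)
  also have "\<dots> = concat (replicate reps classes) ! (v - 1)"
    unfolding class_list_def using assms
    by (subst nth_append_left) (auto simp: length_concat_replicate classes(3))
  also have "\<dots> = classes ! ((v - 1) mod n)"
    using assms by (intro nth_concat_replicate classes(3)) simp
  also have "\<dots> = inv w (Suc ((v - 1) mod n))"
    using n_pos by (simp add: classes_def del: upt_Suc)
  finally show ?thesis .
qed

lemma cls_iff:
  assumes "1 \<le> v" "v \<le> reps * n" "i \<in> {1..n}"
  shows "cls v = i \<longleftrightarrow> (\<exists>k. v = w i + k * n)"
proof -
  have "cls v = i \<longleftrightarrow> Suc ((v - 1) mod n) = w i"
    unfolding cls_eq[OF assms(1,2)] using permutes_inv_eq[OF w] by metis
  also have "\<dots> \<longleftrightarrow> (\<exists>k. v = w i + k * n)"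
  proof
    assume *: "Suc ((v - 1) mod n) = w i"
    have "v = Suc ((v - 1) mod n) + ((v - 1) div n) * n"
      using assms(1) by simp
    then show "\<exists>k. v = w i + k * n"
      unfolding * by blast
  next
    assume "\<exists>k. v = w i + k * n"
    then obtain k where k: "v = w i + k * n"
      by blast
    have wi: "1 \<le> w i" "w i \<le> n"
      using w_range[OF assms(3)] by auto
    then have "(v - 1) mod n = ((w i - 1) + k * n) mod n"
      using k by simp
    also have "\<dots> = w i - 1"
      using wi by (subst mod_mult_self1) auto
    finally show "Suc ((v - 1) mod n) = w i"
      using wi by simp
  qed
  finally show ?thesis .
qed

lemma nx_start:
  assumes "i \<in> {1..n}"
  shows "nx cls i 0 = w i"
  unfolding nx_def
proof (rule Least_equality)
  have "w i \<le> reps * n" "1 \<le> w i"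
    using w_range[OF assms] by (auto simp: reps_def)
  then show "0 < w i \<and> cls (w i) = i"
    using cls_iff[OF _ _ assms, of "w i"] by auto
next
  fix v assume v: "0 < v \<and> cls v = i"
  show "w i \<le> v"
  proof (cases "v \<le> reps * n")
    case True
    then show ?thesis
      using cls_iff[OF _ True assms] v by auto
  next
    case False
    have "n \<le> reps * n" "w i \<le> n"
      using w_range[OF assms] by (auto simp: reps_def)
    then show ?thesis
      using False by linarith
  qed
qed

lemma nx_next:
  assumes "i \<in> {1..n}" "k + 2 \<le> reps"
  shows "nx cls i (w i + k * n) = w i + Suc k * n"
  unfolding nx_def
proof (rule Least_equality)
  have "Suc (Suc k) * n \<le> reps * n"
    using assms(2) by (intro mult_le_mono1) simp
  then have le: "w i + Suc k * n \<le> reps * n"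
    using w_range[OF assms(1)] by auto
  moreover have "1 \<le> w i + Suc k * n"
    using n_pos by auto
  ultimately have "cls (w i + Suc k * n) = i"
    using cls_iff[OF _ _ assms(1)] by blast
  then show "w i + k * n < w i + Suc k * n \<and> cls (w i + Suc k * n) = i"
    using n_pos by simp
  fix v assume v: "w i + k * n < v \<and> cls v = i"
  show "w i + Suc k * n \<le> v"
  proof (cases "v \<le> reps * n")
    case True
    then obtain j where j: "v = w i + j * n"
      using cls_iff[OF _ True assms(1)] v by auto
    then have "k * n < j * n"
      using v by simp
    then have "Suc k * n \<le> j * n"
      by (intro mult_le_mono1) simp
    then show ?thesis
      using j by simp
  next
    case False
    then show ?thesis
      using le by simp
  qed
qed

text \<open>The number of slides is tied to the number of filled boxes and so is bounded by
  \<open>card lp\<close>. This keeps each \<open>e i\<close> in the range where the next letter of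
  class \<open>i\<close> is \<open>e i + n\<close>.\<close>

definition reached :: "(box \<rightharpoonup> nat) \<Rightarrow> bool" where
  "reached T \<longleftrightarrow> (\<exists>xs e. run cls xs T e \<and> card (dom T) = n + length xs \<and>
     (\<forall>i\<in>{1..n}. \<exists>k\<le>length xs. e i = w i + k * n))"

lemma finite_lp: "finite lp"
  using young by (simp add: young_diagram_def)

lemma reached_initial: "reached (initial_filling n b w)"
proof -
  have "initial_filling n b w = initial_filling n b (\<lambda>i. nx cls i 0)"
    unfolding initial_filling_def
    by (intro arg_cong[of _ _ map_of] map_cong refl) (auto simp: nx_start simp del: upt_Suc)
  then have r: "run cls [] (initial_filling n b w) (\<lambda>i. nx cls i 0)"
    using run_start by simp
  have "dom (initial_filling n b w) = b ` {1..n}"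
    using initial_filling_iff[of w] by (auto simp: dom_def)
  moreover have "inj_on b {1..n}"
    using b_inj by (auto simp: inj_on_def)
  ultimately have "card (dom (initial_filling n b w)) = n"
    by (simp add: card_image)
  moreover have "\<exists>k\<le>0. nx cls i 0 = w i + k * n" if "i \<in> {1..n}" for i
    using nx_start[OF that] by simp
  ultimately show ?thesis
    unfolding reached_def using r by (intro exI[of _ "[]"] exI[of _ "\<lambda>i. nx cls i 0"]) auto
qed

lemma reached_inv:
  assumes "reached T"
  obtains xs e where "run cls xs T e" "rest_inv cls e T" "length xs + 2 \<le> reps"
    "\<And>i. i \<in> {1..n} \<Longrightarrow> \<exists>k\<le>length xs. e i = w i + k * n" "card (dom T) = n + length xs"
proof -
  obtain xs e where r: "run cls xs T e" "card (dom T) = n + length xs"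
    "\<And>i. i \<in> {1..n} \<Longrightarrow> \<exists>k\<le>length xs. e i = w i + k * n"
    using assms unfolding reached_def by blast
  have inv: "rest_inv cls e T"
    using run_inv[OF r(1) good_cls] .
  have "card (dom T) \<le> card lp"
    using rest_invD(2)[OF inv] finite_lp by (intro card_mono)
  then have "length xs + 2 \<le> reps"
    using r(2) by (simp add: reps_def)
  then show ?thesis
    using that r inv by blast
qed

lemma reached_refill:
  assumes "reached T" "corner (lp - dom T) x" "slides T x U (b i)" "i \<in> {1..n}" "T (b i) = Some v"
  shows "reached (U(b i := Some (v + n)))"
proof -
  obtain xs e where r: "run cls xs T e" "rest_inv cls e T" "length xs + 2 \<le> reps"
    "\<And>i. i \<in> {1..n} \<Longrightarrow> \<exists>k\<le>length xs. e i = w i + k * n" "card (dom T) = n + length xs"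
    using assms(1) by (rule reached_inv) blast
  have v: "v = e i"
    using rest_invD(3)[OF r(2) assms(4)] assms(5) by simp
  obtain k where k: "k \<le> length xs" "e i = w i + k * n"
    using r(4)[OF assms(4)] by blast
  have nx: "nx cls i (e i) = v + n"
    using nx_next[OF assms(4), of k] k r(3) v by simp
  have "run cls (xs @ [x]) (U(b i := Some (v + n))) (e(i := v + n))"
    using run_step[OF r(1) assms(2-4)] unfolding nx .
  moreover have "dom (U(b i := Some (v + n))) = insert x (dom T)"
    using slides_dom[OF assms(3)] by simp
  then have "card (dom (U(b i := Some (v + n)))) = n + length (xs @ [x])"
    using assms(2) r(5) rest_invD(2)[OF r(2)] finite_subset[OF _ finite_lp]
    by (simp add: corner_def)
  moreover have "\<exists>k\<le>length (xs @ [x]). (e(i := v + n)) j = w j + k * n" if "j \<in> {1..n}" for j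
  proof (cases "j = i")
    case True
    then show ?thesis
      using k v by (intro exI[of _ "Suc k"]) auto
  next
    case False
    then show ?thesis
      using r(4)[OF that] by (auto intro: le_SucI)
  qed
  ultimately show ?thesis
    unfolding reached_def by blast
qed

text \<open>The case without refill is contradictory, since every slide ends in a diagonal
  box.\<close>

lemma reached_fill_step:
  assumes "reached T" "fill_step n lp b T T'"
  shows "reached T'"
  using assms(2)
proof cases
  case (refill x U i v)
  then show ?thesis
    using reached_refill[OF assms(1)] by blast
next
  case (no_refill x y)
  obtain xs e where "rest_inv cls e T"
    using assms(1) by (rule reached_inv) blast
  then have "hole_inv cls e T x"
    using rest_inv_start no_refill by blast
  then show ?thesis
    using slides_inv[of T x T' y cls e] no_refill by blast
qed

lemma fill_step_exists:
  assumes "reached T" "\<not> lp \<subseteq> dom T"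
  shows "\<exists>T'. fill_step n lp b T T' \<and> card (lp - dom T') < card (lp - dom T)"
proof -
  obtain xs e where inv: "rest_inv cls e T"
    using assms(1) by (rule reached_inv) blast
  let ?L = "lp - dom T"
  have fin: "finite ?L" "?L \<noteq> {}"
    using finite_lp assms(2) by auto
  let ?h = "\<lambda>y :: box. fst y + snd y"
  \<comment> \<open>An unfilled box with maximal sum of row and column is a corner of the unfilled
    diagram.\<close>
  have "Max (?h ` ?L) \<in> ?h ` ?L"
    using fin by (intro Max_in) auto
  then obtain x where x: "x \<in> ?L" "Max (?h ` ?L) = ?h x"
    by blast
  have x: "x \<in> ?L" "\<And>y. y \<in> ?L \<Longrightarrow> fst y + snd y \<le> fst x + snd x"
    using x(1) Max_ge[of "?h ` ?L"] fin(1) unfolding x(2)[symmetric] by auto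
  have up: "y \<in> dom T" if "z \<in> dom T" "y \<in> lp" "nw z y" for z y
    using inv that unfolding rest_inv_def by blast
  have "young_diagram (?L - {x})"
    unfolding young_diagram_def
  proof (intro conjI ballI)
    show "finite (?L - {x})"
      using fin by simp
    show "?L - {x} \<subseteq> {1..} \<times> {1..}"
      using lp_pos by (auto simp: mem_Times_iff)
    fix y assume y: "y \<in> ?L - {x}"
    show "case y of (i, j) \<Rightarrow> {1..i} \<times> {1..j} \<subseteq> ?L - {x}"
    proof (clarify)
      fix i j i' j' assume ij: "y = (i, j)" "i' \<in> {1..i}" "j' \<in> {1..j}"
      let ?z = "(i', j')"
      have nw: "nw ?z y"
        using ij by (auto simp: nw_def)
      have "?z \<in> lp"
        using lp_nw[OF _ nw] y ij by auto
      moreover have "?z \<notin> dom T"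
        using up[OF _ _ nw] y by blast
      moreover have "?z \<noteq> x"
      proof
        assume zx: "?z = x"
        then have "fst y + snd y \<le> i' + j'"
          using x(2)[of y] y by auto
        then have "y = x"
          using ij zx by auto
        then show False
          using y by simp
      qed
      ultimately show "?z \<in> ?L - {x}"
        by blast
    qed
  qed
  then have cor: "corner ?L x"
    using x(1) by (simp add: corner_def)
  have hi: "hole_inv cls e T x"
    using rest_inv_start[OF inv cor] .
  obtain U y where sl: "slides T x U y"
    using slides_exists[OF hi] by blast
  then obtain i where i: "i \<in> {1..n}" "y = b i"
    using slides_inv[OF sl hi] by blast
  have "fill_step n lp b T (U(b i := Some (e i + n)))"
    by (rule refill[OF cor _ i(1)]) (use sl i rest_invD(3)[OF inv i(1)] in auto)
  moreover have "dom (U(b i := Some (e i + n))) = insert x (dom T)"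
    using slides_dom[OF sl] i by simp
  then have "lp - dom (U(b i := Some (e i + n))) \<subset> ?L"
    using x(1) by auto
  then have "card (lp - dom (U(b i := Some (e i + n)))) < card ?L"
    using fin by (intro psubset_card_mono)
  ultimately show ?thesis
    by blast
qed

lemma slide_filling_exists: "\<exists>T. slide_filling n lp b w T"
proof -
  have "\<exists>T'. (fill_step n lp b)\<^sup>*\<^sup>* T T' \<and> lp \<subseteq> dom T'" if "reached T" for T
    using that
  proof (induction "card (lp - dom T)" arbitrary: T rule: less_induct)
    case less
    show ?case
    proof (cases "lp \<subseteq> dom T")
      case False
      then obtain T1 where T1: "fill_step n lp b T T1" "card (lp - dom T1) < card (lp - dom T)"
        using fill_step_exists[OF less.prems] by blast
      then show ?thesis
        using less.hyps[OF T1(2) reached_fill_step[OF less.prems T1(1)]]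
        by (meson converse_rtranclp_into_rtranclp)
    qed blast
  qed
  then show ?thesis
    using reached_initial unfolding slide_filling_def by blast
qed

lemma slide_filling_reached:
  assumes "slide_filling n lp b w T"
  shows "reached T"
proof -
  have "(fill_step n lp b)\<^sup>*\<^sup>* (initial_filling n b w) T"
    using assms by (simp add: slide_filling_def)
  then show ?thesis
    by (induction rule: rtranclp_induct) (auto intro: reached_initial reached_fill_step)
qed

lemma filter_class_block:
  assumes "i \<in> {1..n}"
  shows "filter (\<lambda>v. v \<le> m * n) (class_block class_list i) = map (\<lambda>k. w i + k * n) [0..<m]"
proof (rule strict_sorted_equal)
  show "sorted_wrt (<) (filter (\<lambda>v. v \<le> m * n) (class_block class_list i))"
    by (intro sorted_wrt_filter sorted_class_block)
  have "sorted_wrt (\<lambda>k l. k < l) [0..<m]"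
    by (rule sorted_wrt_upt)
  then show "sorted_wrt (<) (map (\<lambda>k. w i + k * n) [0..<m])"
    unfolding sorted_wrt_map by (rule sorted_wrt_mono_rel[rotated]) (use n_pos in auto)
  have mr: "m * n \<le> reps * n" "reps * n \<le> length class_list"
    using length_class_list mult_le_mono1[of m reps n] by (simp_all add: reps_def)
  have mr': "v \<le> reps * n" "v \<le> length class_list" if "v \<le> m * n" for v
    using that mr by linarith+
  have wi: "1 \<le> w i" "w i \<le> n"
    using w_range[OF assms] by auto
  show "set (filter (\<lambda>v. v \<le> m * n) (class_block class_list i)) = set (map (\<lambda>k. w i + k * n) [0..<m])"
  proof (rule set_eqI)
    fix v
    have "v \<in> set (filter (\<lambda>v. v \<le> m * n) (class_block class_list i)) \<longleftrightarrow> 1 \<le> v \<and> v \<le> m * n \<and> cls v = i"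
      using mr'[of v] by (auto simp: set_class_block class_fun_def)
    also have "\<dots> \<longleftrightarrow> 1 \<le> v \<and> v \<le> m * n \<and> (\<exists>k. v = w i + k * n)"
      using cls_iff[OF _ _ assms, of v] mr'(1)[of v] by auto
    also have "\<dots> \<longleftrightarrow> (\<exists>k<m. v = w i + k * n)"
    proof
      assume *: "1 \<le> v \<and> v \<le> m * n \<and> (\<exists>k. v = w i + k * n)"
      then obtain k where k: "v = w i + k * n"
        by blast
      then have "k * n < m * n"
        using * wi by linarith
      then show "\<exists>k<m. v = w i + k * n"
        using k by auto
    next
      assume "\<exists>k<m. v = w i + k * n"
      then obtain k where k: "k < m" "v = w i + k * n"
        by blast
      then have "Suc k * n \<le> m * n"
        by (intro mult_le_mono1) simp
      then show "1 \<le> v \<and> v \<le> m * n \<and> (\<exists>k. v = w i + k * n)"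
        using k wi by auto
    qed
    also have "\<dots> \<longleftrightarrow> v \<in> set (map (\<lambda>k. w i + k * n) [0..<m])"
      by auto
    finally show "v \<in> set (filter (\<lambda>v. v \<le> m * n) (class_block class_list i)) \<longleftrightarrow>
        v \<in> set (map (\<lambda>k. w i + k * n) [0..<m])" .
  qed
qed

lemma filter_class_word: "filter (\<lambda>v. v \<le> m * n) (class_word n class_list) = aug n m w"
  unfolding class_word_def aug_def filter_concat map_map
  by (intro arg_cong[of _ _ concat] map_cong refl)
    (auto simp: filter_class_block comp_def simp del: upt_Suc)

lemma unique_class_list: "unique_rows n class_list"
  unfolding class_list_def
  using unique_rows_equiv[OF permutation_power_columns_equiv[OF classes(1,2) n_pos]] unique_rows_columns
  by blast

definition insertion_row :: "nat \<Rightarrow> nat" where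
  "insertion_row = (SOME \<rho>. inserted (class_word n class_list) \<rho>)"

lemma inserted_insertion_row: "inserted (class_word n class_list) insertion_row"
  unfolding insertion_row_def using inserted_rows_rep[OF distinct_class_word] by (metis someI_ex)

lemma insertion_row_support: "insertion_row v \<noteq> 0 \<longleftrightarrow> 1 \<le> v \<and> v \<le> length class_list"
proof -
  have "set (class_word n class_list) = {v. 1 \<le> v \<and> v \<le> length class_list}"
    unfolding set_class_word using class_list_range nth_mem[of _ class_list]
    by (auto simp: subset_iff)
  then show ?thesis
    using inserted_support[OF inserted_insertion_row] by simp
qed

definition insertion_tokens :: "(nat \<times> nat) list" where
  "insertion_tokens = map (\<lambda>k. (class_list ! k, insertion_row (Suc k))) [0..<length class_list]"

lemma map_fst_tokens: "map fst (map (\<lambda>k. (class_list ! k, f k)) [0..<length class_list]) = class_list"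
  by (simp add: comp_def map_nth)

lemma class_list_nth: "k < length class_list \<Longrightarrow> 1 \<le> class_list ! k \<and> class_list ! k \<le> n"
  using class_list_range nth_mem[of k class_list] by (auto simp: subset_iff)

lemma insertion_system_tokens: "insertion_system n insertion_tokens"
  unfolding insertion_system_def insertion_tokens_def map_fst_tokens
  using inserted_insertion_row class_list_nth by auto

text \<open>The completed run and the insertion provide tokens over the same class list, each in its
  own row system, so uniqueness of rows identifies them.\<close>

lemma row_of_eq_insertion_row:
  assumes "run cls xs T e" "dom T = lp" "1 \<le> v" "v \<le> length class_list"
  shows "row_of cls T v (insertion_row v)"
proof -
  have "\<exists>r. row_of cls T v r" for v
    unfolding row_of_def by (auto simp: ran_def)
  then obtain f where f: "\<And>v. row_of cls T v (f v)"
    by metis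
  let ?z = "map (\<lambda>k. (class_list ! k, f (Suc k))) [0..<length class_list]"
  have sys: "slide_system xs ?z"
    unfolding slide_system_def map_fst_tokens using assms(1,2) f class_list_nth by auto
  have fst: "map fst insertion_tokens = class_list"
    unfolding insertion_tokens_def by (rule map_fst_tokens)
  have "?z = insertion_tokens"
    by (rule unique_class_list[unfolded unique_rows_def, rule_format, OF slide_row_system
        insertion_row_system sys insertion_system_tokens map_fst_tokens fst])
  then have "snd (?z ! (v - 1)) = snd (insertion_tokens ! (v - 1))"
    by simp
  then have "f v = insertion_row v"
    using assms(3,4) by (simp add: insertion_tokens_def)
  then show ?thesis
    using f by metis
qed

lemma insertion_row_count:
  assumes "1 \<le> r" "r \<le> n"
  shows "Suc m \<le> r + card {v. v \<le> m * n \<and> insertion_row v = r}"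
proof -
  have mr: "m \<le> reps" "m * n \<le> length class_list"
    using length_class_list mult_le_mono1[of m reps n] by (auto simp: reps_def)
  have "Suc m \<le> r + count (mset (map snd (take (m * n) insertion_tokens))) r"
    by (rule row_system.row_count_lower[OF insertion_row_system classes(1,2) n_pos assms mr(1)
          insertion_system_tokens])
      (unfold insertion_tokens_def map_fst_tokens, rule class_list_def)
  also have "map snd (take (m * n) insertion_tokens) = map (\<lambda>k. insertion_row (Suc k)) [0..<m * n]"
    using mr(2) by (simp add: insertion_tokens_def take_map comp_def)
  also have "count (mset \<dots>) r = card {k. k < m * n \<and> insertion_row (Suc k) = r}"
    by (rule count_mset_map_upt)
  also have "\<dots> = card (Suc ` {k. k < m * n \<and> insertion_row (Suc k) = r})"
    by (rule card_image[symmetric]) simp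
  also have "Suc ` {k. k < m * n \<and> insertion_row (Suc k) = r} = {v. v \<le> m * n \<and> insertion_row v = r}"
  proof (intro set_eqI iffI)
    fix v assume v: "v \<in> {v. v \<le> m * n \<and> insertion_row v = r}"
    then have "1 \<le> v"
      using insertion_row_support[of v] assms(1) by auto
    then show "v \<in> Suc ` {k. k < m * n \<and> insertion_row (Suc k) = r}"
      using v by (intro image_eqI[of _ _ "v - 1"]) auto
  qed auto
  finally show ?thesis .
qed

text \<open>Let \<open>ls\<close> list the letters in a given row of the tableau of the whole class
  list. The row of \<open>T\<close> is the initial segment of \<open>ls\<close> up to
  \<open>e i\<close>, and the row of the insertion tableau is the one up to \<open>m * n\<close>.
  Both have at least \<open>c\<close> letters, so they agree in every column of
  \<open>lp\<close>.\<close>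

lemma filling_eq_tableau:
  assumes "slide_filling n lp b w T"
  shows "dom T = lp" "x \<in> lp \<Longrightarrow> T x = insertion_tableau (aug n m w) x"
proof -
  obtain xs e where r: "run cls xs T e" "rest_inv cls e T" "length xs + 2 \<le> reps"
    "\<And>i. i \<in> {1..n} \<Longrightarrow> \<exists>k\<le>length xs. e i = w i + k * n"
    using slide_filling_reached[OF assms] by (rule reached_inv) blast
  show dom: "dom T = lp"
    using assms rest_invD(2)[OF r(2)] by (auto simp: slide_filling_def)
  note C = core_invD[OF rest_invD(1)[OF r(2)]]
  assume "x \<in> lp"
  define row where "row = fst x"
  define q where "q = snd x"
  define i where "i = Suc n - row"
  define c where "c = snd (b i)"
  have x: "x = (row, q)"
    by (simp add: row_def q_def)
  have bounds: "1 \<le> row" "row \<le> n" "1 \<le> q" "q \<le> c"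
    using lp_pos[OF \<open>x \<in> lp\<close>] row_end[OF \<open>x \<in> lp\<close>] by (auto simp: row_def q_def c_def i_def)
  then have i: "i \<in> {1..n}"
    by (auto simp: i_def)
  then have i: "i \<in> {1..n}" "fst (b i) = row"
    using b_row[OF i] bounds by (auto simp: i_def)
  have in_lp: "(row, j) \<in> lp \<longleftrightarrow> 1 \<le> j \<and> j \<le> c" for j
  proof
    assume "(row, j) \<in> lp"
    then show "1 \<le> j \<and> j \<le> c"
      using lp_pos[of "(row, j)"] row_end[of "(row, j)"] by (auto simp: c_def i_def)
  next
    assume "1 \<le> j \<and> j \<le> c"
    then show "(row, j) \<in> lp"
      using lp_nw[OF b_in[OF i(1)], of "(row, j)"] i(2) bounds by (auto simp: nw_def c_def)
  qed
  define f where "f j = the (T (row, Suc j))" for j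
  have f: "T (row, Suc j) = Some (f j)" if "j < c" for j
    using that in_lp[of "Suc j"] dom unfolding f_def by auto
  have e_le: "e i \<le> length class_list"
  proof -
    obtain k where k: "k \<le> length xs" "e i = w i + k * n"
      using r(4)[OF i(1)] by blast
    then have "Suc k * n \<le> reps * n"
      using r(3) by (intro mult_le_mono1) simp
    then show ?thesis
      using k w_range[OF i(1)] length_class_list by auto
  qed
  define ls where "ls = sorted_list_of_set {v. v \<le> length class_list \<and> insertion_row v = row}"
  have ls: "sorted_wrt (<) ls" "set ls = {v. v \<le> length class_list \<and> insertion_row v = row}"
    unfolding ls_def by auto
  have T_row: "sorted_wrt (<) (map f [0..<c])"
  proof -
    have "f j < f k" if "j < k" "k < c" for j k
      using C(1)[OF f[of j] f[of k]] that by (auto simp: nw_def)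
    then show ?thesis
      by (auto simp: sorted_wrt_iff_nth_less)
  qed
  have T_set: "set (map f [0..<c]) = {v \<in> set ls. v \<le> e i}"
  proof (intro set_eqI iffI)
    fix v assume "v \<in> set (map f [0..<c])"
    then obtain j where j: "j < c" "v = f j"
      by auto
    have Tj: "T (row, Suc j) = Some v"
      using f[OF j(1)] j(2) by simp
    have "v \<le> e i"
      using C(5)[OF i(1) Tj] j(1) i(2) by (simp add: nw_def c_def)
    moreover have "1 \<le> v"
      using core_inv_class(1)[OF rest_invD(1)[OF r(2)] Tj] .
    ultimately have "row_of cls T v (insertion_row v)"
      using row_of_eq_insertion_row[OF r(1) dom] e_le by simp
    then have "insertion_row v = row"
      unfolding row_of_def
    proof (elim disjE exE conjE)
      fix y assume "T y = Some v" "fst y = insertion_row v"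
      then show ?thesis
        using C(2)[OF Tj, of y] by auto
    qed (use ranI[of T "(row, Suc j)" v] Tj in simp)
    then show "v \<in> {v \<in> set ls. v \<le> e i}"
      using \<open>v \<le> e i\<close> e_le ls(2) by simp
  next
    fix v assume "v \<in> {v \<in> set ls. v \<le> e i}"
    then have v: "v \<le> length class_list" "insertion_row v = row" "v \<le> e i"
      using ls(2) by auto
    have v1: "1 \<le> v"
      using insertion_row_support[of v] v(2) bounds(1) by auto
    have rv: "row_of cls T v row"
      using row_of_eq_insertion_row[OF r(1) dom v1 v(1)] v(2) by simp
    show "v \<in> set (map f [0..<c])"
    proof (cases rule: row_of_cases[OF r(2) v1 rv, case_names present absent])
      case (present y)
      then have "y = (row, snd y)" "y \<in> lp"
        using dom by (auto simp: prod_eq_iff)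
      then have "1 \<le> snd y" "snd y \<le> c"
        using in_lp[of "snd y"] by auto
      then have "snd y - 1 < c" "v = f (snd y - 1)"
        using present \<open>y = (row, snd y)\<close> f[of "snd y - 1"] by auto
      then show ?thesis
        by auto
    next
      case absent
      \<comment> \<open>An absent letter is assigned its home row, so here its class is
        \<open>i\<close> and it exceeds \<open>e i\<close>, against the choice of
        \<open>v\<close>.\<close>
      then have "cls v = i"
        using b_row[of "cls v"] bounds by (auto simp: i_def)
      then show ?thesis
        using absent v(3) by simp
    qed
  qed
  define P where "P = insertion_rows (aug n m w)"
  define L where "L = P ! (row - 1)"
  have aug: "distinct (aug n m w)" "inserted (aug n m w) (restrict_rows (m * n) insertion_row)"
    unfolding filter_class_word[symmetric]
    using distinct_class_word restrict_inserted[OF inserted_insertion_row] by auto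
  obtain \<rho> where \<rho>: "inserted (aug n m w) \<rho>" "rows_rep 1 P \<rho>"
    unfolding P_def using inserted_rows_rep[OF aug(1)] by blast
  have \<rho>_eq: "\<rho> = restrict_rows (m * n) insertion_row"
    using inserted_deterministic[OF \<rho>(1) aug(2)] .
  have ml: "m * n \<le> length class_list"
    using length_class_list mult_le_mono1[of m reps n] by (simp add: reps_def)
  \<comment> \<open>The length of this row of \<open>lp\<close> is at most the number of letters up
    to \<open>m * n\<close> guaranteed in the row.\<close>
  have cm: "c + row \<le> Suc m"
    using b_col_le[OF i(1)] bounds by (auto simp: c_def i_def)
  let ?B = "{v. v \<le> m * n \<and> insertion_row v = row}"
  have cardB: "c \<le> card ?B"
    using insertion_row_count[OF bounds(1,2)] cm by linarith
  have rowB: "{v. \<rho> v = row} = ?B"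
    using bounds(1) by (auto simp: \<rho>_eq restrict_rows_def)
  have "0 < card ?B"
    using cardB bounds by linarith
  then have "?B \<noteq> {}"
    by (metis card.empty less_irrefl)
  then obtain v0 where "\<rho> v0 = row"
    using rowB by auto
  then have lenP: "row - 1 < length P"
  proof -
    have "\<rho> v0 < 1 + length P"
      using \<rho>(2) unfolding rows_rep_def by blast
    then show ?thesis
      using \<open>\<rho> v0 = row\<close> bounds(1) by linarith
  qed
  then have L: "sorted_wrt (<) L" "set L = ?B"
    using \<rho>(2) bounds(1) rowB unfolding rows_rep_def L_def by auto
  have "length L = card ?B"
    using L by (metis distinct_card strict_sorted_iff)
  then have qL: "q - 1 < length L"
    using cardB bounds by linarith
  have "set L = {v \<in> set ls. v \<le> m * n}"
    using L(2) ls(2) ml by auto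
  then have "L ! (q - 1) = ls ! (q - 1)"
    using sorted_nth_initial[OF ls(1) L(1) _ qL] by simp
  moreover have "map f [0..<c] ! (q - 1) = ls ! (q - 1)"
    by (rule sorted_nth_initial[OF ls(1) T_row T_set]) (use bounds in simp)
  ultimately have "T x = Some (L ! (q - 1))"
    using f[of "q - 1"] bounds x by simp
  moreover have "insertion_tableau (aug n m w) x = Some (L ! (q - 1))"
    unfolding insertion_tableau_def filling_of_rows_def P_def[symmetric] x
    using lenP qL bounds by (auto simp: L_def)
  ultimately show "T x = insertion_tableau (aug n m w) x"
    by simp
qed

text \<open>Every outcome is the restricted tableau. As some complete run exists, the restricted
  tableau is itself an outcome, which gives the converse.\<close>

lemma slide_filling_iff:
  "lp \<subseteq> dom (insertion_tableau (aug n m w))"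
  "slide_filling n lp b w T \<longleftrightarrow> T = insertion_tableau (aug n m w) |` lp"
proof -
  let ?I = "insertion_tableau (aug n m w)"
  have eq: "T = ?I |` lp" if "slide_filling n lp b w T" for T
  proof
    fix x
    show "T x = (?I |` lp) x"
      using filling_eq_tableau[OF that] by (cases "x \<in> lp") auto
  qed
  obtain T0 where T0: "slide_filling n lp b w T0"
    using slide_filling_exists by blast
  show "lp \<subseteq> dom ?I"
  proof
    fix x assume "x \<in> lp"
    then show "x \<in> dom ?I"
      using filling_eq_tableau[OF T0] by (metis domIff)
  qed
  show "slide_filling n lp b w T \<longleftrightarrow> T = ?I |` lp"
    using eq T0 by metis
qed

end

theorem theorem5p1:
  fixes n m :: nat and lp lm :: "box set" and b :: "nat \<Rightarrow> box" and w :: "nat \<Rightarrow> nat"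
  assumes "1 \<le> n" and "n \<le> m"
    and "is_diagonal n ({1..n} \<times> {1..m}) lp lm b"
    and "w permutes {1..n}"
  shows "lp \<subseteq> dom (insertion_tableau (aug n m w)) \<and>
    (\<forall>T. slide_filling n lp b w T \<longleftrightarrow> T = insertion_tableau (aug n m w) |` lp)"
proof -
  interpret diagonal n lp b
    by (rule is_diagonal_diagonal(1)[OF assms(3,1)])
  interpret diagonal_filling n lp b m w
    by standard (use assms is_diagonal_diagonal(2)[OF assms(3,1)] in auto)
  show ?thesis
    using slide_filling_iff by blast
qed

end
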